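(* There is an algorithm which, given a finite poset $\mathcal{P}=(P,\leq^\mathcal{P})$ of width $w$ whose elements are colored by a map $\lambda:P\to\Lambda$ ($\Lambda$ a finite set), and a first-order sentence $\phi$ in negation normal form, decides whether $\mathcal{P}\models\phi$ in time $f(w,\phi)\cdot|P|^2$, where $f$ is a computable function (i.e., in FPT time with respect to the parameters $w$ and $\phi$).
   Context: The width of a poset is the maximum cardinality of an antichain (a set of pairwise incomparable elements). First-order formulas are evaluated over colored posets in the vocabulary consisting of the binary relation $\leq^\mathcal{P}$ and one unary predicate $c(x)$ for each color $c\in\Lambda$ (meaning $\lambda(x)=c$); atoms are $x=y$, $x\leq^\mathcal{P} y$ and $c(x)$. A formula is in negation normal form if negations occur only in front of atoms. *)

theory Defs
  imports Main
begin

section \<open>Posets\<close>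

definition antichain :: "'a set \<Rightarrow> 'a rel \<Rightarrow> 'a set \<Rightarrow> bool" where
  "antichain P r A \<longleftrightarrow>
     A \<subseteq> P \<and> (\<forall>x\<in>A. \<forall>y\<in>A. x \<noteq> y \<longrightarrow> (x, y) \<notin> r \<and> (y, x) \<notin> r)"

definition width :: "'a set \<Rightarrow> 'a rel \<Rightarrow> nat" where
  "width P r = Max (card ` {A. antichain P r A})"

section \<open>First-order logic of colored posets\<close>

text \<open>Variables are natural numbers; \<open>'c\<close> is the type of color names.\<close>

datatype 'c fm =
    Eq nat nat
  | Leq nat nat
  | Color 'c nat
  | Neg "'c fm"
  | And "'c fm" "'c fm"
  | Or "'c fm" "'c fm"
  | Ex nat "'c fm"
  | All nat "'c fm"

fun sat :: "'a set \<Rightarrow> 'a rel \<Rightarrow> ('a \<Rightarrow> 'c) \<Rightarrow> (nat \<Rightarrow> 'a) \<Rightarrow> 'c fm \<Rightarrow> bool" where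
  "sat P r col e (Eq x y) \<longleftrightarrow> e x = e y"
| "sat P r col e (Leq x y) \<longleftrightarrow> (e x, e y) \<in> r"
| "sat P r col e (Color c x) \<longleftrightarrow> col (e x) = c"
| "sat P r col e (Neg \<phi>) \<longleftrightarrow> \<not> sat P r col e \<phi>"
| "sat P r col e (And \<phi> \<psi>) \<longleftrightarrow> sat P r col e \<phi> \<and> sat P r col e \<psi>"
| "sat P r col e (Or \<phi> \<psi>) \<longleftrightarrow> sat P r col e \<phi> \<or> sat P r col e \<psi>"
| "sat P r col e (Ex x \<phi>) \<longleftrightarrow> (\<exists>a\<in>P. sat P r col (e(x := a)) \<phi>)"
| "sat P r col e (All x \<phi>) \<longleftrightarrow> (\<forall>a\<in>P. sat P r col (e(x := a)) \<phi>)"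

fun free_vars :: "'c fm \<Rightarrow> nat set" where
  "free_vars (Eq x y) = {x, y}"
| "free_vars (Leq x y) = {x, y}"
| "free_vars (Color c x) = {x}"
| "free_vars (Neg \<phi>) = free_vars \<phi>"
| "free_vars (And \<phi> \<psi>) = free_vars \<phi> \<union> free_vars \<psi>"
| "free_vars (Or \<phi> \<psi>) = free_vars \<phi> \<union> free_vars \<psi>"
| "free_vars (Ex x \<phi>) = free_vars \<phi> - {x}"
| "free_vars (All x \<phi>) = free_vars \<phi> - {x}"

definition sentence :: "'c fm \<Rightarrow> bool" where
  "sentence \<phi> \<longleftrightarrow> free_vars \<phi> = {}"

text \<open>For a sentence the choice of the initial assignment is immaterial.\<close>

definition models :: "'a set \<Rightarrow> 'a rel \<Rightarrow> ('a \<Rightarrow> 'c) \<Rightarrow> 'c fm \<Rightarrow> bool" where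
  "models P r col \<phi> \<longleftrightarrow> sat P r col (\<lambda>_. undefined) \<phi>"

fun atomic :: "'c fm \<Rightarrow> bool" where
  "atomic (Eq x y) = True"
| "atomic (Leq x y) = True"
| "atomic (Color c x) = True"
| "atomic _ = False"

fun nnf :: "'c fm \<Rightarrow> bool" where
  "nnf (Neg \<phi>) \<longleftrightarrow> atomic \<phi>"
| "nnf (And \<phi> \<psi>) \<longleftrightarrow> nnf \<phi> \<and> nnf \<psi>"
| "nnf (Or \<phi> \<psi>) \<longleftrightarrow> nnf \<phi> \<and> nnf \<psi>"
| "nnf (Ex x \<phi>) \<longleftrightarrow> nnf \<phi>"
| "nnf (All x \<phi>) \<longleftrightarrow> nnf \<phi>"
| "nnf _ = True"

section \<open>Machine model\<close>

text \<open>
  Algorithms are programs of a uniform-cost random access machine, written as while programs.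
  A program accesses finitely many registers, each holding a natural number, and finitely many
  arrays with unboundedly many cells (indirect addressing). The only arithmetic is
  addition and truncated subtraction. Without multiplication, the usual convention
  of unit cost per operation is within a polynomial of Turing machine time.
\<close>

datatype aexp =
    N nat
  | V nat           \<comment> \<open>register\<close>
  | Rd nat aexp     \<comment> \<open>array name and cell index\<close>
  | Plus aexp aexp
  | Minus aexp aexp

datatype com =
    Skip
  | Assign nat aexp
  | Store nat aexp aexp   \<comment> \<open>array name, cell index, new content\<close>
  | Seq com com
  | If aexp com com       \<comment> \<open>a condition holds iff its value is nonzero\<close>
  | While aexp com

type_synonym state = "(nat \<Rightarrow> nat) \<times> (nat \<Rightarrow> nat \<Rightarrow> nat)"

fun aval :: "aexp \<Rightarrow> state \<Rightarrow> nat" where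
  "aval (N k) s = k"
| "aval (V x) s = fst s x"
| "aval (Rd A a) s = snd s A (aval a s)"
| "aval (Plus a b) s = aval a s + aval b s"
| "aval (Minus a b) s = aval a s - aval b s"

fun acost :: "aexp \<Rightarrow> nat" where
  "acost (N k) = 1"
| "acost (V x) = 1"
| "acost (Rd A a) = 1 + acost a"
| "acost (Plus a b) = 1 + acost a + acost b"
| "acost (Minus a b) = 1 + acost a + acost b"

text \<open>\<open>exec c s t s'\<close>: started in state \<open>s\<close>, the program \<open>c\<close> halts after \<open>t\<close> time units in
  state \<open>s'\<close>.\<close>

inductive exec :: "com \<Rightarrow> state \<Rightarrow> nat \<Rightarrow> state \<Rightarrow> bool" where
  Skip: "exec Skip s 1 s"
| Assign: "exec (Assign x a) s (1 + acost a) ((fst s)(x := aval a s), snd s)"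
| Store: "exec (Store A a b) s (1 + acost a + acost b)
            (fst s, (snd s)(A := (snd s A)(aval a s := aval b s)))"
| Seq: "exec c s t s' \<Longrightarrow> exec d s' u s'' \<Longrightarrow> exec (Seq c d) s (t + u) s''"
| IfTrue: "aval a s \<noteq> 0 \<Longrightarrow> exec c s t s' \<Longrightarrow> exec (If a c d) s (1 + acost a + t) s'"
| IfFalse: "aval a s = 0 \<Longrightarrow> exec d s t s' \<Longrightarrow> exec (If a c d) s (1 + acost a + t) s'"
| WhileFalse: "aval a s = 0 \<Longrightarrow> exec (While a c) s (1 + acost a) s"
| WhileTrue: "aval a s \<noteq> 0 \<Longrightarrow> exec c s t s' \<Longrightarrow> exec (While a c) s' u s'' \<Longrightarrow>
            exec (While a c) s (1 + acost a + t + u) s''"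

inductive_cases exec_SkipE: "exec Skip s t s'"
inductive_cases exec_AssignE: "exec (Assign x a) s t s'"
inductive_cases exec_StoreE: "exec (Store A a b) s t s'"
inductive_cases exec_SeqE: "exec (Seq c d) s t s'"
inductive_cases exec_IfE: "exec (If a c d) s t s'"
inductive_cases exec_WhileE: "exec (While a c) s t s'"

lemma exec_deterministic:
  "exec c s t s' \<Longrightarrow> exec c s u s'' \<Longrightarrow> t = u \<and> s' = s''"
proof (induction arbitrary: u s'' rule: exec.induct)
  case (Skip s)
  from Skip.prems show ?case by (rule exec_SkipE) simp
next
  case (Assign x a s)
  from Assign.prems show ?case by (rule exec_AssignE) simp
next
  case (Store A a b s)
  from Store.prems show ?case by (rule exec_StoreE) simp
next
  case (Seq c s t s' d u' s2)
  from Seq.prems show ?case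
  proof (rule exec_SeqE)
    fix t1 s1 u1
    assume u: "u = t1 + u1" and c: "exec c s t1 s1" and d: "exec d s1 u1 s''"
    from Seq.IH(1)[OF c] d have "exec d s' u1 s''" by simp
    from Seq.IH(1)[OF c] Seq.IH(2)[OF this] u show ?thesis by simp
  qed
next
  case (IfTrue a s c t s' d)
  from IfTrue.prems show ?case
  proof (rule exec_IfE)
    fix t1
    assume u: "u = Suc (acost a + t1)" and c: "exec c s t1 s''"
    from IfTrue.IH[OF c] u show ?thesis by simp
  qed (simp add: IfTrue.hyps)
next
  case (IfFalse a s d t s' c)
  from IfFalse.prems show ?case
  proof (rule exec_IfE)
    fix t1
    assume u: "u = Suc (acost a + t1)" and d: "exec d s t1 s''"
    from IfFalse.IH[OF d] u show ?thesis by simp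
  qed (simp add: IfFalse.hyps)
next
  case (WhileFalse a s c)
  from WhileFalse.prems show ?case
    by (rule exec_WhileE) (simp_all add: WhileFalse.hyps)
next
  case (WhileTrue a s c t s' u' s2)
  from WhileTrue.prems show ?case
  proof (rule exec_WhileE)
    fix t1 s1 u1
    assume u: "u = Suc (acost a + t1 + u1)"
      and c: "exec c s t1 s1" and w: "exec (While a c) s1 u1 s''"
    from WhileTrue.IH(1)[OF c] w have "exec (While a c) s' u1 s''" by simp
    from WhileTrue.IH(1)[OF c] WhileTrue.IH(2)[OF this] u show ?thesis by simp
  qed (simp add: WhileTrue.hyps)
qed

text \<open>The input word is in array 0 and its length in register 0; everything else is 0.
  The output is read from register 0.\<close>

definition init :: "nat list \<Rightarrow> state" where
  "init ws =
     ((\<lambda>_. 0)(0 := length ws),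
      (\<lambda>_ _. 0)(0 := (\<lambda>i. if i < length ws then ws ! i else 0)))"

definition outputs_in :: "com \<Rightarrow> nat list \<Rightarrow> nat \<Rightarrow> nat \<Rightarrow> bool" where
  "outputs_in p ws t v \<longleftrightarrow> (\<exists>s. exec p (init ws) t s \<and> fst s 0 = v)"

section \<open>Encoding of inputs\<close>

text \<open>Formulas are written in prefix notation.\<close>

fun encode_fm :: "nat fm \<Rightarrow> nat list" where
  "encode_fm (Eq x y) = [0, x, y]"
| "encode_fm (Leq x y) = [1, x, y]"
| "encode_fm (Color c x) = [2, c, x]"
| "encode_fm (Neg \<phi>) = 3 # encode_fm \<phi>"
| "encode_fm (And \<phi> \<psi>) = 4 # encode_fm \<phi> @ encode_fm \<psi>"
| "encode_fm (Or \<phi> \<psi>) = 5 # encode_fm \<phi> @ encode_fm \<psi>"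
| "encode_fm (Ex x \<phi>) = 6 # x # encode_fm \<phi>"
| "encode_fm (All x \<phi>) = 7 # x # encode_fm \<phi>"

text \<open>A finite poset whose elements are listed as \<open>xs\<close> is given by the number of its
  elements, the 0/1-matrix of its order relation (row by row) and the list of colors.\<close>

definition encode_poset :: "'a list \<Rightarrow> 'a rel \<Rightarrow> ('a \<Rightarrow> nat) \<Rightarrow> nat list" where
  "encode_poset xs r col =
     length xs # [if (x, y) \<in> r then 1 else 0. x \<leftarrow> xs, y \<leftarrow> xs] @ map col xs"

definition computable :: "(nat \<Rightarrow> nat fm \<Rightarrow> nat) \<Rightarrow> bool" where
  "computable f \<longleftrightarrow> (\<exists>q. \<forall>w \<phi>. \<exists>t. outputs_in q (w # encode_fm \<phi>) t (f w \<phi>))"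

end

theory Submission
  imports Defs
begin

text \<open>
  Add a least and a greatest element to the poset and partition it into boundedly many chains, each of
  one colour. For a class \<open>S\<close> of such a partition let the class functions map \<open>x\<close> to the least element of
  \<open>S\<close> above \<open>x\<close> (or not below \<open>x\<close>) and to the greatest element of \<open>S\<close> below \<open>x\<close> (or not above \<open>x\<close>).
  They form a system closed under adjoints: comparing \<open>f x\<close> with \<open>b\<close> amounts to comparing \<open>x\<close> with
  \<open>g b\<close>. Hence comparisons between terms in \<open>y\<close> and terms in other elements reduce to comparisons
  of \<open>y\<close> itself with terms in the other elements. Starting with the given partition, refine
  the classes repeatedly, two elements staying together when all terms of depth \<open>d\<close> in the
  functions of the coarser classes look the same at both; \<open>d\<close> roughly doubles with each level. If \<open>y\<close> is a
  witness of a quantifier of rank \<open>k\<close>, then so is the least element of its class at level \<open>k\<close> which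
  satisfies all lower bounds that \<open>y\<close> satisfies with respect to the terms in the elements chosen
  before, and this element is a class function applied to such a term. So a quantifier may be
  restricted to the values of boundedly many terms, starting from the least element alone, and the
  restricted formula is evaluated by brute force.

  The chains come from an on-line algorithm that places each element, in order of a linear extension,
  on the first suitable chain of a list of groups and then exchanges neighbouring groups
  so that the heads of the chains in a group remain an antichain. Quadratic time is afforded by
  evaluating a class function by a scan of all elements.
\<close>

section \<open>Weakest preconditions with running times\<close>

text \<open>The number of witnesses must be bounded in \<open>w\<close> and the formula; finding
  each may cost a few scans of the poset. Every class receives both ends, so the class functions are
  total and a missing minimum or maximum shows up as an end; the ends form classes of their own, so
  elements in equal classes behave alike there. The recurrence
  \<open>d (Suc k) = 2 * d k + 1\<close> is the price of one round: adjoints turn a comparison of a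
  depth \<open>d\<close> term in \<open>y\<close> with a depth \<open>d\<close> term in an older
  element into one of \<open>y\<close> itself with a depth \<open>2 * d\<close> term, and the answer
  to \<open>y\<close> is one more class function applied to such a term. Classes stay bounded in
  number because \<open>t\<close> terms over \<open>M\<close> classes have at most
  \<open>M^t * 2^(t * t)\<close> descriptions, whatever the poset. The colour set is not part of the
  parameter, so the first partition separates only colours found in the code of the formula. The
  width is not part of the input either: the insertion of elements into chains bounds itself by
  exhibiting an antichain, and having \<open>w * w\<close> chains in place of \<open>w\<close> only
  affects \<open>f\<close>.\<close>

definition wp :: "com \<Rightarrow> (nat \<Rightarrow> state \<Rightarrow> bool) \<Rightarrow> state \<Rightarrow> bool" where
  "wp c Q s \<longleftrightarrow> (\<exists>t s'. exec c s t s' \<and> Q t s')"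

lemma wpI: "exec c s t s' \<Longrightarrow> Q t s' \<Longrightarrow> wp c Q s"
  unfolding wp_def by blast

lemma wpE: assumes "wp c Q s" obtains t s' where "exec c s t s'" "Q t s'"
  using assms unfolding wp_def by blast

lemma wp_Skip: "wp Skip Q s \<longleftrightarrow> Q 1 s"
  by (auto elim!: wpE exec_SkipE intro: wpI exec.Skip)

lemma wp_Assign: "wp (Assign x a) Q s \<longleftrightarrow> Q (1 + acost a) ((fst s)(x := aval a s), snd s)"
  by (auto elim!: wpE exec_AssignE) (rule wpI[OF exec.Assign], simp)

lemma wp_Store: "wp (Store A a b) Q s \<longleftrightarrow> Q (1 + acost a + acost b)
    (fst s, (snd s)(A := (snd s A)(aval a s := aval b s)))"
  by (auto elim!: wpE exec_StoreE) (rule wpI[OF exec.Store], simp)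

lemma wp_Seq: "wp (Seq c d) Q s \<longleftrightarrow> wp c (\<lambda>t s'. wp d (\<lambda>u. Q (t + u)) s') s"
proof
  assume "wp (Seq c d) Q s"
  then obtain t s' where "exec (Seq c d) s t s'" "Q t s'" by (rule wpE)
  then show "wp c (\<lambda>t s'. wp d (\<lambda>u. Q (t + u)) s') s"
    by (elim exec_SeqE) (auto intro!: wpI)
next
  assume "wp c (\<lambda>t s'. wp d (\<lambda>u. Q (t + u)) s') s"
  then show "wp (Seq c d) Q s"
    by (elim wpE) (rule wpI[OF exec.Seq])
qed

lemma wp_If: "wp (If a c d) Q s \<longleftrightarrow>
    (if aval a s \<noteq> 0 then wp c (\<lambda>t. Q (1 + acost a + t)) s else wp d (\<lambda>t. Q (1 + acost a + t)) s)"
    (is "?l \<longleftrightarrow> ?r")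
proof
  assume ?l
  then obtain t s' where "exec (If a c d) s t s'" "Q t s'" by (rule wpE)
  then show ?r by (elim exec_IfE) (auto intro!: wpI)
next
  assume ?r
  then show ?l
    by (auto elim!: wpE split: if_splits intro: wpI[OF exec.IfTrue] wpI[OF exec.IfFalse])
qed

lemmas wp_simps = wp_Skip wp_Assign wp_Store wp_Seq wp_If

lemma wp_mono: "wp c Q s \<Longrightarrow> (\<And>t s'. Q t s' \<Longrightarrow> Q' t s') \<Longrightarrow> wp c Q' s"
  unfolding wp_def by blast

section \<open>Frame conditions and counting loops\<close>

fun wregs :: "com \<Rightarrow> nat set" where
  "wregs (Assign x a) = {x}"
| "wregs (Seq c d) = wregs c \<union> wregs d"
| "wregs (If a c d) = wregs c \<union> wregs d"
| "wregs (While a c) = wregs c"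
| "wregs _ = {}"

fun warrs :: "com \<Rightarrow> nat set" where
  "warrs (Store A a b) = {A}"
| "warrs (Seq c d) = warrs c \<union> warrs d"
| "warrs (If a c d) = warrs c \<union> warrs d"
| "warrs (While a c) = warrs c"
| "warrs _ = {}"

definition frame :: "com \<Rightarrow> state \<Rightarrow> state \<Rightarrow> bool" where
  "frame c s s' \<longleftrightarrow> (\<forall>x. x \<notin> wregs c \<longrightarrow> fst s' x = fst s x) \<and> (\<forall>A. A \<notin> warrs c \<longrightarrow> snd s' A = snd s A)"

lemma exec_frame: "exec c s t s' \<Longrightarrow> frame c s s'"
  by (induction rule: exec.induct) (auto simp: frame_def)

lemma frame_reg: "frame c s s' \<Longrightarrow> x \<notin> wregs c \<Longrightarrow> fst s' x = fst s x"
  and frame_arr: "frame c s s' \<Longrightarrow> A \<notin> warrs c \<Longrightarrow> snd s' A = snd s A"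
  by (auto simp: frame_def)

lemma wp_use:
  "wp c Q s \<Longrightarrow> (\<And>t s'. Q t s' \<Longrightarrow> frame c s s' \<Longrightarrow> Q' t s') \<Longrightarrow> wp c Q' s"
  unfolding wp_def using exec_frame by blast

definition For :: "nat \<Rightarrow> aexp \<Rightarrow> com \<Rightarrow> com" where
  "For i a c = Seq (Assign i (N 0)) (While (Minus a (V i)) (Seq c (Assign i (Plus (V i) (N 1)))))"

lemma wregs_For [simp]: "wregs (For i a c) = insert i (wregs c)"
  and warrs_For [simp]: "warrs (For i a c) = warrs c"
  by (auto simp: For_def)

text \<open>A round costs \<open>acost a + 3\<close> for the guard, 4 for the increment and at most
  \<open>T\<close> for the body. The initial assignment and the last, failing guard test are
  absorbed by counting one round more than \<open>k\<close>. The bound \<open>a\<close> is evaluated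
  anew in every round, so its value must be known in every state that the loop can produce.\<close>

lemma wp_For:
  assumes i: "i \<notin> wregs c"
    and bound: "\<And>s. frame (For i a c) s0 s \<Longrightarrow> aval a s = k"
    and init: "Inv 0 ((fst s0)(i := 0), snd s0)"
    and body: "\<And>j s. j < k \<Longrightarrow> frame (For i a c) s0 s \<Longrightarrow> fst s i = j \<Longrightarrow> Inv j s \<Longrightarrow>
       wp c (\<lambda>t s'. t \<le> T \<and> Inv (Suc j) ((fst s')(i := Suc j), snd s')) s"
    and post: "\<And>t s'. t \<le> (k + 1) * (acost a + 7 + T) \<Longrightarrow> frame (For i a c) s0 s' \<Longrightarrow> fst s' i = k \<Longrightarrow>
       Inv k s' \<Longrightarrow> Q t s'"
  shows "wp (For i a c) Q s0"
proof -
  let ?W = "While (Minus a (V i)) (Seq c (Assign i (Plus (V i) (N 1))))"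
  let ?F = "For i a c"
  have loop: "\<exists>t s'. exec ?W s t s' \<and> t \<le> (k - j) * (acost a + 7 + T) + acost a + 3
      \<and> frame ?F s0 s' \<and> fst s' i = k \<and> Inv k s'"
    if "j \<le> k" "frame ?F s0 s" "fst s i = j" "Inv j s" for j s
    using that
  proof (induction "k - j" arbitrary: j s)
    case 0
    then have "j = k" by simp
    have "aval (Minus a (V i)) s = 0" using bound[of s] 0 by simp
    from exec.WhileFalse[OF this] have "exec ?W s (1 + acost (Minus a (V i))) s" .
    then show ?case using 0 \<open>j = k\<close> by (intro exI[of _ "1 + acost (Minus a (V i))"] exI[of _ s]) simp
  next
    case (Suc r)
    then have jk: "j < k" by simp
    from body[OF jk Suc.prems(2-4)] obtain t s1 where
      1: "exec c s t s1" "t \<le> T" "Inv (Suc j) ((fst s1)(i := Suc j), snd s1)"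
      unfolding wp_def by blast
    let ?s2 = "((fst s1)(i := Suc j), snd s1)"
    from exec_frame[OF 1(1)] have f1: "frame c s s1" .
    have s1i: "fst s1 i = j" using frame_reg[OF f1 i] Suc.prems(3) by simp
    have f2: "frame ?F s0 ?s2" using f1 Suc.prems(2) by (auto simp: frame_def)
    have "r = k - Suc j" using Suc.hyps(2) by simp
    from Suc.hyps(1)[OF this _ f2 _ 1(3)] jk obtain u s' where
      2: "exec ?W ?s2 u s'" "u \<le> (k - Suc j) * (acost a + 7 + T) + acost a + 3"
        "frame ?F s0 s'" "fst s' i = k" "Inv k s'" by (metis Suc_leI fstI fun_upd_same)
    have "exec (Assign i (Plus (V i) (N 1))) s1 (1 + acost (Plus (V i) (N 1))) ?s2"
      using exec.Assign[of i "Plus (V i) (N 1)" s1] s1i by simp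
    from exec.Seq[OF 1(1) this] have 3: "exec (Seq c (Assign i (Plus (V i) (N 1)))) s (t + 4) ?s2"
      by (simp add: numeral_eq_Suc)
    have "aval (Minus a (V i)) s \<noteq> 0" using bound[OF Suc.prems(2)] Suc.prems(3) jk by simp
    from exec.WhileTrue[OF this 3 2(1)]
    have 4: "exec ?W s (1 + acost (Minus a (V i)) + (t + 4) + u) s'" .
    have "k - j = Suc (k - Suc j)" using jk by simp
    then have "1 + acost (Minus a (V i)) + (t + 4) + u \<le> (k - j) * (acost a + 7 + T) + acost a + 3"
      using 1(2) 2(2) by simp
    with 4 2(3-5) show ?case by blast
  qed
  have f0: "frame ?F s0 ((fst s0)(i := 0), snd s0)" by (auto simp: frame_def wregs_For)
  from loop[of 0 "((fst s0)(i := 0), snd s0)"] f0 init obtain t s' where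
    1: "exec ?W ((fst s0)(i := 0), snd s0) t s'" "t \<le> k * (acost a + 7 + T) + acost a + 3"
      "frame ?F s0 s'" "fst s' i = k" "Inv k s'" by auto
  have "exec (Assign i (N 0)) s0 (1 + acost (N 0)) ((fst s0)(i := 0), snd s0)"
    using exec.Assign[of i "N 0" s0] by simp
  from exec.Seq[OF this 1(1)] have "exec ?F s0 (2 + t) s'" by (simp add: For_def)
  moreover have "Q (2 + t) s'" using 1 by (intro post) simp_all
  ultimately show ?thesis unfolding wp_def by blast
qed

section \<open>Quantifier restriction in bounded posets\<close>

primrec scan :: "(nat \<Rightarrow> nat \<Rightarrow> bool) \<Rightarrow> (nat \<Rightarrow> bool) \<Rightarrow> nat \<Rightarrow> nat \<Rightarrow> nat" where
  "scan R P r 0 = r"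
| "scan R P r (Suc j) = (if P j \<and> R j (scan R P r j) then j else scan R P r j)"

text \<open>With the ends added, each of the four functions below has a candidate, except
  \<open>least_not_below\<close> at the top and \<open>greatest_not_above\<close> at the bottom;
  there the start value of the scan, again an end, is the result.\<close>

definition with_ends :: "nat \<Rightarrow> (nat \<Rightarrow> bool) \<Rightarrow> nat \<Rightarrow> bool" where
  "with_ends m S y \<longleftrightarrow> S y \<or> y = 0 \<or> y = m - 1"

definition least_above :: "(nat \<Rightarrow> nat \<Rightarrow> bool) \<Rightarrow> nat \<Rightarrow> (nat \<Rightarrow> bool) \<Rightarrow> nat \<Rightarrow> nat" where
  "least_above le m S x = scan le (\<lambda>y. with_ends m S y \<and> le x y) (m - 1) m"
definition greatest_below :: "(nat \<Rightarrow> nat \<Rightarrow> bool) \<Rightarrow> nat \<Rightarrow> (nat \<Rightarrow> bool) \<Rightarrow> nat \<Rightarrow> nat" where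
  "greatest_below le m S x = scan (\<lambda>y r. le r y) (\<lambda>y. with_ends m S y \<and> le y x) 0 m"
definition least_not_below :: "(nat \<Rightarrow> nat \<Rightarrow> bool) \<Rightarrow> nat \<Rightarrow> (nat \<Rightarrow> bool) \<Rightarrow> nat \<Rightarrow> nat" where
  "least_not_below le m S x = scan le (\<lambda>y. with_ends m S y \<and> \<not> le y x) (m - 1) m"
definition greatest_not_above :: "(nat \<Rightarrow> nat \<Rightarrow> bool) \<Rightarrow> nat \<Rightarrow> (nat \<Rightarrow> bool) \<Rightarrow> nat \<Rightarrow> nat" where
  "greatest_not_above le m S x = scan (\<lambda>y r. le r y) (\<lambda>y. with_ends m S y \<and> \<not> le x y) 0 m"

definition class_funs :: "(nat \<Rightarrow> nat \<Rightarrow> bool) \<Rightarrow> nat \<Rightarrow> (nat \<Rightarrow> nat \<Rightarrow> bool) \<Rightarrow> nat \<Rightarrow> (nat \<Rightarrow> nat) list" where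
  "class_funs le m cls M = concat (map (\<lambda>c. [least_above le m (cls c), greatest_below le m (cls c), least_not_below le m (cls c), greatest_not_above le m (cls c)]) [0..<M])"

definition close :: "('a \<Rightarrow> 'a) list \<Rightarrow> 'a list \<Rightarrow> 'a list" where
  "close fs xs = xs @ concat (map (\<lambda>x. map (\<lambda>f. f x) fs) xs)"

primrec cl :: "('a \<Rightarrow> 'a) list \<Rightarrow> nat \<Rightarrow> 'a list \<Rightarrow> 'a list" where
  "cl fs 0 xs = xs"
| "cl fs (Suc d) xs = close fs (cl fs d xs)"

primrec terms :: "('a \<Rightarrow> 'a) list \<Rightarrow> nat \<Rightarrow> ('a \<Rightarrow> 'a) list" where
  "terms fs 0 = [id]"
| "terms fs (Suc d) = terms fs d @ concat (map (\<lambda>t. map (\<lambda>f. f \<circ> t) fs) (terms fs d))"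

text \<open>Both recursions enumerate in the same order, so a position in the closure of a single
  element denotes the same term for every element. Comparing two closures entry by entry therefore
  compares terms.\<close>

lemma cl_singleton: "cl fs d [x] = map (\<lambda>t. t x) (terms fs d)"
  by (induction d) (simp_all add: close_def map_concat o_def)

lemma terms_cases:
  assumes "s \<in> set (terms fs (Suc d))"
  obtains "s \<in> set (terms fs d)" | f t where "f \<in> set fs" "t \<in> set (terms fs d)" "s = f \<circ> t"
  using assms by auto

lemma id_terms: "id \<in> set (terms fs d)"
  by (induction d) auto

lemma terms_Suc: "f \<in> set fs \<Longrightarrow> t \<in> set (terms fs d) \<Longrightarrow> f \<circ> t \<in> set (terms fs (Suc d))"
  by auto

lemma terms_mono: "d \<le> e \<Longrightarrow> set fs \<subseteq> set gs \<Longrightarrow> set (terms fs d) \<subseteq> set (terms gs e)"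
proof (induction e arbitrary: d)
  case 0 then show ?case by simp
next
  case (Suc e)
  show ?case
  proof (cases d)
    case 0 then show ?thesis using id_terms[of gs "Suc e"] by simp
  next
    case (Suc d')
    then have "set (terms fs d') \<subseteq> set (terms gs e)" using Suc.IH[of d'] Suc.prems by simp
    then show ?thesis using Suc Suc.prems by fastforce
  qed
qed

lemma terms_comp: "t \<in> set (terms fs d) \<Longrightarrow> s \<in> set (terms fs e) \<Longrightarrow> t \<circ> s \<in> set (terms fs (d + e))"
proof (induction d arbitrary: t)
  case 0 then show ?case by simp
next
  case (Suc d)
  from Suc.prems(1) show ?case
  proof (cases rule: terms_cases)
    case 1
    then have "t \<circ> s \<in> set (terms fs (d + e))" using Suc by blast
    then show ?thesis by (simp del: o_apply)
  next
    case (2 f u)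
    then have "u \<circ> s \<in> set (terms fs (d + e))" using Suc by blast
    from terms_Suc[OF 2(1) this] show ?thesis unfolding 2(3) comp_assoc add_Suc .
  qed
qed

lemma terms_comp1: "t \<in> set (terms fs d) \<Longrightarrow> f \<in> set fs \<Longrightarrow> t \<circ> f \<in> set (terms fs (Suc d))"
  using terms_comp[of t fs d f 1] by simp

lemma set_cl: "set (cl fs d xs) = (\<Union>t\<in>set (terms fs d). t ` set xs)"
proof (induction d)
  case 0 then show ?case by simp
next
  case (Suc d)
  have "set (cl fs (Suc d) xs) = set (cl fs d xs) \<union> (\<Union>f\<in>set fs. f ` set (cl fs d xs))"
    by (auto simp: close_def)
  then show ?case unfolding Suc by (auto simp: image_iff) (metis comp_apply)+
qed

lemma length_close: "length (close fs xs) = length xs * Suc (length fs)"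
  by (simp add: close_def length_concat o_def sum_list_triv)

lemma length_cl: "length (cl fs d xs) = length xs * Suc (length fs) ^ d"
  by (induction d) (simp_all add: length_close algebra_simps)

lemma length_class_funs: "length (class_funs le m cls M) = 4 * M"
  by (simp add: class_funs_def length_concat o_def sum_list_triv)

lemma product_map: "List.product (map f xs) (map g ys) = map (map_prod f g) (List.product xs ys)"
  by (induction xs) simp_all

lemma
  assumes "\<And>a. a \<in> A \<Longrightarrow> \<exists>b\<in>B. P a = Q b" "\<And>b. b \<in> B \<Longrightarrow> \<exists>a\<in>A. Q b = P a"
  shows bex_transfer: "(\<exists>a\<in>A. P a) = (\<exists>b\<in>B. Q b)" and ball_transfer: "(\<forall>a\<in>A. P a) = (\<forall>b\<in>B. Q b)"
  using assms by metis+

section \<open>Bounded posets and the adjoints of class functions\<close>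

locale bposet =
  fixes m :: nat and le :: "nat \<Rightarrow> nat \<Rightarrow> bool"
  assumes m2: "2 \<le> m"
    and refl: "x < m \<Longrightarrow> le x x"
    and trans: "x < m \<Longrightarrow> y < m \<Longrightarrow> z < m \<Longrightarrow> le x y \<Longrightarrow> le y z \<Longrightarrow> le x z"
    and antisym: "x < m \<Longrightarrow> y < m \<Longrightarrow> le x y \<Longrightarrow> le y x \<Longrightarrow> x = y"
    and bot: "x < m \<Longrightarrow> le 0 x"
    and top: "x < m \<Longrightarrow> le x (m - 1)"
begin

abbreviation "tp \<equiv> m - 1"

definition chain_on :: "(nat \<Rightarrow> bool) \<Rightarrow> bool" where
  "chain_on S \<longleftrightarrow> (\<forall>x<m. \<forall>y<m. S x \<longrightarrow> S y \<longrightarrow> le x y \<or> le y x)"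

lemma le_bot: "x < m \<Longrightarrow> le x 0 \<longleftrightarrow> x = 0"
  using antisym[of x 0] bot[of x] refl m2 by auto

lemma le_top: "x < m \<Longrightarrow> le tp x \<longleftrightarrow> x = tp"
  using antisym[of tp x] top[of x] refl m2 by auto

lemma with_ends_chain: "chain_on S \<Longrightarrow> x < m \<Longrightarrow> y < m \<Longrightarrow> with_ends m S x \<Longrightarrow> with_ends m S y \<Longrightarrow> le x y \<or> le y x"
  unfolding with_ends_def chain_on_def using bot top by blast

text \<open>A candidate that does not replace the running value is comparable with it, hence above
  it. This is where the class must be a chain: a single running value then bounds all candidates
  seen so far.\<close>

lemma scan_le:
  assumes ch: "chain_on S" and P: "\<And>y. P y \<Longrightarrow> with_ends m S y" and j: "j \<le> m"
  defines "r \<equiv> scan le P tp j"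
  shows "(r = tp \<or> P r \<and> r < j) \<and> (\<forall>y<j. P y \<longrightarrow> le r y)"
  using j unfolding r_def
proof (induction j)
  case 0 then show ?case by simp
next
  case (Suc j)
  let ?r = "scan le P tp j"
  from Suc have IH: "?r = tp \<or> P ?r \<and> ?r < j" "\<forall>y<j. P y \<longrightarrow> le ?r y" by auto
  have rm: "?r < m" "with_ends m S ?r" using IH(1) Suc.prems m2 P by (auto simp: with_ends_def)
  show ?case
  proof (cases "P j \<and> le j ?r")
    case True
    then have "le j y" if "y < Suc j" "P y" for y
      using that IH(2) trans[of j ?r y] rm refl[of j] Suc.prems by (cases "y = j") auto
    with True show ?thesis by simp
  next
    case False
    then have "le ?r y" if "y < Suc j" "P y" for y
      using that IH(2) with_ends_chain[OF ch, of j ?r] rm P Suc.prems by (cases "y = j") auto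
    with False IH(1) show ?thesis by (cases "P j") auto
  qed
qed

lemma scan_ge:
  assumes ch: "chain_on S" and P: "\<And>y. P y \<Longrightarrow> with_ends m S y" and j: "j \<le> m"
  defines "r \<equiv> scan (\<lambda>y r. le r y) P 0 j"
  shows "(r = 0 \<or> P r \<and> r < j) \<and> (\<forall>y<j. P y \<longrightarrow> le y r)"
  using j unfolding r_def
proof (induction j)
  case 0 then show ?case by simp
next
  case (Suc j)
  let ?r = "scan (\<lambda>y r. le r y) P 0 j"
  from Suc have IH: "?r = 0 \<or> P ?r \<and> ?r < j" "\<forall>y<j. P y \<longrightarrow> le y ?r" by auto
  have rm: "?r < m" "with_ends m S ?r" using IH(1) Suc.prems m2 P by (auto simp: with_ends_def)
  show ?case
  proof (cases "P j \<and> le ?r j")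
    case True
    then have "le y j" if "y < Suc j" "P y" for y
      using that IH(2) trans[of y ?r j] rm refl[of j] Suc.prems by (cases "y = j") auto
    with True show ?thesis by simp
  next
    case False
    then have "le y ?r" if "y < Suc j" "P y" for y
      using that IH(2) with_ends_chain[OF ch, of j ?r] rm P Suc.prems by (cases "y = j") auto
    with False IH(1) show ?thesis by (cases "P j") auto
  qed
qed

context
  fixes S assumes S: "chain_on S"
begin

lemma least_above_props:
  assumes "x < m"
  shows "least_above le m S x < m" "with_ends m S (least_above le m S x)" "le x (least_above le m S x)"
    "\<And>y. y < m \<Longrightarrow> with_ends m S y \<Longrightarrow> le x y \<Longrightarrow> le (least_above le m S x) y"
  using scan_le[OF S, of "\<lambda>y. with_ends m S y \<and> le x y" m] assms m2 top[of x]
  unfolding least_above_def by (auto simp: with_ends_def)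

lemma greatest_below_props:
  assumes "x < m"
  shows "greatest_below le m S x < m" "with_ends m S (greatest_below le m S x)" "le (greatest_below le m S x) x"
    "\<And>y. y < m \<Longrightarrow> with_ends m S y \<Longrightarrow> le y x \<Longrightarrow> le y (greatest_below le m S x)"
  using scan_ge[OF S, of "\<lambda>y. with_ends m S y \<and> le y x" m] assms m2 bot[of x]
  unfolding greatest_below_def by (auto simp: with_ends_def)

lemma least_not_below_props:
  assumes "x < m"
  shows "least_not_below le m S x < m" "with_ends m S (least_not_below le m S x)" "x \<noteq> tp \<Longrightarrow> \<not> le (least_not_below le m S x) x"
    "\<And>y. y < m \<Longrightarrow> with_ends m S y \<Longrightarrow> \<not> le y x \<Longrightarrow> le (least_not_below le m S x) y" "x = tp \<Longrightarrow> least_not_below le m S x = tp"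
  using scan_le[OF S, of "\<lambda>y. with_ends m S y \<and> \<not> le y x" m] assms m2 top[of x] le_top[of x] top
  unfolding least_not_below_def by (auto simp: with_ends_def)

lemma greatest_not_above_props:
  assumes "x < m"
  shows "greatest_not_above le m S x < m" "with_ends m S (greatest_not_above le m S x)" "x \<noteq> 0 \<Longrightarrow> \<not> le x (greatest_not_above le m S x)"
    "\<And>y. y < m \<Longrightarrow> with_ends m S y \<Longrightarrow> \<not> le x y \<Longrightarrow> le y (greatest_not_above le m S x)" "x = 0 \<Longrightarrow> greatest_not_above le m S x = 0"
  using scan_ge[OF S, of "\<lambda>y. with_ends m S y \<and> \<not> le x y" m] assms m2 bot[of x] le_bot[of x] bot
  unfolding greatest_not_above_def by (auto simp: with_ends_def)

text \<open>Both sides say that some element of the class, or an end, lies between \<open>x\<close>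
  and \<open>b\<close>.\<close>

lemma adjoint_AB:
  assumes "x < m" "b < m"
  shows "le (least_above le m S x) b \<longleftrightarrow> le x (greatest_below le m S b)"
  using least_above_props[OF assms(1)] greatest_below_props[OF assms(2)] trans assms by metis

text \<open>The class elements not above \<open>b\<close> are those up to
  \<open>greatest_not_above le m S b\<close>; by minimality \<open>least_above le m S x\<close> is
  among them iff \<open>x\<close> lies below that element. At \<open>b = 0\<close> there are none,
  and the default value 0 must be excepted.\<close>

lemma adjoint_AD:
  assumes "x < m" "b < m"
  shows "le b (least_above le m S x) \<longleftrightarrow> b = 0 \<or> \<not> le x (greatest_not_above le m S b)"
  using least_above_props[OF assms(1)] greatest_not_above_props[OF assms(2)] trans assms bot by metis

text \<open>Some class element below \<open>b\<close> fails to be below \<open>x\<close> iff the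
  greatest one below \<open>b\<close> does. The exception is \<open>x = tp\<close>, where
  \<open>least_not_below\<close> has its default value.\<close>

lemma adjoint_CB:
  assumes "x < m" "b < m"
  shows "le (least_not_below le m S x) b \<longleftrightarrow> (if x = tp then b = tp else \<not> le (greatest_below le m S b) x)"
proof (cases "x = tp")
  case True
  then show ?thesis using least_not_below_props(5)[OF assms(1)] le_top[OF assms(2)] by simp
next
  case False
  then show ?thesis
    using least_not_below_props(1-4)[OF assms(1)] greatest_below_props[OF assms(2)] trans assms by metis
qed

text \<open>The two sides are contrapositives: all class elements not below \<open>x\<close> are
  above \<open>b\<close>, and all those not above \<open>b\<close> are below
  \<open>x\<close>.\<close>

lemma adjoint_DC:
  assumes "x < m" "b < m"
  shows "le b (least_not_below le m S x) \<longleftrightarrow> le (greatest_not_above le m S b) x"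
proof (cases "x = tp \<or> b = 0")
  case True
  then show ?thesis
    using least_not_below_props[OF assms(1)] greatest_not_above_props[OF assms(2)] bot top assms by metis
next
  case False
  then show ?thesis
    using least_not_below_props(1-4)[OF assms(1)] greatest_not_above_props(1-4)[OF assms(2)] trans assms by metis
qed

end

text \<open>Every comparison of \<open>f x\<close> with \<open>b\<close> is determined by the comparisons of \<open>x\<close> with \<open>g b\<close>
  for a single function \<open>g\<close>, up to degenerate cases at the two ends of the poset.\<close>

definition adjointable :: "(nat \<Rightarrow> nat) list \<Rightarrow> bool" where
  "adjointable fs \<longleftrightarrow> (\<forall>f\<in>set fs. (\<forall>x<m. f x < m) \<and>
     (\<exists>g\<in>set fs. \<exists>\<Phi>. \<forall>x<m. \<forall>b<m. le (f x) b =
        \<Phi> (le x (g b)) (le (g b) x) (x = 0) (x = tp) (b = 0) (b = tp)) \<and>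
     (\<exists>g\<in>set fs. \<exists>\<Phi>. \<forall>x<m. \<forall>b<m. le b (f x) =
        \<Phi> (le x (g b)) (le (g b) x) (x = 0) (x = tp) (b = 0) (b = tp)))"

lemma adjointableE1:
  assumes "adjointable fs" "f \<in> set fs"
  obtains g \<Phi> where "g \<in> set fs" "\<forall>x<m. \<forall>b<m. le (f x) b =
        \<Phi> (le x (g b)) (le (g b) x) (x = 0) (x = tp) (b = 0) (b = tp)"
  using bspec[OF assms(1)[unfolded adjointable_def] assms(2)] by (elim conjE bexE exE)

lemma adjointableE2:
  assumes "adjointable fs" "f \<in> set fs"
  obtains g \<Phi> where "g \<in> set fs" "\<forall>x<m. \<forall>b<m. le b (f x) =
        \<Phi> (le x (g b)) (le (g b) x) (x = 0) (x = tp) (b = 0) (b = tp)"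
  using bspec[OF assms(1)[unfolded adjointable_def] assms(2)] by (elim conjE bexE exE)

text \<open>The four equivalences are used in both directions. In this way each of the four
  functions finds a partner of the same class for comparisons from below and another one for
  comparisons from above.\<close>

lemma adjointable_class_funs:
  assumes "\<And>c. c < M \<Longrightarrow> chain_on (cls c)"
  shows "adjointable (class_funs le m cls M)"
  unfolding adjointable_def
proof (intro ballI)
  fix f assume "f \<in> set (class_funs le m cls M)"
  then obtain c where c: "c < M"
    and f: "f \<in> {least_above le m (cls c), greatest_below le m (cls c), least_not_below le m (cls c), greatest_not_above le m (cls c)}"
    by (auto simp: class_funs_def)
  let ?S = "cls c"
  note S = assms[OF c]
  have mem: "least_above le m ?S \<in> set (class_funs le m cls M)" "greatest_below le m ?S \<in> set (class_funs le m cls M)"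
    "least_not_below le m ?S \<in> set (class_funs le m cls M)" "greatest_not_above le m ?S \<in> set (class_funs le m cls M)"
    using c by (auto simp: class_funs_def)
  let ?G = "\<lambda>L. \<exists>g\<in>set (class_funs le m cls M). \<exists>\<Phi>. \<forall>x<m. \<forall>b<m. L x b =
        \<Phi> (le x (g b)) (le (g b) x) (x = 0) (x = tp) (b = 0) (b = tp)"
  from f consider "f = least_above le m ?S" | "f = greatest_below le m ?S" | "f = least_not_below le m ?S" | "f = greatest_not_above le m ?S" by blast
  then show "(\<forall>x<m. f x < m) \<and> ?G (\<lambda>x b. le (f x) b) \<and> ?G (\<lambda>x b. le b (f x))"
  proof cases
    case 1
    have "?G (\<lambda>x b. le (f x) b)" unfolding 1
      by (rule bexI[OF _ mem(2)], rule exI[of _ "\<lambda>p q a b c d. p"]) (simp add: adjoint_AB[OF S])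
    moreover have "?G (\<lambda>x b. le b (f x))" unfolding 1
      by (rule bexI[OF _ mem(4)], rule exI[of _ "\<lambda>p q a b c d. c \<or> \<not> p"]) (simp add: adjoint_AD[OF S])
    ultimately show ?thesis using least_above_props(1)[OF S] 1 by simp
  next
    case 2
    have "le (greatest_below le m ?S x) b \<longleftrightarrow> b = tp \<or> \<not> le (least_not_below le m ?S b) x" if "x < m" "b < m" for x b
      using adjoint_CB[OF S that(2,1)] top[of "greatest_below le m ?S x"] greatest_below_props(1)[OF S that(1)]
      by (auto split: if_splits)
    then have "?G (\<lambda>x b. le (f x) b)" unfolding 2
      by (intro bexI[OF _ mem(3)] exI[of _ "\<lambda>p q a b c d. d \<or> \<not> q"]) simp
    moreover have "?G (\<lambda>x b. le b (f x))" unfolding 2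
      by (rule bexI[OF _ mem(1)], rule exI[of _ "\<lambda>p q a b c d. q"]) (simp add: adjoint_AB[OF S])
    ultimately show ?thesis using greatest_below_props(1)[OF S] 2 by simp
  next
    case 3
    have "?G (\<lambda>x b. le (f x) b)" unfolding 3
      by (rule bexI[OF _ mem(2)], rule exI[of _ "\<lambda>p q a b c d. if b then d else \<not> q"])
        (simp add: adjoint_CB[OF S])
    moreover have "?G (\<lambda>x b. le b (f x))" unfolding 3
      by (rule bexI[OF _ mem(4)], rule exI[of _ "\<lambda>p q a b c d. q"]) (simp add: adjoint_DC[OF S])
    ultimately show ?thesis using least_not_below_props(1)[OF S] 3 by simp
  next
    case 4
    have "?G (\<lambda>x b. le (f x) b)" unfolding 4
      by (rule bexI[OF _ mem(3)], rule exI[of _ "\<lambda>p q a b c d. p"]) (simp add: adjoint_DC[OF S])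
    moreover have "le b (greatest_not_above le m ?S x) \<longleftrightarrow> (if x = 0 then b = 0 else \<not> le x (least_above le m ?S b))"
      if "x < m" "b < m" for x b
      using adjoint_AD[OF S that(2,1)] greatest_not_above_props(5)[OF S that(1)] le_bot[OF that(2)] by auto
    then have "?G (\<lambda>x b. le b (f x))" unfolding 4
      by (intro bexI[OF _ mem(1)] exI[of _ "\<lambda>p q a b c d. if a then c else \<not> p"]) simp
    ultimately show ?thesis using greatest_not_above_props(1)[OF S] 4 by simp
  qed
qed

lemma terms_less:
  assumes "adjointable fs"
  shows "t \<in> set (terms fs d) \<Longrightarrow> x < m \<Longrightarrow> t x < m"
  by (induction d arbitrary: t) (use assms in \<open>auto simp: adjointable_def\<close>)

text \<open>The outermost function \<open>f\<close> of \<open>s = f \<circ> t\<close> is moved to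
  the other side as a function \<open>g\<close> applied to \<open>b\<close>, and the induction goes
  on with the shorter \<open>t\<close> and the new \<open>b\<close>. So the terms needed at
  \<open>b\<close> are no deeper than \<open>s\<close>. The premises about 0 and \<open>tp\<close>
  feed the degenerate cases of the equivalences.\<close>

lemma transfer:
  assumes adj: "adjointable fs"
  shows "\<lbrakk>s \<in> set (terms fs d); y < m; y' < m; b < m; b' < m;
    \<And>u. u \<in> set (terms fs d) \<Longrightarrow> (le y (u b) \<longleftrightarrow> le y' (u b')) \<and> (le (u b) y \<longleftrightarrow> le (u b') y');
    \<And>u. u \<in> set (terms fs d) \<Longrightarrow> (u b = 0 \<longleftrightarrow> u b' = 0) \<and> (u b = tp \<longleftrightarrow> u b' = tp);
    \<And>u. u \<in> set (terms fs d) \<Longrightarrow> (u y = 0 \<longleftrightarrow> u y' = 0) \<and> (u y = tp \<longleftrightarrow> u y' = tp)\<rbrakk>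
   \<Longrightarrow> (le (s y) b \<longleftrightarrow> le (s y') b') \<and> (le b (s y) \<longleftrightarrow> le b' (s y'))"
proof (induction d arbitrary: s b b')
  case 0
  then show ?case using id_terms[of fs 0] by force
next
  case (Suc d)
  have sub: "u \<in> set (terms fs d) \<Longrightarrow> u \<in> set (terms fs (Suc d))" for u by simp
  from Suc.prems(1) show ?case
  proof (cases rule: terms_cases)
    case 1
    from Suc.IH[OF 1 Suc.prems(2-5)] Suc.prems(6-8) sub show ?thesis by blast
  next
    case (2 f t)
    have ty: "t y < m" "t y' < m" using terms_less[OF adj 2(2)] Suc.prems by auto
    have ends: "(t y = 0 \<longleftrightarrow> t y' = 0) \<and> (t y = tp \<longleftrightarrow> t y' = tp)"
      "(b = 0 \<longleftrightarrow> b' = 0) \<and> (b = tp \<longleftrightarrow> b' = tp)"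
      using Suc.prems(8)[OF sub[OF 2(2)]] Suc.prems(7)[OF id_terms] by auto
    have step: "(le (t y) (g b) \<longleftrightarrow> le (t y') (g b')) \<and> (le (g b) (t y) \<longleftrightarrow> le (g b') (t y'))"
      if g: "g \<in> set fs" for g
    proof -
      have gm: "g b < m" "g b' < m" using g adj Suc.prems(4,5) by (auto simp: adjointable_def)
      have 3: "u \<circ> g \<in> set (terms fs (Suc d))" if "u \<in> set (terms fs d)" for u
        using terms_comp1[OF that g] .
      have "(le (t y) (g b) \<longleftrightarrow> le (t y') (g b')) \<and> (le (g b) (t y) \<longleftrightarrow> le (g b') (t y'))"
        by (rule Suc.IH[OF 2(2) Suc.prems(2,3) gm])
          (use Suc.prems(6)[OF 3] Suc.prems(7)[OF 3] Suc.prems(8)[OF sub] in auto)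
      then show ?thesis .
    qed
    from adj 2(1) obtain g \<Phi> where g: "g \<in> set fs" "\<forall>x<m. \<forall>b<m. le (f x) b =
        \<Phi> (le x (g b)) (le (g b) x) (x = 0) (x = tp) (b = 0) (b = tp)"
      by (rule adjointableE1)
    from adj 2(1) obtain h \<Psi> where h: "h \<in> set fs" "\<forall>x<m. \<forall>b<m. le b (f x) =
        \<Psi> (le x (h b)) (le (h b) x) (x = 0) (x = tp) (b = 0) (b = tp)"
      by (rule adjointableE2)
    show ?thesis
      using g(2) h(2) ty Suc.prems(4,5) step[OF g(1)] step[OF h(1)] ends unfolding 2(3) by simp
  qed
qed

end

section \<open>Levels of refinement and the back-and-forth argument\<close>

definition signature :: "(nat \<Rightarrow> nat \<Rightarrow> bool) \<Rightarrow> (nat \<Rightarrow> nat) \<Rightarrow> nat list \<Rightarrow> nat list \<times> bool list" where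
  "signature le \<kappa> T = (map \<kappa> T, map (\<lambda>(u, v). le u v) (List.product T T))"

text \<open>The classes of all levels share one numbering, which is why \<open>cls\<close> has no
  level argument. The functions of level \<open>k\<close> use every class number below
  \<open>M k\<close>, so classes of lower levels stay available and the sets of terms grow with
  \<open>k\<close>. Only level 0 has to isolate the ends; finer levels inherit this.\<close>

locale levels = bposet +
  fixes \<kappa> :: "nat \<Rightarrow> nat \<Rightarrow> nat" and cls :: "nat \<Rightarrow> nat \<Rightarrow> bool" and M d :: "nat \<Rightarrow> nat" and K :: nat
  assumes \<kappa>_bot: "x < m \<Longrightarrow> \<kappa> 0 x = \<kappa> 0 0 \<Longrightarrow> x = 0"
    and \<kappa>_top: "x < m \<Longrightarrow> \<kappa> 0 x = \<kappa> 0 (m - 1) \<Longrightarrow> x = m - 1"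
    and \<kappa>_less: "k \<le> K \<Longrightarrow> x < m \<Longrightarrow> \<kappa> k x < M k"
    and M_mono: "k < K \<Longrightarrow> M k \<le> M (Suc k)"
    and cls: "k \<le> K \<Longrightarrow> x < m \<Longrightarrow> y < m \<Longrightarrow> cls (\<kappa> k x) y \<longleftrightarrow> \<kappa> k y = \<kappa> k x"
    and cls_chain: "c < M K \<Longrightarrow> chain_on (cls c)"
    and \<kappa>_step: "k < K \<Longrightarrow> x < m \<Longrightarrow> y < m \<Longrightarrow> \<kappa> (Suc k) x = \<kappa> (Suc k) y \<Longrightarrow>
       signature le (\<kappa> k) (cl (class_funs le m cls (M k)) (d k) [x]) =
       signature le (\<kappa> k) (cl (class_funs le m cls (M k)) (d k) [y])"
    and d_step: "k < K \<Longrightarrow> d (Suc k) = 2 * d k + 1"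
begin

abbreviation "fs k \<equiv> class_funs le m cls (M k)"

definition TS :: "nat \<Rightarrow> (nat \<Rightarrow> nat) set" where
  "TS k = set (terms (fs k) (d k))"

text \<open>The invariant of an Ehrenfeucht-Fraisse game between the tuples \<open>g\<close> and
  \<open>g'\<close> with \<open>k\<close> rounds left.\<close>

definition agree :: "nat \<Rightarrow> ('i \<Rightarrow> nat) \<Rightarrow> ('i \<Rightarrow> nat) \<Rightarrow> 'i set \<Rightarrow> bool" where
  "agree k g g' X \<longleftrightarrow>
    (\<forall>i\<in>X. \<forall>s\<in>TS k. \<kappa> k (s (g i)) = \<kappa> k (s (g' i))) \<and>
    (\<forall>i\<in>X. \<forall>j\<in>X. \<forall>s\<in>TS k. \<forall>t\<in>TS k. le (s (g i)) (t (g j)) \<longleftrightarrow> le (s (g' i)) (t (g' j)))"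

lemma agree_\<kappa>: "agree k g g' X \<Longrightarrow> i \<in> X \<Longrightarrow> s \<in> TS k \<Longrightarrow> \<kappa> k (s (g i)) = \<kappa> k (s (g' i))"
  and agree_le: "agree k g g' X \<Longrightarrow> i \<in> X \<Longrightarrow> j \<in> X \<Longrightarrow> s \<in> TS k \<Longrightarrow> t \<in> TS k \<Longrightarrow>
    le (s (g i)) (t (g j)) \<longleftrightarrow> le (s (g' i)) (t (g' j))"
  unfolding agree_def by simp_all

lemma M_mono': "k \<le> l \<Longrightarrow> l \<le> K \<Longrightarrow> M k \<le> M l"
  by (induction l rule: dec_induct) (use M_mono in \<open>auto intro: order_trans\<close>)

lemma d_mono: "k \<le> l \<Longrightarrow> l \<le> K \<Longrightarrow> d k \<le> d l"
  by (induction l rule: dec_induct) (use d_step in auto)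

lemma fs_mono: "k \<le> l \<Longrightarrow> l \<le> K \<Longrightarrow> set (fs k) \<subseteq> set (fs l)"
  using M_mono'[of k l] by (force simp: class_funs_def)

lemma adjointable_fs: "k \<le> K \<Longrightarrow> adjointable (fs k)"
  using cls_chain M_mono'[of k K] by (intro adjointable_class_funs) auto

lemma TS_mono: "k \<le> l \<Longrightarrow> l \<le> K \<Longrightarrow> TS k \<subseteq> TS l"
  unfolding TS_def by (intro terms_mono d_mono fs_mono)

lemma TS_less: "k \<le> K \<Longrightarrow> t \<in> TS k \<Longrightarrow> x < m \<Longrightarrow> t x < m"
  unfolding TS_def using terms_less[OF adjointable_fs] by blast

lemma id_TS: "id \<in> TS k"
  unfolding TS_def by (rule id_terms)

lemma \<kappa>_step_agree:
  assumes "k < K" "x < m" "y < m" "\<kappa> (Suc k) x = \<kappa> (Suc k) y"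
  shows "agree k (\<lambda>_. x) (\<lambda>_. y) X"
  using \<kappa>_step[OF assms]
  unfolding agree_def TS_def signature_def cl_singleton product_map by (auto simp: o_def)

lemma \<kappa>_coarser:
  assumes "k < K" "x < m" "y < m" "\<kappa> (Suc k) x = \<kappa> (Suc k) y"
  shows "\<kappa> k x = \<kappa> k y"
proof -
  have "\<kappa> k (id x) = \<kappa> k (id y)"
    by (rule agree_\<kappa>[OF \<kappa>_step_agree[OF assms] UNIV_I id_TS])
  then show ?thesis by simp
qed

lemma \<kappa>_zero: "k \<le> K \<Longrightarrow> x < m \<Longrightarrow> y < m \<Longrightarrow> \<kappa> k x = \<kappa> k y \<Longrightarrow> \<kappa> 0 x = \<kappa> 0 y"
proof (induction k)
  case (Suc k)
  then show ?case using \<kappa>_coarser[of k x y] by simp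
qed

lemma \<kappa>_ends:
  assumes "k \<le> K" "x < m" "y < m" "\<kappa> k x = \<kappa> k y"
  shows "(x = 0 \<longleftrightarrow> y = 0) \<and> (x = tp \<longleftrightarrow> y = tp)"
  using \<kappa>_zero[OF assms] \<kappa>_bot \<kappa>_top assms(2,3) by metis

lemma agree_mono: "agree k g g' X \<Longrightarrow> Y \<subseteq> X \<Longrightarrow> agree k g g' Y"
  unfolding agree_def by blast

lemma agree_sym: "agree k g g' X \<Longrightarrow> agree k g' g X"
  unfolding agree_def by simp

lemma agree_refl: "agree k g g X"
  unfolding agree_def by simp

lemma chain_max:
  assumes "finite Z" "Z \<noteq> {}" "chain_on S" "\<And>z. z \<in> Z \<Longrightarrow> f z < m \<and> S (f z)"
  shows "\<exists>z\<in>Z. \<forall>z'\<in>Z. le (f z') (f z)"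
  using assms
proof (induction rule: finite_ne_induct)
  case (singleton x)
  then show ?case using refl by auto
next
  case (insert x F)
  then obtain z where z: "z \<in> F" "\<forall>z'\<in>F. le (f z') (f z)" by auto
  have lt: "f x < m" "f z < m" "S (f x)" "S (f z)" "\<And>z'. z' \<in> F \<Longrightarrow> f z' < m" using insert.prems z by auto
  then consider "le (f x) (f z)" | "le (f z) (f x)" using insert.prems(1) unfolding chain_on_def by blast
  then show ?case
  proof cases
    case 1 then show ?thesis using z by auto
  next
    case 2
    then have "\<forall>z'\<in>insert x F. le (f z') (f x)" using z(2) lt trans[of _ "f z" "f x"] refl by auto
    then show ?thesis by auto
  qed
qed

text \<open>The answer to \<open>y\<close> is the largest of the minimal elements of the class of \<open>y\<close> above
  each of the bounds that the chosen elements put on \<open>y\<close> from below.\<close>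

lemma agree_extend:
  assumes k: "k < K" and ag: "agree (Suc k) g g' X"
    and X: "finite X" "o0 \<in> X" "g o0 = 0" "g' o0 = 0" and z: "z \<notin> X"
    and gm: "\<And>i. i \<in> X \<Longrightarrow> g i < m \<and> g' i < m"
    and y: "y < m" "y \<noteq> 0" "y \<noteq> tp"
  obtains w j where "w \<in> TS (Suc k)" "j \<in> X" "w (g' j) < m" "w (g' j) \<noteq> 0" "w (g' j) \<noteq> tp"
    "agree k (g(z := y)) (g'(z := w (g' j))) (insert z X)"
proof -
  define S where "S = cls (\<kappa> (Suc k) y)"
  have S: "S x \<longleftrightarrow> \<kappa> (Suc k) x = \<kappa> (Suc k) y" if "x < m" for x
    unfolding S_def using cls[of "Suc k" y x] k y that by simp
  have cM: "\<kappa> (Suc k) y < M (Suc k)" using \<kappa>_less[of "Suc k" y] k y by simp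
  have chS: "chain_on S" unfolding S_def
    using cls_chain cM M_mono'[of "Suc k" K] k by simp
  \<comment> \<open>The depth is \<open>2 * d k\<close> because a term of depth \<open>d k\<close>
    of an old element will receive, by \<open>transfer\<close>, up to \<open>d k\<close> further
    functions taken over from the term of \<open>y\<close>.\<close>
  define U where "U = set (terms (fs k) (2 * d k))"
  have adj: "adjointable (fs k)" using adjointable_fs k by simp
  have U_less: "u x < m" if "u \<in> U" "x < m" for u x
    using terms_less[OF adj] that unfolding U_def by blast
  have U_TS: "U \<subseteq> TS (Suc k)" unfolding U_def TS_def
    by (rule terms_mono) (use d_step[OF k] fs_mono[of k "Suc k"] k in auto)
  have fU: "f \<circ> u \<in> TS (Suc k)" if "f \<in> {least_above le m S, least_not_below le m S}" "u \<in> U" for f u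
  proof -
    have "u \<in> set (terms (fs (Suc k)) (2 * d k))"
      using that(2) terms_mono[OF order.refl, of "fs k" "fs (Suc k)" "2 * d k"] fs_mono[of k "Suc k"] k
      unfolding U_def by auto
    moreover have "f \<in> set (fs (Suc k))" using that(1) cM unfolding S_def class_funs_def by auto
    ultimately show ?thesis unfolding TS_def using terms_Suc d_step[OF k] by simp
  qed
  \<comment> \<open>\<open>Z\<close> collects the terms that yield lower bounds of \<open>y\<close>
    inside its class. Without \<open>u (g j) \<noteq> 0\<close> the value of
    \<open>least_above\<close> could be the end 0, which does not lie in the class.\<close>
  define Z where "Z = {(w, j). j \<in> X \<and>
    ((\<exists>u\<in>U. w = least_above le m S \<circ> u \<and> le (u (g j)) y \<and> u (g j) \<noteq> 0) \<or>
     (\<exists>u\<in>U. w = least_not_below le m S \<circ> u \<and> \<not> le y (u (g j))))}"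
  have "Z \<subseteq> ((\<lambda>u. least_above le m S \<circ> u) ` U \<union> (\<lambda>u. least_not_below le m S \<circ> u) ` U) \<times> X" unfolding Z_def by auto
  then have "finite Z" by (rule finite_subset) (use X in \<open>simp add: U_def\<close>)
  \<comment> \<open>The least element, kept at index \<open>o0\<close>, always provides one bound,
    since \<open>y\<close> is not below 0.\<close>
  have "id \<in> U" "\<not> le y (id (g o0))" using X y le_bot[of y] id_terms unfolding U_def by auto
  then have "(least_not_below le m S \<circ> id, o0) \<in> Z" using X(2) unfolding Z_def by blast
  then have "Z \<noteq> {}" by blast
  have hS: "with_ends m S y" using S[OF y(1)] by (simp add: with_ends_def)
  have Zp: "w \<in> TS (Suc k) \<and> j \<in> X \<and> w (g j) < m \<and> S (w (g j)) \<and> le (w (g j)) y"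
    if "(w, j) \<in> Z" for w j
  proof -
    have j: "j \<in> X" "g j < m" using that gm unfolding Z_def by auto
    from that consider u where "u \<in> U" "w = least_above le m S \<circ> u" "le (u (g j)) y" "u (g j) \<noteq> 0"
      | u where "u \<in> U" "w = least_not_below le m S \<circ> u" "\<not> le y (u (g j))" unfolding Z_def by auto
    then show ?thesis
    proof cases
      case (1 u)
      have um: "u (g j) < m" using U_less 1(1) j(2) .
      let ?w = "least_above le m S (u (g j))"
      note A = least_above_props[OF chS um]
      have le: "le ?w y" using A(4)[OF y(1) hS 1(3)] .
      have "?w \<noteq> 0" using A(3) 1(4) le_bot[OF um] by metis
      moreover have "?w \<noteq> tp" using le le_top[OF y(1)] y(3) by metis
      ultimately show ?thesis using A(1,2) le j fU[OF _ 1(1)] unfolding 1(2) with_ends_def by simp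
    next
      case (2 u)
      have um: "u (g j) < m" using U_less 2(1) j(2) .
      let ?w = "least_not_below le m S (u (g j))"
      note C = least_not_below_props[OF chS um]
      have le: "le ?w y" using C(4)[OF y(1) hS 2(3)] .
      have "u (g j) \<noteq> tp" using 2(3) top y(1) by metis
      then have "?w \<noteq> 0" using C(3) bot[OF um] by metis
      moreover have "?w \<noteq> tp" using le le_top[OF y(1)] y(3) by metis
      ultimately show ?thesis using C(1,2) le j fU[OF _ 2(1)] unfolding 2(2) with_ends_def by simp
    qed
  qed
  obtain w j where wj: "(w, j) \<in> Z" and mx: "\<And>w' j'. (w', j') \<in> Z \<Longrightarrow> le (w' (g j')) (w (g j))"
    using chain_max[OF \<open>finite Z\<close> \<open>Z \<noteq> {}\<close> chS, of "\<lambda>(w, j). w (g j)"] Zp by fastforce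
  define ys where "ys = w (g j)"
  define y' where "y' = w (g' j)"
  from Zp[OF wj] have w: "w \<in> TS (Suc k)" "j \<in> X" "ys < m" "S ys" "le ys y" unfolding ys_def by auto
  have y'm: "y' < m" unfolding y'_def using TS_less[of "Suc k"] k w gm by simp
  have "\<kappa> (Suc k) ys = \<kappa> (Suc k) y'" using agree_\<kappa>[OF ag w(2,1)] unfolding ys_def y'_def .
  then have \<kappa>y: "\<kappa> (Suc k) y = \<kappa> (Suc k) y'" using S[OF w(3)] w(4) by simp
  have y'e: "y' \<noteq> 0" "y' \<noteq> tp" using \<kappa>_ends[OF _ y(1) y'm \<kappa>y] k y by auto
  \<comment> \<open>Going down from \<open>y\<close> to \<open>ys\<close> changes no comparison with
    an old term. A term below \<open>y\<close> contributes its \<open>least_above\<close>, so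
    \<open>ys\<close> is still above it. A term above \<open>ys\<close> but not above
    \<open>y\<close> would contribute its \<open>least_not_below\<close>, which is below
    \<open>ys\<close> and hence below the term: a contradiction. From \<open>ys\<close> to
    \<open>y'\<close> the agreement of the old tuples applies.\<close>
  have cmp: "(le (u (g i)) y \<longleftrightarrow> le (u (g' i)) y') \<and> (le y (u (g i)) \<longleftrightarrow> le y' (u (g' i)))"
    if u: "u \<in> U" and i: "i \<in> X" for u i
  proof -
    have um: "u (g i) < m" using U_less u gm i by blast
    have "le (u (g i)) y \<longleftrightarrow> le (u (g i)) ys"
    proof
      assume l: "le (u (g i)) y"
      show "le (u (g i)) ys"
      proof (cases "u (g i) = 0")
        case True then show ?thesis using bot w by simp
      next
        case False
        then have "(least_above le m S \<circ> u, i) \<in> Z" using u i l unfolding Z_def by auto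
        from mx[OF this] have "le (least_above le m S (u (g i))) ys" by (simp add: ys_def)
        then show ?thesis using least_above_props(1,3)[OF chS um] trans um w(3) by metis
      qed
    next
      assume "le (u (g i)) ys" then show "le (u (g i)) y" using trans um w y by blast
    qed
    moreover have "le y (u (g i)) \<longleftrightarrow> le ys (u (g i))"
    proof
      assume "le y (u (g i))" then show "le ys (u (g i))" using trans um w y by blast
    next
      assume l: "le ys (u (g i))"
      show "le y (u (g i))"
      proof (rule ccontr)
        assume n: "\<not> le y (u (g i))"
        then have "(least_not_below le m S \<circ> u, i) \<in> Z" using u i unfolding Z_def by auto
        from mx[OF this] have "le (least_not_below le m S (u (g i))) ys" by (simp add: ys_def)
        then have "le (least_not_below le m S (u (g i))) (u (g i))" using l least_not_below_props(1)[OF chS um] trans um w(3) by blast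
        then show False using least_not_below_props(3)[OF chS um] n top y(1) by metis
      qed
    qed
    moreover have "(le (u (g i)) ys \<longleftrightarrow> le (u (g' i)) y') \<and> (le ys (u (g i)) \<longleftrightarrow> le y' (u (g' i)))"
      using agree_le[OF ag] u U_TS i w(1,2) unfolding ys_def y'_def by blast
    ultimately show ?thesis by simp
  qed
  have own: "agree k (\<lambda>_::unit. y) (\<lambda>_. y') UNIV" using \<kappa>_step_agree[OF k y(1) y'm \<kappa>y] .
  have ownk: "\<kappa> k (s y) = \<kappa> k (s y')" if "s \<in> TS k" for s using agree_\<kappa>[OF own UNIV_I that] .
  have ownl: "le (s y) (t y) \<longleftrightarrow> le (s y') (t y')" if "s \<in> TS k" "t \<in> TS k" for s t
    using agree_le[OF own UNIV_I UNIV_I that] .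
  have TSk: "TS k \<subseteq> TS (Suc k)" using TS_mono[of k "Suc k"] k by simp
  have oldk: "\<kappa> k (s (g i)) = \<kappa> k (s (g' i))" if "s \<in> TS k" "i \<in> X" for s i
  proof -
    have "\<kappa> (Suc k) (s (g i)) = \<kappa> (Suc k) (s (g' i))" using agree_\<kappa>[OF ag] that TSk by blast
    then show ?thesis using \<kappa>_coarser[OF k] TS_less[of k s] k that gm by simp
  qed
  have oldl: "le (s (g i)) (t (g l)) \<longleftrightarrow> le (s (g' i)) (t (g' l))"
    if "s \<in> TS k" "t \<in> TS k" "i \<in> X" "l \<in> X" for s t i l
    using agree_le[OF ag] that TSk by blast
  \<comment> \<open>\<open>transfer\<close> moves the whole term \<open>s\<close> from the new
    element to the old one, so only \<open>cmp\<close> and the positions of the ends are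
    consulted.\<close>
  have mixed: "(le (s y) (t (g i)) \<longleftrightarrow> le (s y') (t (g' i))) \<and> (le (t (g i)) (s y) \<longleftrightarrow> le (t (g' i)) (s y'))"
    if st: "s \<in> TS k" "t \<in> TS k" and i: "i \<in> X" for s t i
  proof (rule transfer[OF adj, of s "d k" y y' "t (g i)" "t (g' i)"])
    show "s \<in> set (terms (fs k) (d k))" using st(1) unfolding TS_def .
    show "t (g i) < m" "t (g' i) < m" using TS_less[of k t] k st gm i by auto
    fix u assume u: "u \<in> set (terms (fs k) (d k))"
    have ut: "u \<circ> t \<in> U" using terms_comp[OF u] st(2) unfolding U_def TS_def mult_2 by blast
    show "(le y (u (t (g i))) \<longleftrightarrow> le y' (u (t (g' i)))) \<and> (le (u (t (g i))) y \<longleftrightarrow> le (u (t (g' i))) y')"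
      using cmp[OF ut i] by simp
    have "\<kappa> (Suc k) ((u \<circ> t) (g i)) = \<kappa> (Suc k) ((u \<circ> t) (g' i))"
      using agree_\<kappa>[OF ag i] ut U_TS by blast
    then show "(u (t (g i)) = 0 \<longleftrightarrow> u (t (g' i)) = 0) \<and> (u (t (g i)) = tp \<longleftrightarrow> u (t (g' i)) = tp)"
      using \<kappa>_ends[of "Suc k" "(u \<circ> t) (g i)" "(u \<circ> t) (g' i)"] k U_less[OF ut] gm[OF i] by simp
    have "u \<in> TS k" using u unfolding TS_def .
    then show "(u y = 0 \<longleftrightarrow> u y' = 0) \<and> (u y = tp \<longleftrightarrow> u y' = tp)"
      using \<kappa>_ends[of k "u y" "u y'"] ownk TS_less[of k u] k y(1) y'm by simp
  qed (use y y'm in auto)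
  have "agree k (g(z := y)) (g'(z := y')) (insert z X)"
    unfolding agree_def using z ownk ownl oldk oldl mixed by auto
  then show ?thesis using that[OF w(1,2)] y'm y'e unfolding y'_def by blast
qed

abbreviation "inner \<equiv> {0<..<m - 1}"

lemma case_nat_fun_upd: "(case_nat b e)(Suc x := a) = case_nat b (e(x := a))"
  by (auto simp: fun_eq_iff split: nat.split)

text \<open>Variable \<open>v\<close> is stored at index \<open>Suc v\<close>; index 0 holds the
  least element as a constant, so that there are terms even when no variable is free. The old value
  of \<open>x\<close> is dropped from the tuple before the new one enters.\<close>

lemma agree_quantifier:
  assumes k: "k < K"
    and ag: "agree (Suc k) (case_nat 0 e) (case_nat 0 e') (insert 0 (Suc ` (X - {x})))"
    and X: "finite X" "\<And>v. v \<in> X - {x} \<Longrightarrow> e v \<in> inner \<and> e' v \<in> inner" and a: "a \<in> inner"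
  obtains w j where "w \<in> TS (Suc k)" "j \<in> insert 0 (Suc ` (X - {x}))" "w (case_nat 0 e' j) \<in> inner"
    "agree k (case_nat 0 (e(x := a))) (case_nat 0 (e'(x := w (case_nat 0 e' j)))) (insert 0 (Suc ` X))"
proof -
  let ?X = "insert 0 (Suc ` (X - {x}))"
  obtain w j where w: "w \<in> TS (Suc k)" "j \<in> ?X" "w (case_nat 0 e' j) < m" "w (case_nat 0 e' j) \<noteq> 0"
    "w (case_nat 0 e' j) \<noteq> tp"
    "agree k ((case_nat 0 e)(Suc x := a)) ((case_nat 0 e')(Suc x := w (case_nat 0 e' j))) (insert (Suc x) ?X)"
  proof (rule agree_extend[OF k ag, of 0 "Suc x" a])
    show "case_nat 0 e i < m \<and> case_nat 0 e' i < m" if "i \<in> ?X" for i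
      using that X(2)[of "i - 1"] m2 by (cases i) auto
  qed (use X a in auto)
  have "agree k (case_nat 0 (e(x := a))) (case_nat 0 (e'(x := w (case_nat 0 e' j)))) (insert 0 (Suc ` X))"
    using agree_mono[OF w(6), of "insert 0 (Suc ` X)"] unfolding case_nat_fun_upd by auto
  moreover have "w (case_nat 0 e' j) \<in> inner" using w(3-5) by simp
  ultimately show ?thesis using that[OF w(1,2)] by blast
qed

end

section \<open>Restricting the quantifiers to values of terms\<close>

fun qrank :: "'c fm \<Rightarrow> nat" where
  "qrank (Neg \<phi>) = qrank \<phi>"
| "qrank (And \<phi> \<psi>) = max (qrank \<phi>) (qrank \<psi>)"
| "qrank (Or \<phi> \<psi>) = max (qrank \<phi>) (qrank \<psi>)"
| "qrank (Ex x \<phi>) = Suc (qrank \<phi>)"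
| "qrank (All x \<phi>) = Suc (qrank \<phi>)"
| "qrank _ = 0"

text \<open>The index \<open>i\<close> counts the enclosing quantifiers: witnesses are terms in the
  elements chosen before, so deeper quantifiers need larger ranges.\<close>

fun qsat :: "(nat \<Rightarrow> 'a set) \<Rightarrow> 'a rel \<Rightarrow> ('a \<Rightarrow> 'c) \<Rightarrow> nat \<Rightarrow> (nat \<Rightarrow> 'a) \<Rightarrow> 'c fm \<Rightarrow> bool" where
  "qsat Q r col i e (Eq x y) \<longleftrightarrow> e x = e y"
| "qsat Q r col i e (Leq x y) \<longleftrightarrow> (e x, e y) \<in> r"
| "qsat Q r col i e (Color c x) \<longleftrightarrow> col (e x) = c"
| "qsat Q r col i e (Neg \<phi>) \<longleftrightarrow> \<not> qsat Q r col i e \<phi>"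
| "qsat Q r col i e (And \<phi> \<psi>) \<longleftrightarrow> qsat Q r col i e \<phi> \<and> qsat Q r col i e \<psi>"
| "qsat Q r col i e (Or \<phi> \<psi>) \<longleftrightarrow> qsat Q r col i e \<phi> \<or> qsat Q r col i e \<psi>"
| "qsat Q r col i e (Ex x \<phi>) \<longleftrightarrow> (\<exists>a\<in>Q i. qsat Q r col (Suc i) (e(x := a)) \<phi>)"
| "qsat Q r col i e (All x \<phi>) \<longleftrightarrow> (\<forall>a\<in>Q i. qsat Q r col (Suc i) (e(x := a)) \<phi>)"

lemma finite_free_vars: "finite (free_vars \<phi>)"
  by (induction \<phi>) auto

locale colored_levels = levels +
  fixes col :: "nat \<Rightarrow> 'c" and \<Lambda> :: "'c set"
  assumes \<kappa>_col: "x \<in> inner \<Longrightarrow> y \<in> inner \<Longrightarrow> \<kappa> 0 x = \<kappa> 0 y \<Longrightarrow> c \<in> \<Lambda> \<Longrightarrow> col x = c \<longleftrightarrow> col y = c"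
begin

abbreviation "R \<equiv> {(x, y). le x y}"

lemma sat_agree_quantifier:
  assumes k: "k < K" and IH: "\<And>e e'. agree k (case_nat 0 e) (case_nat 0 e') (insert 0 (Suc ` free_vars \<phi>)) \<Longrightarrow>
      (\<And>v. v \<in> free_vars \<phi> \<Longrightarrow> e v \<in> inner \<and> e' v \<in> inner) \<Longrightarrow> sat inner R col e \<phi> \<longleftrightarrow> sat inner R col e' \<phi>"
    and ag: "agree (Suc k) (case_nat 0 e) (case_nat 0 e') (insert 0 (Suc ` (free_vars \<phi> - {x})))"
    and fv: "\<And>v. v \<in> free_vars \<phi> - {x} \<Longrightarrow> e v \<in> inner \<and> e' v \<in> inner"
  shows "sat inner R col e (Ex x \<phi>) \<longleftrightarrow> sat inner R col e' (Ex x \<phi>)"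
    and "sat inner R col e (All x \<phi>) \<longleftrightarrow> sat inner R col e' (All x \<phi>)"
proof -
  have step: "\<exists>a'\<in>inner. sat inner R col (f(x := a)) \<phi> \<longleftrightarrow> sat inner R col (f'(x := a')) \<phi>"
    if f: "agree (Suc k) (case_nat 0 f) (case_nat 0 f') (insert 0 (Suc ` (free_vars \<phi> - {x})))"
      "\<And>v. v \<in> free_vars \<phi> - {x} \<Longrightarrow> f v \<in> inner \<and> f' v \<in> inner" and a: "a \<in> inner" for f f' a
  proof -
    obtain w j where w: "w (case_nat 0 f' j) \<in> inner"
      "agree k (case_nat 0 (f(x := a))) (case_nat 0 (f'(x := w (case_nat 0 f' j)))) (insert 0 (Suc ` free_vars \<phi>))"
      by (rule agree_quantifier[OF k f(1) finite_free_vars f(2) a])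
    have "sat inner R col (f(x := a)) \<phi> \<longleftrightarrow> sat inner R col (f'(x := w (case_nat 0 f' j))) \<phi>"
      by (rule IH[OF w(2)]) (use f(2) a w(1) in auto)
    with w(1) show ?thesis by blast
  qed
  have fv': "e' v \<in> inner \<and> e v \<in> inner" if "v \<in> free_vars \<phi> - {x}" for v using fv[OF that] by simp
  note steps = step[OF ag fv] step[OF agree_sym[OF ag] fv']
  show "sat inner R col e (Ex x \<phi>) \<longleftrightarrow> sat inner R col e' (Ex x \<phi>)"
    unfolding sat.simps by (rule bex_transfer) (use steps in blast)+
  show "sat inner R col e (All x \<phi>) \<longleftrightarrow> sat inner R col e' (All x \<phi>)"
    unfolding sat.simps by (rule ball_transfer) (use steps in blast)+
qed

text \<open>The Ehrenfeucht-Fraisse argument: every quantifier spends one level. Atoms can be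
  decided at any level, because the identity is a term, equality is recovered from the order by
  antisymmetry, and every level refines level 0, which determines the colours.\<close>

lemma sat_agree:
  "\<lbrakk>qrank \<phi> \<le> k; k \<le> K; set_fm \<phi> \<subseteq> \<Lambda>;
    agree k (case_nat 0 e) (case_nat 0 e') (insert 0 (Suc ` free_vars \<phi>));
    \<And>v. v \<in> free_vars \<phi> \<Longrightarrow> e v \<in> inner \<and> e' v \<in> inner\<rbrakk>
   \<Longrightarrow> sat inner R col e \<phi> \<longleftrightarrow> sat inner R col e' \<phi>"
proof (induction \<phi> arbitrary: k e e')
  case (Eq x y)
  have "le (id (e u)) (id (e v)) \<longleftrightarrow> le (id (e' u)) (id (e' v))" if "u \<in> {x, y}" "v \<in> {x, y}" for u v
    using agree_le[OF Eq(4), of "Suc u" "Suc v" id id] that id_TS[of k] by auto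
  then have "le (e x) (e y) \<longleftrightarrow> le (e' x) (e' y)" "le (e y) (e x) \<longleftrightarrow> le (e' y) (e' x)" by auto
  moreover have "e x < m" "e' x < m" "e y < m" "e' y < m" using Eq(5)[of x] Eq(5)[of y] by auto
  ultimately show ?case using antisym refl by simp metis
next
  case (Leq x y)
  have "le (id (e x)) (id (e y)) \<longleftrightarrow> le (id (e' x)) (id (e' y))"
    using agree_le[OF Leq(4), of "Suc x" "Suc y" id id] id_TS[of k] by auto
  then show ?case by simp
next
  case (Color c x)
  have "\<kappa> k (id (e x)) = \<kappa> k (id (e' x))"
    using agree_\<kappa>[OF Color(4), of "Suc x" id] id_TS[of k] by auto
  moreover have ex: "e x \<in> inner" "e' x \<in> inner" using Color(5) by auto
  ultimately have "\<kappa> 0 (e x) = \<kappa> 0 (e' x)" using \<kappa>_zero[OF Color(2), of "e x" "e' x"] by auto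
  from \<kappa>_col[OF ex this, of c] show ?case using Color(3) by simp
next
  case (Neg \<phi>)
  have "sat inner R col e \<phi> \<longleftrightarrow> sat inner R col e' \<phi>"
    by (rule Neg.IH) (use Neg.prems in auto)
  then show ?case by simp
next
  case (And \<phi> \<psi>)
  have "sat inner R col e \<phi> \<longleftrightarrow> sat inner R col e' \<phi>"
    by (rule And.IH(1)[OF _ And.prems(2) _ agree_mono[OF And.prems(4)]]) (use And.prems in auto)
  moreover have "sat inner R col e \<psi> \<longleftrightarrow> sat inner R col e' \<psi>"
    by (rule And.IH(2)[OF _ And.prems(2) _ agree_mono[OF And.prems(4)]]) (use And.prems in auto)
  ultimately show ?case by simp
next
  case (Or \<phi> \<psi>)
  have "sat inner R col e \<phi> \<longleftrightarrow> sat inner R col e' \<phi>"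
    by (rule Or.IH(1)[OF _ Or.prems(2) _ agree_mono[OF Or.prems(4)]]) (use Or.prems in auto)
  moreover have "sat inner R col e \<psi> \<longleftrightarrow> sat inner R col e' \<psi>"
    by (rule Or.IH(2)[OF _ Or.prems(2) _ agree_mono[OF Or.prems(4)]]) (use Or.prems in auto)
  ultimately show ?case by simp
next
  case (Ex x \<phi>)
  then obtain k' where k': "k = Suc k'" "qrank \<phi> \<le> k'" by (cases k) auto
  have IH: "sat inner R col f \<phi> \<longleftrightarrow> sat inner R col f' \<phi>"
    if "agree k' (case_nat 0 f) (case_nat 0 f') (insert 0 (Suc ` free_vars \<phi>))"
      "\<And>v. v \<in> free_vars \<phi> \<Longrightarrow> f v \<in> inner \<and> f' v \<in> inner" for f f'
    by (rule Ex.IH[OF k'(2) _ _ that]) (use k' Ex.prems in auto)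
  show ?case
    by (rule sat_agree_quantifier(1)[OF _ IH]) (use k' Ex.prems in auto)
next
  case (All x \<phi>)
  then obtain k' where k': "k = Suc k'" "qrank \<phi> \<le> k'" by (cases k) auto
  have IH: "sat inner R col f \<phi> \<longleftrightarrow> sat inner R col f' \<phi>"
    if "agree k' (case_nat 0 f) (case_nat 0 f') (insert 0 (Suc ` free_vars \<phi>))"
      "\<And>v. v \<in> free_vars \<phi> \<Longrightarrow> f v \<in> inner \<and> f' v \<in> inner" for f f'
    by (rule All.IH[OF k'(2) _ _ that]) (use k' All.prems in auto)
  show ?case
    by (rule sat_agree_quantifier(2)[OF _ IH]) (use k' All.prems in auto)
qed

text \<open>The back-and-forth step is applied to the current assignment paired with itself. It
  replaces an arbitrary value of the quantified variable by a term in the assignment without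
  changing the truth value of the body, so the values of terms form a sufficient range.\<close>

theorem qsat_iff_sat:
  assumes W: "\<And>i. W i \<subseteq> {..<m}" "0 \<in> W 0" "\<And>i. W i \<subseteq> W (Suc i)"
    and cl: "\<And>i w x. w \<in> TS K \<Longrightarrow> x \<in> W i \<Longrightarrow> w x \<in> W (Suc i)"
  shows "\<lbrakk>qrank \<phi> \<le> K; set_fm \<phi> \<subseteq> \<Lambda>; \<And>v. v \<in> free_vars \<phi> \<Longrightarrow> e v \<in> W i \<inter> inner\<rbrakk>
    \<Longrightarrow> qsat (\<lambda>i. W (Suc i) \<inter> inner) R col i e \<phi> \<longleftrightarrow> sat inner R col e \<phi>"
proof (induction \<phi> arbitrary: i e)
  have W0: "0 \<in> W i" for i by (induction i) (use W in auto)
  have wit: "\<exists>a'\<in>W (Suc i) \<inter> inner. sat inner R col (e(x := a)) \<phi> \<longleftrightarrow> sat inner R col (e(x := a')) \<phi>"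
    if a: "a \<in> inner" and \<phi>: "Suc (qrank \<phi>) \<le> K" "set_fm \<phi> \<subseteq> \<Lambda>"
      and fv: "\<And>v. v \<in> free_vars \<phi> - {x} \<Longrightarrow> e v \<in> W i \<inter> inner" for a \<phi> e x i
  proof -
    obtain w j where w: "w \<in> TS (Suc (qrank \<phi>))" "j \<in> insert 0 (Suc ` (free_vars \<phi> - {x}))"
      "w (case_nat 0 e j) \<in> inner"
      "agree (qrank \<phi>) (case_nat 0 (e(x := a))) (case_nat 0 (e(x := w (case_nat 0 e j)))) (insert 0 (Suc ` free_vars \<phi>))"
      by (rule agree_quantifier[OF _ agree_refl finite_free_vars _ a, where k = "qrank \<phi>" and e = e and x = x])
        (use \<phi> fv in auto)
    have "case_nat 0 e j \<in> W i" using w(2) W0 fv by (auto split: nat.split)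
    moreover have "w \<in> TS K" using w(1) TS_mono[of "Suc (qrank \<phi>)" K] \<phi>(1) by auto
    ultimately have "w (case_nat 0 e j) \<in> W (Suc i)" using cl by blast
    moreover have "sat inner R col (e(x := a)) \<phi> \<longleftrightarrow> sat inner R col (e(x := w (case_nat 0 e j))) \<phi>"
      by (rule sat_agree[OF order.refl _ _ w(4)]) (use \<phi> a w(3) fv in auto)
    ultimately show ?thesis using w(3) by blast
  qed
  {
    case (Ex x \<phi>)
    have "qsat (\<lambda>i. W (Suc i) \<inter> inner) R col (Suc i) (e(x := a)) \<phi> \<longleftrightarrow> sat inner R col (e(x := a)) \<phi>"
      if "a \<in> W (Suc i) \<inter> inner" for a
      by (rule Ex.IH) (use Ex.prems that W(3) in \<open>auto simp: subset_iff\<close>)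
    then show ?case unfolding qsat.simps sat.simps using wit[of _ \<phi> x e i] Ex.prems by (intro bex_transfer) auto
  next
    case (All x \<phi>)
    have "qsat (\<lambda>i. W (Suc i) \<inter> inner) R col (Suc i) (e(x := a)) \<phi> \<longleftrightarrow> sat inner R col (e(x := a)) \<phi>"
      if "a \<in> W (Suc i) \<inter> inner" for a
      by (rule All.IH) (use All.prems that W(3) in \<open>auto simp: subset_iff\<close>)
    then show ?case unfolding qsat.simps sat.simps using wit[of _ \<phi> x e i] All.prems by (intro ball_transfer) auto
  }
qed auto

end

section \<open>Computing closures under the class functions\<close>

abbreviation seq (infixr ";;" 60) where "c ;; d \<equiv> Seq c d"

abbreviation (input) "rn \<equiv> 10::nat"
abbreviation (input) "rm \<equiv> 11::nat"
abbreviation (input) "rtop \<equiv> 12::nat"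
abbreviation (input) "rcb \<equiv> 13::nat"
abbreviation (input) "rfb \<equiv> 14::nat"
abbreviation (input) "rL \<equiv> 15::nat"
abbreviation (input) "rM \<equiv> 16::nat"
abbreviation (input) "rlb \<equiv> 17::nat"
abbreviation (input) "rd \<equiv> 18::nat"
abbreviation (input) "rlen \<equiv> 19::nat"
abbreviation (input) "rx \<equiv> 20::nat"
abbreviation (input) "rc \<equiv> 21::nat"
abbreviation (input) "ry \<equiv> 22::nat"
abbreviation (input) "rA \<equiv> 23::nat"
abbreviation (input) "rB \<equiv> 24::nat"
abbreviation (input) "rC \<equiv> 25::nat"
abbreviation (input) "rD \<equiv> 26::nat"
abbreviation (input) "rit \<equiv> 27::nat"
abbreviation (input) "ri \<equiv> 28::nat"
abbreviation (input) "rl \<equiv> 29::nat"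

abbreviation (input) "aLE \<equiv> 2::nat"
abbreviation (input) "aOFF \<equiv> 3::nat"
abbreviation (input) "aNC \<equiv> 4::nat"
abbreviation (input) "aCNT \<equiv> 5::nat"
abbreviation (input) "aHD \<equiv> 6::nat"
abbreviation (input) "aG \<equiv> 7::nat"
abbreviation (input) "aCH \<equiv> 8::nat"
abbreviation (input) "aK \<equiv> 9::nat"
abbreviation (input) "aCB \<equiv> 10::nat"
abbreviation (input) "aRP \<equiv> 11::nat"
abbreviation (input) "aT \<equiv> 12::nat"
abbreviation (input) "aU \<equiv> 13::nat"
abbreviation (input) "aW \<equiv> 14::nat"
abbreviation (input) "aML \<equiv> 15::nat"

text \<open>The machine cannot multiply, so the start of a matrix row is looked up in the table
  \<open>aOFF\<close>.\<close>

definition LEq :: "aexp \<Rightarrow> aexp \<Rightarrow> aexp" where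
  "LEq a b = Rd aLE (Plus (Rd aOFF a) b)"

definition Neq :: "aexp \<Rightarrow> aexp \<Rightarrow> aexp" where
  "Neq a b = Plus (Minus a b) (Minus b a)"

lemma acost_LEq [simp]: "acost (LEq a b) = 3 + acost a + acost b"
  by (simp add: LEq_def)

lemma acost_Neq [simp]: "acost (Neq a b) = 3 + 2 * acost a + 2 * acost b"
  by (simp add: Neq_def)

lemma aval_Neq [simp]: "(0 < aval (Neq a b) s) = (aval a s \<noteq> aval b s)"
  by (auto simp: Neq_def)

lemma aval_Neq0 [simp]: "(aval (Neq a b) s = 0) = (aval a s = aval b s)"
  by (auto simp: Neq_def)

definition order_stored :: "nat \<Rightarrow> (nat \<Rightarrow> nat \<Rightarrow> bool) \<Rightarrow> state \<Rightarrow> bool" where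
  "order_stored m le s \<longleftrightarrow> fst s rm = m \<and> fst s rtop = m - 1 \<and> (\<forall>x<m. snd s aOFF x = x * m) \<and>
     (\<forall>x<m. \<forall>y<m. snd s aLE (x * m + y) = of_bool (le x y))"

lemma order_stored_cong: "order_stored m le s \<Longrightarrow> fst s' rm = fst s rm \<Longrightarrow> fst s' rtop = fst s rtop \<Longrightarrow>
    snd s' aOFF = snd s aOFF \<Longrightarrow> snd s' aLE = snd s aLE \<Longrightarrow> order_stored m le s'"
  by (simp add: order_stored_def)

lemma aval_LEq: "order_stored m le s \<Longrightarrow> aval a s < m \<Longrightarrow> aval b s < m \<Longrightarrow>
    aval (LEq a b) s = of_bool (le (aval a s) (aval b s))"
  by (simp add: LEq_def order_stored_def)

text \<open>The sum of three truncated differences acts as a disjunction: \<open>y\<close> is the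
  bottom, or the top, or carries class number \<open>rc\<close>. One pass over \<open>y\<close>
  serves all four class functions.\<close>

definition SCANB :: com where
  "SCANB = If (Plus (Minus (N 1) (V ry)) (Plus (Minus (N 1) (Minus (V rtop) (V ry)))
      (Minus (N 1) (Neq (Rd aK (Plus (Rd aCB (V rc)) (V ry))) (V rc)))))
    (If (LEq (V rx) (V ry))
       (If (LEq (V ry) (V rA)) (Assign rA (V ry)) Skip)
       (If (LEq (V rD) (V ry)) (Assign rD (V ry)) Skip) ;;
     If (LEq (V ry) (V rx))
       (If (LEq (V rB) (V ry)) (Assign rB (V ry)) Skip)
       (If (LEq (V ry) (V rC)) (Assign rC (V ry)) Skip))
    Skip"

definition SCAN :: com where
  "SCAN = Assign rA (V rtop) ;; Assign rC (V rtop) ;; Assign rB (N 0) ;; Assign rD (N 0) ;;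
     For ry (V rm) SCANB"

lemma wregs_SCANB [simp]: "wregs SCANB = {rA, rB, rC, rD}"
  and warrs_SCANB [simp]: "warrs SCANB = {}"
  by (auto simp: SCANB_def)

lemma wregs_SCAN [simp]: "wregs SCAN = {rA, rB, rC, rD, ry}"
  and warrs_SCAN [simp]: "warrs SCAN = {}"
  by (auto simp: SCAN_def )

lemma scan_less: "r < m \<Longrightarrow> j \<le> m \<Longrightarrow> scan R P r j < m"
  by (induction j) auto

lemma wp_SCANB:
  assumes G: "order_stored m le s" and x: "fst s rx < m" "fst s ry < m" "fst s rA < m" "fst s rB < m" "fst s rC < m" "fst s rD < m"
    and S: "(snd s aK (snd s aCB (fst s rc) + fst s ry) = fst s rc) \<longleftrightarrow> S (fst s ry)"
  shows "wp SCANB (\<lambda>t s'. t \<le> 100 \<and>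
    fst s' rA = (if with_ends m S (fst s ry) \<and> le (fst s rx) (fst s ry) \<and> le (fst s ry) (fst s rA) then fst s ry else fst s rA) \<and>
    fst s' rB = (if with_ends m S (fst s ry) \<and> le (fst s ry) (fst s rx) \<and> le (fst s rB) (fst s ry) then fst s ry else fst s rB) \<and>
    fst s' rC = (if with_ends m S (fst s ry) \<and> \<not> le (fst s ry) (fst s rx) \<and> le (fst s ry) (fst s rC) then fst s ry else fst s rC) \<and>
    fst s' rD = (if with_ends m S (fst s ry) \<and> \<not> le (fst s rx) (fst s ry) \<and> le (fst s rD) (fst s ry) then fst s ry else fst s rD)) s"
proof -
  have G': "order_stored m le (f, snd s)" if "f rm = fst s rm" "f rtop = fst s rtop" for f
    using G by (rule order_stored_cong) (simp_all add: that)
  have h: "0 < aval (Plus (Minus (N 1) (V ry)) (Plus (Minus (N 1) (Minus (V rtop) (V ry)))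
      (Minus (N 1) (Neq (Rd aK (Plus (Rd aCB (V rc)) (V ry))) (V rc))))) s \<longleftrightarrow> with_ends m S (fst s ry)"
    using S G x(2) unfolding with_ends_def order_stored_def by (auto simp: Neq_def)
  show ?thesis
    unfolding SCANB_def
    apply (subst wp_If)
    unfolding neq0_conv h
    apply (cases "with_ends m S (fst s ry)")
     apply (simp_all add: wp_simps aval_LEq[OF G] aval_LEq[OF G'] x)
    done
qed

text \<open>Absorbs the constant overhead of a round into the bound on its body, so that time bounds
  remain plain products.\<close>

lemma loop_le: "1 \<le> B \<Longrightarrow> k \<le> k' \<Longrightarrow> k * (c + e * B) \<le> (c + e) * (k' * (B::nat))"
proof -
  assume B: "1 \<le> B" and k: "k \<le> k'"
  have "c \<le> c * B" using B by (cases B) auto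
  then have "c + e * B \<le> (c + e) * B" by (simp add: add_mult_distrib)
  then have "k * (c + e * B) \<le> k' * ((c + e) * B)" using k by (rule mult_le_mono[rotated])
  then show ?thesis by (simp add: mult.left_commute)
qed

lemma loop_bound:
  "t \<le> k * (c + e * B) \<Longrightarrow> 1 \<le> B \<Longrightarrow> k \<le> k' \<Longrightarrow> c + e \<le> f \<Longrightarrow> t \<le> f * (k' * (B::nat))"
  using loop_le[of B k k' c e] mult_le_mono1[of "c + e" f "k' * B"] by linarith

lemma wp_SCAN:
  assumes G: "order_stored m le s" and m: "0 < m" and x: "fst s rx < m"
    and S: "\<And>y. y < m \<Longrightarrow> (snd s aK (snd s aCB (fst s rc) + y) = fst s rc) \<longleftrightarrow> S y"
  shows "wp SCAN (\<lambda>t s'. t \<le> 120 * (m + 1) \<and> fst s' rA = least_above le m S (fst s rx) \<and> fst s' rB = greatest_below le m S (fst s rx) \<and>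
    fst s' rC = least_not_below le m S (fst s rx) \<and> fst s' rD = greatest_not_above le m S (fst s rx)) s"
proof -
  let ?x = "fst s rx"
  define I where "I j s' \<longleftrightarrow>
      fst s' rA = scan le (\<lambda>y. with_ends m S y \<and> le ?x y) (m - 1) j \<and>
      fst s' rB = scan (\<lambda>y r. le r y) (\<lambda>y. with_ends m S y \<and> le y ?x) 0 j \<and>
      fst s' rC = scan le (\<lambda>y. with_ends m S y \<and> \<not> le y ?x) (m - 1) j \<and>
      fst s' rD = scan (\<lambda>y r. le r y) (\<lambda>y. with_ends m S y \<and> \<not> le ?x y) 0 j" for j and s' :: state
  let ?s0 = "((fst s)(rA := fst s rtop, rC := fst s rtop, rB := 0, rD := 0), snd s)"
  have tp: "fst s rtop = m - 1" "fst s rm = m" using G by (simp_all add: order_stored_def)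
  have "wp (For ry (V rm) SCANB) (\<lambda>t s'. t \<le> (m + 1) * 108 \<and> I m s') ?s0"
  proof (rule wp_For[where k = m and T = 100 and Inv = I], goal_cases fresh bound init body post)
    case (body j s')
    note j = body(1,2,3,4)
    have fr: "fst s' x = fst ?s0 x" if "x \<notin> {rA, rB, rC, rD, ry}" for x
      using frame_reg[OF j(2)] that by simp
    have fa: "snd s' = snd s"
      using frame_arr[OF j(2)] by auto
    have "order_stored m le s'" using order_stored_cong[OF G] fr fa by simp
    moreover have "fst s' rA < m" "fst s' rB < m" "fst s' rC < m" "fst s' rD < m"
      using j(4) j(1) m scan_less[of _ m j] by (simp_all add: I_def)
    ultimately show ?case
      apply -
      apply (rule wp_mono[OF wp_SCANB[where m = m and le = le and S = S]])
      subgoal by assumption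
      subgoal using fr x by simp
      subgoal using j by simp
      subgoal by simp
      subgoal by simp
      subgoal by simp
      subgoal by simp
      subgoal using S[of j] fr fa j by simp
      subgoal using j fr by (simp add: I_def)
      done
  next
    case (bound s')
    show ?case using frame_reg[OF bound, of rm] tp by simp
  qed (use tp in \<open>auto simp: I_def\<close>)
  then show ?thesis unfolding SCAN_def
    by (simp add: wp_simps) (rule wp_mono, assumption, auto simp: I_def least_above_def greatest_below_def least_not_below_def greatest_not_above_def)
qed

definition holds :: "nat \<Rightarrow> state \<Rightarrow> nat list \<Rightarrow> bool" where
  "holds A s xs \<longleftrightarrow> fst s rlen = length xs \<and> (\<forall>i<length xs. snd s A i = xs ! i)"

text \<open>The tables of the levels lie one after another in \<open>aK\<close>, and
  \<open>aCB c\<close> is the start of the table of the level to which class \<open>c\<close>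
  belongs. As class numbers are never reused, the entry \<open>c\<close> there marks
  membership.\<close>

definition classes_stored :: "nat \<Rightarrow> (nat \<Rightarrow> nat \<Rightarrow> bool) \<Rightarrow> nat \<Rightarrow> state \<Rightarrow> bool" where
  "classes_stored m cls M s \<longleftrightarrow> fst s rM = M \<and> (\<forall>c<M. \<forall>y<m. (snd s aK (snd s aCB c + y) = c) = cls c y)"

lemma classes_stored_cong: "classes_stored m cls M s \<Longrightarrow> fst s' rM = fst s rM \<Longrightarrow> snd s' aK = snd s aK \<Longrightarrow> snd s' aCB = snd s aCB \<Longrightarrow>
    classes_stored m cls M s'"
  by (simp add: classes_stored_def)

lemma holds_cong: "holds A s xs \<Longrightarrow> fst s' rlen = fst s rlen \<Longrightarrow> snd s' A = snd s A \<Longrightarrow> holds A s' xs"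
  by (simp add: holds_def)

definition PUSH :: "nat \<Rightarrow> nat \<Rightarrow> com" where
  "PUSH A r = Store A (V rlen) (V r) ;; Assign rlen (Plus (V rlen) (N 1))"

lemma holds_push:
  "holds A s xs \<Longrightarrow> holds A ((fst s)(rlen := Suc (fst s rlen)), (snd s)(A := (snd s A)(fst s rlen := v))) (xs @ [v])"
  by (auto simp: holds_def nth_append less_Suc_eq)

lemma wp_PUSH:
  assumes "holds A s xs"
  shows "wp (PUSH A r) (\<lambda>t s'. t = 7 \<and> holds A s' (xs @ [fst s r])) s"
  using holds_push[OF assms, of "fst s r"] by (simp add: PUSH_def wp_simps)

definition APP :: "nat \<Rightarrow> com" where
  "APP A = SCAN ;; PUSH A rA ;; PUSH A rB ;; PUSH A rC ;; PUSH A rD"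

lemma wregs_PUSH [simp]: "wregs (PUSH A r) = {rlen}" and warrs_PUSH [simp]: "warrs (PUSH A r) = {A}"
  by (auto simp: PUSH_def)

lemma wregs_APP [simp]: "wregs (APP A) = {rA, rB, rC, rD, ry, rlen}" and warrs_APP [simp]: "warrs (APP A) = {A}"
  by (auto simp: APP_def )

lemma wp_APP:
  assumes G: "order_stored m le s" and m: "0 < m" and x: "fst s rx < m" and C: "classes_stored m cls M s" "fst s rc < M"
    and h: "holds A s xs" and A: "A \<notin> {aLE, aOFF, aK, aCB}"
  shows "wp (APP A) (\<lambda>t s'. t \<le> 150 * (m + 1) \<and>
     holds A s' (xs @ map (\<lambda>f. f (fst s rx)) [least_above le m (cls (fst s rc)), greatest_below le m (cls (fst s rc)),
        least_not_below le m (cls (fst s rc)), greatest_not_above le m (cls (fst s rc))])) s"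
  unfolding APP_def wp_Seq
  apply (rule wp_use[OF wp_SCAN[OF G m x, of "cls (fst s rc)"]])
  subgoal using C by (simp add: classes_stored_def)
  subgoal for t s1
    apply (rule wp_use[OF wp_PUSH[OF holds_cong[OF h]]])
    subgoal by (simp add: frame_reg )
    subgoal by (simp add: frame_arr )
    subgoal for u s2
      apply (rule wp_use[OF wp_PUSH], blast)
      subgoal for v s3
        apply (rule wp_use[OF wp_PUSH], blast)
        subgoal for w s4
          apply (rule wp_use[OF wp_PUSH], blast)
          by (simp add: frame_reg[of "PUSH _ _"] wregs_PUSH)
        done
      done
    done
  done

text \<open>The list grows while it is traversed. The length is therefore frozen in
  \<open>rl\<close> at the start of each round, so that a round performs exactly one
  \<open>close\<close>.\<close>

definition CL :: "nat \<Rightarrow> com" where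
  "CL A = For rit (V rd) (Assign rl (V rlen) ;;
     For ri (V rl) (Assign rx (Rd A (V ri)) ;; For rc (V rM) (APP A)))"

lemma wregs_CL [simp]: "wregs (CL A) = {rit, rl, ri, rx, rc, rA, rB, rC, rD, ry, rlen}"
  and warrs_CL [simp]: "warrs (CL A) = {A}"
  by (auto simp: CL_def )

lemma length_cl_mono: "d \<le> e \<Longrightarrow> length (cl fs d xs) \<le> length (cl fs e xs)"
  by (simp add: length_cl power_increasing)

text \<open>The three factors \<open>Z\<close> stand for the number of rounds, the length of the
  list and the number of classes; \<open>m + 1\<close> is the cost of a scan.\<close>

lemma wp_CL:
  assumes G: "order_stored m le s" and m: "0 < m" and C: "classes_stored m cls M s" and d: "fst s rd = d"
    and h: "holds A s xs" and xs: "set xs \<subseteq> {..<m}" and A: "A \<notin> {aLE, aOFF, aK, aCB}"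
    and Z: "length (cl (class_funs le m cls M) d xs) + 1 \<le> Z" "M + 1 \<le> Z" "d + 1 \<le> Z"
  shows "wp (CL A) (\<lambda>t s'. t \<le> 180 * (Z * (Z * (Z * (m + 1)))) \<and>
     holds A s' (cl (class_funs le m cls M) d xs) \<and> set (cl (class_funs le m cls M) d xs) \<subseteq> {..<m}) s"
proof -
  let ?fs = "class_funs le m cls M"
  have fs_less: "f x < m" if "f \<in> set ?fs" "x < m" for f x
    using that m by (auto simp: class_funs_def least_above_def greatest_below_def least_not_below_def greatest_not_above_def intro!: scan_less)
  have rM: "fst s rM = M" using C by (simp add: classes_stored_def)
  have inner: "wp (For rc (V rM) (APP A)) (\<lambda>t s'. t \<le> 158 * (Z * (m + 1)) \<and> holds A s' (ys @ map (\<lambda>f. f x) ?fs)) s1"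
    if "order_stored m le s1" "classes_stored m cls M s1" "fst s1 rx = x" "x < m" "holds A s1 ys" for s1 x ys
  proof (rule wp_For[where k = M and T = "150 * (m + 1)" and
        Inv = "\<lambda>j s'. holds A s' (ys @ map (\<lambda>f. f x) (class_funs le m cls j))"], goal_cases fresh bound init body post)
    case (body j s')
    note j = body(1,2,3,4)
    have "fst s' r = fst s1 r" if "r \<in> {rm, rtop, rM, rx}" for r
      using frame_reg[OF j(2), of r] that by auto
    moreover have "snd s' B = snd s1 B" if "B \<in> {aLE, aOFF, aK, aCB}" for B
      using frame_arr[OF j(2), of B] that A by auto
    ultimately have "order_stored m le s'" "classes_stored m cls M s'" "fst s' rx = x"
      using order_stored_cong[OF that(1)] classes_stored_cong[OF that(2)] that(3) by auto
    then show ?case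
      apply -
      apply (rule wp_mono[OF wp_APP[OF _ m _ _ _ j(4) A]])
      using that(4) j by (auto simp: class_funs_def holds_def)
  next
    case (bound s')
    show ?case using frame_reg[OF bound, of rM] \<open>classes_stored m cls M s1\<close> by (simp add: classes_stored_def)
  next
    case (post t s')
    note post(1,4)
    then show ?case
      using loop_le[of "m + 1" "M + 1" Z 8 150] Z by simp
  qed (use that(5) in \<open>auto simp: class_funs_def holds_def\<close>)
  let ?c2 = "Assign rx (Rd A (V ri)) ;; For rc (V rM) (APP A)"
  have middle: "wp (For ri (V rl) ?c2) (\<lambda>t s'. t \<le> 169 * (Z * (Z * (m + 1))) \<and> holds A s' (close ?fs ys)) s1"
    if "order_stored m le s1" "classes_stored m cls M s1" "fst s1 rl = length ys" "set ys \<subseteq> {..<m}" "holds A s1 ys"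
      "length ys + 1 \<le> Z" for s1 ys
  proof (rule wp_For[where k = "length ys" and T = "161 * (Z * (m + 1))" and
        Inv = "\<lambda>j s'. holds A s' (ys @ concat (map (\<lambda>x. map (\<lambda>f. f x) ?fs) (take j ys)))"], goal_cases fresh bound init body post)
    case (body j s')
    note j = body(1,2,3,4)
    have fr: "fst s' r = fst s1 r" if "r \<in> {rm, rtop, rM}" for r
      using frame_reg[OF j(2), of r] that by auto
    have fa: "snd s' B = snd s1 B" if "B \<in> {aLE, aOFF, aK, aCB}" for B
      using frame_arr[OF j(2), of B] that A by auto
    let ?s2 = "((fst s')(rx := ys ! j), snd s')"
    have yj: "snd s' A j = ys ! j" using j(1,4) by (simp add: holds_def nth_append)
    have tk: "take (Suc j) ys = take j ys @ [ys ! j]" using j(1) by (rule take_Suc_conv_app_nth)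
    have "wp (For rc (V rM) (APP A)) (\<lambda>t s'. t \<le> 158 * (Z * (m + 1)) \<and>
        holds A s' ((ys @ concat (map (\<lambda>x. map (\<lambda>f. f x) ?fs) (take j ys))) @ map (\<lambda>f. f (ys ! j)) ?fs)) ?s2"
    proof (rule inner)
      show "ys ! j < m" using that(4) j(1) nth_mem by blast
    qed (use order_stored_cong[OF that(1)] classes_stored_cong[OF that(2)] fr fa holds_cong[OF j(4)] in auto)
    then show ?case
      unfolding wp_Seq wp_Assign
      apply (simp add: j(3) yj)
      apply (rule wp_mono, assumption)
      using Z(2) by (auto simp: tk holds_def)
  next
    case (bound s')
    show ?case using frame_reg[OF bound, of rl] \<open>fst s1 rl = length ys\<close> by simp
  next
    case (post t s')
    note post(1,4)
    then show ?case
      using loop_le[of "Z * (m + 1)" "length ys + 1" Z 8 161] Z that(6) by (simp add: close_def)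
  qed (use that(5) in \<open>auto simp: holds_def\<close>)
  let ?c1 = "Assign rl (V rlen) ;; For ri (V rl) ?c2"
  have "1 \<le> Z * (Z + Z * m)" using Z(2) by simp
  then have Zt: "Suc (Suc t) \<le> 171 * (Z * (Z + Z * m))" if "t \<le> 169 * (Z * (Z + Z * m))" for t
    using that by linarith
  show ?thesis unfolding CL_def
  proof (rule wp_For[where k = d and T = "171 * (Z * (Z * (m + 1)))" and
        Inv = "\<lambda>j s'. holds A s' (cl ?fs j xs) \<and> set (cl ?fs j xs) \<subseteq> {..<m}"], goal_cases fresh bound init body post)
    case (body j s')
    note j = body(1,2,3) and I = body(4)
    have fr: "fst s' r = fst s r" if "r \<in> {rm, rtop, rM}" for r
      using frame_reg[OF j(2), of r] that by auto
    have fa: "snd s' B = snd s B" if "B \<in> {aLE, aOFF, aK, aCB}" for B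
      using frame_arr[OF j(2), of B] that A by auto
    let ?s2 = "((fst s')(rl := length (cl ?fs j xs)), snd s')"
    have "wp (For ri (V rl) ?c2) (\<lambda>t s'. t \<le> 169 * (Z * (Z * (m + 1))) \<and> holds A s' (close ?fs (cl ?fs j xs))) ?s2"
    proof (rule middle)
      show "length (cl ?fs j xs) + 1 \<le> Z" using length_cl_mono[of j d ?fs xs] j(1) Z(1) by simp
    qed (use order_stored_cong[OF G] classes_stored_cong[OF C] fr fa I holds_cong[of A s'] in auto)
    moreover have "set (close ?fs (cl ?fs j xs)) \<subseteq> {..<m}" using I fs_less by (auto simp: close_def subset_iff)
    ultimately show ?case
      unfolding wp_Seq[of "Assign rl (V rlen)"] wp_Assign
      using I apply (simp add: holds_def[of A s'])
      apply (rule wp_mono, assumption)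
      by (auto simp: holds_def intro!: Zt)
  next
    case (bound s')
    show ?case using frame_reg[OF bound, of rd] d by simp
  next
    case (post t s')
    note post(1,4)
    then show ?case
      using loop_le[of "Z * (Z * (m + 1))" "d + 1" Z 8 171] Z by simp
  qed (use h xs in \<open>auto simp: holds_def\<close>)
qed

section \<open>Refining the classes\<close>

abbreviation (input) "rf \<equiv> 30::nat"
abbreviation (input) "rj \<equiv> 31::nat"
abbreviation (input) "rxx \<equiv> 32::nat"
abbreviation (input) "rM2 \<equiv> 33::nat"
abbreviation (input) "rcc \<equiv> 34::nat"
abbreviation (input) "rlb2 \<equiv> 35::nat"
abbreviation (input) "rfd \<equiv> 36::nat"
abbreviation (input) "rcur \<equiv> 37::nat"

declare split_of_bool [split del]

text \<open>Position \<open>i * length T + j\<close> of the product list is the pair of entries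
  \<open>i\<close> and \<open>j\<close>, so the flat list of truth values is the comparison matrix.
  The right-hand side is what two nested loops can test.\<close>

lemma signature_eq_iff:
  assumes "length T = length U"
  shows "signature le \<kappa> T = signature le \<kappa> U \<longleftrightarrow>
    (\<forall>i<length T. \<kappa> (T ! i) = \<kappa> (U ! i) \<and> (\<forall>j<length T. le (T ! i) (T ! j) = le (U ! i) (U ! j)))"
proof -
  have 1: "map \<kappa> T = map \<kappa> U \<longleftrightarrow> (\<forall>i<length T. \<kappa> (T ! i) = \<kappa> (U ! i))"
    using assms by (auto simp: list_eq_iff_nth_eq)
  have nth: "length xs = length ys \<Longrightarrow> i < length xs * length xs \<Longrightarrow>
     List.product xs ys ! i = (xs ! (i div length xs), ys ! (i mod length xs))" for xs ys :: "nat list" and i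
    by (simp add: product_nth)
  have 2: "map (\<lambda>(u, v). le u v) (List.product T T) = map (\<lambda>(u, v). le u v) (List.product U U) \<longleftrightarrow>
      (\<forall>i<length T. \<forall>j<length T. le (T ! i) (T ! j) = le (U ! i) (U ! j))" (is "?l = ?r")
  proof
    assume l: ?l
    show ?r
    proof (intro allI impI)
      fix i j assume ij: "i < length T" "j < length T"
      then have "length T \<noteq> 0" by auto
      have lt: "i * length T + j < length T * length T"
      proof -
        have "i * length T + j < Suc i * length T" using ij by simp
        also have "\<dots> \<le> length T * length T" using ij by (intro mult_le_mono1) simp
        finally show ?thesis .
      qed
      have "map (\<lambda>(u, v). le u v) (List.product T T) ! (i * length T + j) =
          map (\<lambda>(u, v). le u v) (List.product U U) ! (i * length T + j)" using l by simp
      then show "le (T ! i) (T ! j) = le (U ! i) (U ! j)"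
        using lt ij assms \<open>length T \<noteq> 0\<close> by (simp add: nth)
    qed
  next
    assume r: ?r
    show ?l
    proof (rule nth_equalityI)
      fix k assume "k < length (map (\<lambda>(u, v). le u v) (List.product T T))"
      then have k: "k < length T * length T" by simp
      then have "0 < length T" by (cases "length T") auto
      with k have "k div length T < length T" "k mod length T < length T"
        by (simp_all add: less_mult_imp_div_less)
      with r k assms show "map (\<lambda>(u, v). le u v) (List.product T T) ! k =
          map (\<lambda>(u, v). le u v) (List.product U U) ! k" by (simp add: nth)
    qed (use assms in simp)
  qed
  show ?thesis unfolding signature_def prod.inject 1 2 by blast
qed

definition CMPI :: com where
  "CMPI = If (Neq (LEq (Rd aT (V ri)) (Rd aT (V rj))) (LEq (Rd aU (V ri)) (Rd aU (V rj)))) (Assign rf (N 0)) Skip"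

definition CMP :: com where
  "CMP = Assign rf (N 1) ;; For ri (V rlen) (
     If (Neq (Rd aK (Plus (V rlb) (Rd aT (V ri)))) (Rd aK (Plus (V rlb) (Rd aU (V ri))))) (Assign rf (N 0)) Skip ;;
     For rj (V rlen) CMPI)"

lemma wregs_CMPI [simp]: "wregs CMPI = {rf}" and warrs_CMPI [simp]: "warrs CMPI = {}"
  by (auto simp: CMPI_def)

lemma wregs_CMP [simp]: "wregs CMP = {rf, ri, rj}" and warrs_CMP [simp]: "warrs CMP = {}"
  by (auto simp: CMP_def)

lemma wp_CMP:
  assumes G: "order_stored m le s" and h: "holds aT s T" "holds aU s U" and TU: "set T \<subseteq> {..<m}" "set U \<subseteq> {..<m}"
    and \<kappa>: "\<And>x. x < m \<Longrightarrow> snd s aK (fst s rlb + x) = \<kappa> x"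
    and Z: "length T + 1 \<le> Z"
  shows "wp CMP (\<lambda>t s'. t \<le> 80 * (Z * Z) \<and> fst s' rf = of_bool (signature le \<kappa> T = signature le \<kappa> U)) s"
proof -
  have len: "length T = length U" "fst s rlen = length T" using h by (auto simp: holds_def)
  have lt: "T ! i < m" "U ! i < m" if "i < length T" for i
    using subsetD[OF TU(1) nth_mem[of i T]] subsetD[OF TU(2) nth_mem[of i U]] that len by simp_all
  have inner: "wp (For rj (V rlen) CMPI) (\<lambda>t s'. t \<le> 42 * Z \<and>
      fst s' rf = of_bool (b \<and> (\<forall>j<length T. le (T ! i) (T ! j) = le (U ! i) (U ! j)))) s1"
    if s1: "order_stored m le s1" "holds aT s1 T" "holds aU s1 U" "fst s1 rf = of_bool b" "fst s1 ri = i" "i < length T"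
    for s1 b i
  proof (rule wp_For[where k = "length T" and T = 34 and Inv =
        "\<lambda>j s'. fst s' rf = of_bool (b \<and> (\<forall>j'<j. le (T ! i) (T ! j') = le (U ! i) (U ! j')))"], goal_cases fresh bound init body post)
    case (body j s')
    note j = body(1,2,3,4)
    have arr: "snd s' = snd s1" using frame_arr[OF j(2)] by auto
    have i: "fst s' ri = i" using frame_reg[OF j(2), of ri] s1(5) by simp
    have G': "order_stored m le s'" by (rule order_stored_cong[OF s1(1)]) (use frame_reg[OF j(2)] arr in auto)
    have vals: "snd s' aT i = T ! i" "snd s' aT j = T ! j" "snd s' aU i = U ! i" "snd s' aU j = U ! j"
      using s1 j(1) len arr by (auto simp: holds_def)
    have "aval (LEq (Rd aT (V ri)) (Rd aT (V rj))) s' = of_bool (le (T ! i) (T ! j))"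
      "aval (LEq (Rd aU (V ri)) (Rd aU (V rj))) s' = of_bool (le (U ! i) (U ! j))"
      using aval_LEq[OF G'] vals i j(1,3) lt s1(6) by simp_all
    then show ?case
      using j(4) by (auto simp: CMPI_def wp_simps less_Suc_eq split: split_of_bool)
  next
    case (bound s')
    show ?case using frame_reg[OF bound, of rlen] s1(2) by (simp add: holds_def)
  qed (use s1 Z in auto)
  let ?c = "If (Neq (Rd aK (Plus (V rlb) (Rd aT (V ri)))) (Rd aK (Plus (V rlb) (Rd aU (V ri))))) (Assign rf (N 0)) Skip ;;
     For rj (V rlen) CMPI"
  let ?P = "\<lambda>i. \<kappa> (T ! i) = \<kappa> (U ! i) \<and> (\<forall>j<length T. le (T ! i) (T ! j) = le (U ! i) (U ! j))"
  have "wp (For ri (V rlen) ?c) (\<lambda>t s'. t \<le> 76 * (Z * Z) \<and> fst s' rf = of_bool (\<forall>i<length T. ?P i))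
     ((fst s)(rf := 1), snd s)"
  proof (rule wp_For[where k = "length T" and T = "26 + 42 * Z" and Inv =
        "\<lambda>i s'. fst s' rf = of_bool (\<forall>i'<i. ?P i')"], goal_cases fresh bound init body post)
    case (body i s')
    note i = body(1,2,3,4)
    have arr: "snd s' = snd s" using frame_arr[OF i(2)] by auto
    have G': "order_stored m le s'" by (rule order_stored_cong[OF G]) (use frame_reg[OF i(2)] arr in auto)
    have lb: "fst s' rlb = fst s rlb" "fst s' rlen = fst s rlen" using frame_reg[OF i(2)] by auto
    have hh: "holds aT s' T" "holds aU s' U" using h arr lb by (auto simp: holds_def)
    have vals: "snd s aT i = T ! i" "snd s aU i = U ! i" using h i(1) len by (auto simp: holds_def)
    have G2: "order_stored m le ((fst s')(rf := v), snd s)" for v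
      by (rule order_stored_cong[OF G']) (simp_all add: arr)
    have hh2: "holds aT ((fst s')(rf := v), snd s) T" "holds aU ((fst s')(rf := v), snd s) U" for v
      using hh arr by (auto simp: holds_def)
    note I0 = inner[OF G2 hh2, of 0 False i]
      and I1 = inner[OF G' hh, of "\<forall>i'<i. ?P i'" i]
    show ?case
    proof (cases "\<kappa> (T ! i) = \<kappa> (U ! i)")
      case True
      show ?thesis unfolding wp_Seq wp_If
        using True i(3) arr vals lb \<kappa> lt[OF i(1)]
        apply (simp add: wp_simps)
        apply (rule wp_mono[OF I1])
        using i by (auto simp: All_less_Suc conj_commute)
    next
      case False
      show ?thesis unfolding wp_Seq wp_If
        using False i(3) arr vals lb \<kappa> lt[OF i(1)]
        apply (simp add: wp_simps)
        apply (rule wp_mono[OF I0])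
        using i by (auto simp: less_Suc_eq)
    qed
  next
    case (post t s')
    note post(1,4)
    then show ?case
      using loop_le[of Z "length T + 1" Z 34 42] Z by simp
  next
    case (bound s')
    show ?case using frame_reg[OF bound, of rlen] h by (simp add: holds_def)
  qed auto
  moreover have "1 \<le> Z * Z" using Z by simp
  then have "t + 2 \<le> 80 * (Z * Z)" if "t \<le> 76 * (Z * Z)" for t using that by linarith
  ultimately show ?thesis unfolding CMP_def wp_Seq[of "Assign rf (N 1)"] wp_Assign signature_eq_iff[OF len(1)]
    by simp (erule wp_mono, auto)
qed

text \<open>The closure of a representative is recomputed for each comparison. This takes a bounded
  number of scans, and there are boundedly many representatives, so the work per element remains
  linear and that per level quadratic.\<close>

definition SEARCHB :: com where
  "SEARCHB = Assign rcur (Plus (V rM) (V rcc)) ;; Store aU (N 0) (Rd aRP (V rcur)) ;; Assign rlen (N 1) ;;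
     CL aU ;; CMP ;;
     If (V rf) (Assign rfd (N 1) ;; Store aK (Plus (V rlb2) (V rxx)) (V rcur)) Skip"

definition NEWCLASS :: com where
  "NEWCLASS = Store aRP (V rM2) (V rxx) ;; Store aCB (V rM2) (V rlb2) ;;
     Store aK (Plus (V rlb2) (V rxx)) (V rM2) ;; Assign rM2 (Plus (V rM2) (N 1))"

definition LEVELB :: com where
  "LEVELB = Store aT (N 0) (V rxx) ;; Assign rlen (N 1) ;; CL aT ;; Assign rfd (N 0) ;;
     For rcc (Minus (V rM2) (V rM)) SEARCHB ;;
     If (V rfd) Skip NEWCLASS"

definition LEVEL :: com where
  "LEVEL = Assign rlb2 (Plus (V rlb) (V rm)) ;; Assign rM2 (V rM) ;; For rxx (V rm) LEVELB ;;
     Assign rM (V rM2) ;; Assign rlb (V rlb2) ;; Assign rd (Plus (V rd) (Plus (V rd) (N 1)))"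

abbreviation "clregs \<equiv> {rit, rl, ri, rx, rc, rA, rB, rC, rD, ry, rlen}"

lemma wregs_SEARCHB [simp]: "wregs SEARCHB = {rcur, rf, rj, rfd} \<union> clregs" and warrs_SEARCHB [simp]: "warrs SEARCHB = {aU, aK}"
  by (auto simp: SEARCHB_def)

lemma wregs_NEWCLASS [simp]: "wregs NEWCLASS = {rM2}" and warrs_NEWCLASS [simp]: "warrs NEWCLASS = {aRP, aCB, aK}"
  by (auto simp: NEWCLASS_def)

lemma wregs_LEVELB [simp]: "wregs LEVELB = {rcur, rf, rj, rfd, rcc, rM2} \<union> clregs"
  and warrs_LEVELB [simp]: "warrs LEVELB = {aT, aU, aK, aRP, aCB}"
  by (auto simp: LEVELB_def)

text \<open>\<open>K0\<close> and \<open>CB0\<close> are the tables of the earlier levels. The step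
  writes to \<open>aK\<close> only from index \<open>lb + m\<close> on and to \<open>aCB\<close>
  only from class number \<open>M\<close> on, so the class functions in use do not change while new
  classes appear.\<close>

locale level_step =
  fixes m :: nat and le :: "nat \<Rightarrow> nat \<Rightarrow> bool" and cls :: "nat \<Rightarrow> nat \<Rightarrow> bool" and M d lb Z B :: nat
    and K0 CB0 \<kappa> :: "nat \<Rightarrow> nat"
  assumes m: "0 < m"
    and cls: "\<And>c y. c < M \<Longrightarrow> y < m \<Longrightarrow> (K0 (CB0 c + y) = c) = cls c y"
    and CB0: "\<And>c. c < M \<Longrightarrow> CB0 c \<le> lb"
    and \<kappa>: "\<And>x. x < m \<Longrightarrow> K0 (lb + x) = \<kappa> x"
    and Z: "length (cl (class_funs le m cls M) d [0]) + 1 \<le> Z" "M + 1 \<le> Z" "d + 1 \<le> Z"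
    and B: "B = Z * (Z * (Z * (m + 1)))"
begin

definition clo :: "nat \<Rightarrow> nat list" where
  "clo x = cl (class_funs le m cls M) d [x]"

definition sig :: "nat \<Rightarrow> nat list \<times> bool list" where
  "sig x = signature le \<kappa> (clo x)"

definition inv :: "state \<Rightarrow> bool" where
  "inv s \<longleftrightarrow> order_stored m le s \<and> fst s rM = M \<and> fst s rd = d \<and> fst s rlb = lb \<and> fst s rlb2 = lb + m \<and>
     (\<forall>i<lb + m. snd s aK i = K0 i) \<and> (\<forall>c<M. snd s aCB c = CB0 c)"

lemma inv_cong: "inv s \<Longrightarrow> (\<And>r. r \<in> {rm, rtop, rM, rd, rlb, rlb2} \<Longrightarrow> fst s' r = fst s r) \<Longrightarrow>
    (\<And>A. A \<in> {aLE, aOFF} \<Longrightarrow> snd s' A = snd s A) \<Longrightarrow>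
    (\<And>i. i < lb + m \<Longrightarrow> snd s' aK i = snd s aK i) \<Longrightarrow> (\<And>c. c < M \<Longrightarrow> snd s' aCB c = snd s aCB c) \<Longrightarrow> inv s'"
  using order_stored_cong[of m le s s'] by (simp add: inv_def)

lemma inv_classes_stored: "inv s \<Longrightarrow> classes_stored m cls M s"
  unfolding inv_def classes_stored_def
proof (elim conjE, intro conjI allI impI)
  fix c y assume *: "c < M" "y < m" "\<forall>i<lb + m. snd s aK i = K0 i" "\<forall>c<M. snd s aCB c = CB0 c"
  then have "CB0 c + y < lb + m" using CB0[of c] by simp
  then show "(snd s aK (snd s aCB c + y) = c) = cls c y" using * cls[of c y] by simp
qed

lemma length_clo: "length (clo x) + 1 \<le> Z"
  using Z(1) by (simp add: clo_def length_cl)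

lemma B_bounds: "Z * Z \<le> B" "Z \<le> B" "1 \<le> B"
proof -
  have z: "1 \<le> Z" using Z by simp
  then have "Z * Z \<le> Z * (Z * (Z * (m + 1)))" by simp
  then show "Z * Z \<le> B" unfolding B .
  moreover have "Z \<le> Z * Z" using z by simp
  ultimately show "Z \<le> B" "1 \<le> B" using z by linarith+
qed

lemma wp_clo:
  assumes "inv s" "A \<notin> {aLE, aOFF, aK, aCB}" "fst s rlen = 1" "snd s A 0 = x" "x < m"
  shows "wp (CL A) (\<lambda>t s'. t \<le> 180 * B \<and> holds A s' (clo x) \<and> set (clo x) \<subseteq> {..<m}) s"
  unfolding clo_def B
  by (rule wp_CL) (use assms m inv_classes_stored[OF assms(1)] Z length_clo[of x] in \<open>auto simp: inv_def holds_def clo_def\<close>)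

lemma wp_SEARCHB:
  assumes inv: "inv s" and T: "\<forall>i<length (clo x). snd s aT i = clo x ! i" "set (clo x) \<subseteq> {..<m}"
    and x: "fst s rxx = x" "x < m" and c: "snd s aRP (M + fst s rcc) = y" "y < m"
  shows "wp SEARCHB (\<lambda>t s'. t \<le> 300 * B \<and> inv s' \<and>
     fst s' rfd = (if sig x = sig y then 1 else fst s rfd) \<and>
     snd s' aK = (if sig x = sig y then (snd s aK)(lb + m + x := M + fst s rcc) else snd s aK)) s"
proof -
  let ?s1 = "((fst s)(rcur := M + fst s rcc, rlen := 1), (snd s)(aU := (snd s aU)(0 := y)))"
  have i1: "inv ?s1" by (rule inv_cong[OF inv]) auto
  have cl: "wp (CL aU) (\<lambda>t s'. t \<le> 180 * B \<and> holds aU s' (clo y) \<and> set (clo y) \<subseteq> {..<m}) ?s1"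
    by (rule wp_clo[OF i1]) (use c in auto)
  have "wp (CL aU ;; CMP ;; If (V rf) (Assign rfd (N 1) ;; Store aK (Plus (V rlb2) (V rxx)) (V rcur)) Skip)
    (\<lambda>t s'. t \<le> 280 * B \<and> inv s' \<and> fst s' rfd = (if sig x = sig y then 1 else fst s rfd) \<and>
     snd s' aK = (if sig x = sig y then (snd s aK)(lb + m + x := M + fst s rcc) else snd s aK)) ?s1"
    unfolding wp_Seq[of "CL aU"]
  proof (rule wp_use[OF cl], goal_cases step)
    case (step t s2)
    note 2 = step(1,2)
    have i2: "inv s2" by (rule inv_cong[OF i1]) (use frame_reg[OF 2(2)] frame_arr[OF 2(2)] in auto)
    have hT: "holds aT s2 (clo x)"
      using 2(1) T(1) frame_arr[OF 2(2), of aT] by (simp add: holds_def clo_def length_cl)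
    have "wp CMP (\<lambda>t s'. t \<le> 80 * (Z * Z) \<and> fst s' rf = of_bool (signature le \<kappa> (clo x) = signature le \<kappa> (clo y))) s2"
      by (rule wp_CMP[OF _ hT]) (use i2 2(1) T(2) \<kappa> length_clo in \<open>auto simp: inv_def\<close>)
    then show ?case
      unfolding wp_Seq[of CMP]
    proof (rule wp_use, goal_cases step)
      case (step u s3)
      note 3 = step(1,2)
      have i3: "inv s3" by (rule inv_cong[OF i2]) (use frame_reg[OF 3(2)] frame_arr[OF 3(2)] in auto)
      have i4: "inv ((fst s3)(rfd := 1), (snd s3)(aK := (snd s3 aK)(lb + m + x := v)))" for v
        by (rule inv_cong[OF i3]) auto
      have "fst s3 rxx = x" "fst s3 rlb2 = lb + m" "fst s3 rcur = M + fst s rcc" "snd s3 aK = snd s aK"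
          "fst s3 rfd = fst s rfd"
        using frame_reg[OF 3(2)] frame_reg[OF 2(2)] frame_arr[OF 3(2)] frame_arr[OF 2(2)] x inv
        by (simp_all add: inv_def)
      then show ?case
        using 2(1) 3(1) B_bounds i3 i4 by (simp add: wp_simps sig_def)
    qed
  qed
  then show ?thesis unfolding SEARCHB_def
    using inv c(1) apply (simp add: wp_simps(1-3) wp_Seq[of "Assign _ _"] wp_Seq[of "Store _ _ _"] inv_def[of s]
        split del: if_split)
    apply (erule wp_mono)
    using B_bounds(3) by auto
qed

end

context level_step
begin

lemma wp_search:
  assumes inv: "inv s" and T: "\<forall>i<length (clo x). snd s aT i = clo x ! i" "set (clo x) \<subseteq> {..<m}"
    and x: "fst s rxx = x" "x < m" and M2: "fst s rM2 = M2" "M \<le> M2" "M2 - M + 1 \<le> Z"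
    and RP: "\<And>c. M \<le> c \<Longrightarrow> c < M2 \<Longrightarrow> snd s aRP c < m" and fd: "fst s rfd = 0"
  shows "wp (For rcc (Minus (V rM2) (V rM)) SEARCHB) (\<lambda>t s'. t \<le> 310 * (Z * B) \<and> inv s' \<and>
     (\<forall>i. i \<noteq> lb + m + x \<longrightarrow> snd s' aK i = snd s aK i) \<and>
     (fst s' rfd = 0 \<and> (\<forall>c\<in>{M..<M2}. sig x \<noteq> sig (snd s aRP c)) \<or>
      fst s' rfd = 1 \<and> (\<exists>c\<in>{M..<M2}. sig x = sig (snd s aRP c) \<and> snd s' aK (lb + m + x) = c))) s"
    (is "wp ?c ?Q s")
proof (rule wp_For[where k = "M2 - M" and T = "300 * B" and Inv = "\<lambda>j s'. inv s' \<and>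
     (\<forall>i. i \<noteq> lb + m + x \<longrightarrow> snd s' aK i = snd s aK i) \<and>
     (fst s' rfd = 0 \<and> (\<forall>c\<in>{M..<M + j}. sig x \<noteq> sig (snd s aRP c)) \<or>
      fst s' rfd = 1 \<and> (\<exists>c\<in>{M..<M + j}. sig x = sig (snd s aRP c) \<and> snd s' aK (lb + m + x) = c))"], goal_cases fresh bound init body post)
  case (body j s')
  note j = body(1,2,3) and I = body(4)
  have y: "snd s aRP (M + j) < m" using RP[of "M + j"] j(1) by simp
  have "wp SEARCHB (\<lambda>t s''. t \<le> 300 * B \<and> inv s'' \<and>
     fst s'' rfd = (if sig x = sig (snd s aRP (M + j)) then 1 else fst s' rfd) \<and>
     snd s'' aK = (if sig x = sig (snd s aRP (M + j)) then (snd s' aK)(lb + m + x := M + fst s' rcc) else snd s' aK)) s'"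
    by (rule wp_SEARCHB) (use I T x j y frame_reg[OF j(2)] frame_arr[OF j(2)] in auto)
  then show ?case
  proof (rule wp_mono, goal_cases step)
    case (step t s'')
    note * = step(1)
    have "inv ((fst s'')(rcc := Suc j), snd s'')" by (rule inv_cong[of s'']) (use * in auto)
    then show ?case
      using * I j(3) by (cases "sig x = sig (snd s aRP (M + j))") (auto simp: atLeastLessThanSuc)
  qed
next
  case (bound s')
  show ?case using frame_reg[OF bound, of rM2] frame_reg[OF bound, of rM] M2 inv by (simp add: inv_def)
next
  case (post t s')
  note post(1) and I = post(4)
  moreover have "t \<le> 310 * (Z * B)"
    using loop_le[OF B_bounds(3) M2(3), of 10 300] calculation(1) by simp
  ultimately show ?case using M2(2) by simp
next
  show "inv ((fst s)(rcc := 0), snd s) \<and>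
     (\<forall>i. i \<noteq> lb + m + x \<longrightarrow> snd ((fst s)(rcc := 0), snd s) aK i = snd s aK i) \<and>
     (fst ((fst s)(rcc := 0), snd s) rfd = 0 \<and> (\<forall>c\<in>{M..<M + 0}. sig x \<noteq> sig (snd s aRP c)) \<or>
      fst ((fst s)(rcc := 0), snd s) rfd = 1 \<and>
        (\<exists>c\<in>{M..<M + 0}. sig x = sig (snd s aRP c) \<and> snd ((fst s)(rcc := 0), snd s) aK (lb + m + x) = c))"
    using fd by (auto intro: inv_cong[OF inv])
qed auto

text \<open>Each new class number is carried by its own representative, so distinct classes have
  representatives with distinct signatures. This is what bounds the number of comparisons.\<close>

definition classified :: "nat \<Rightarrow> state \<Rightarrow> bool" where
  "classified j s \<longleftrightarrow> M \<le> fst s rM2 \<and>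
     (\<forall>x<j. snd s aK (lb + m + x) \<in> {M..<fst s rM2}) \<and>
     (\<forall>x<j. \<forall>y<j. snd s aK (lb + m + x) = snd s aK (lb + m + y) \<longleftrightarrow> sig x = sig y) \<and>
     (\<forall>c\<in>{M..<fst s rM2}. snd s aRP c < j \<and> snd s aK (lb + m + snd s aRP c) = c \<and> snd s aCB c = lb + m)"

lemma classified_rep: "classified j s \<Longrightarrow> c \<in> {M..<fst s rM2} \<Longrightarrow>
    snd s aRP c < j \<and> snd s aK (lb + m + snd s aRP c) = c \<and> snd s aCB c = lb + m"
  and classified_range: "classified j s \<Longrightarrow> x < j \<Longrightarrow> snd s aK (lb + m + x) \<in> {M..<fst s rM2}"
  and classified_eq: "classified j s \<Longrightarrow> x < j \<Longrightarrow> y < j \<Longrightarrow>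
    snd s aK (lb + m + x) = snd s aK (lb + m + y) \<longleftrightarrow> sig x = sig y"
  unfolding classified_def by simp_all

lemma classified_bound:
  assumes "classified j s" "j \<le> m"
  shows "fst s rM2 - M \<le> card (sig ` {..<m})"
proof -
  have "inj_on (\<lambda>c. sig (snd s aRP c)) {M..<fst s rM2}"
  proof (rule inj_onI)
    fix c c' assume *: "c \<in> {M..<fst s rM2}" "c' \<in> {M..<fst s rM2}" "sig (snd s aRP c) = sig (snd s aRP c')"
    have r: "snd s aRP c < j" "snd s aRP c' < j" "snd s aK (lb + m + snd s aRP c) = c" "snd s aK (lb + m + snd s aRP c') = c'"
      using classified_rep[OF assms(1)] *(1,2) by simp_all
    then show "c = c'" using classified_eq[OF assms(1) r(1,2)] *(3) by simp
  qed
  moreover have "(\<lambda>c. sig (snd s aRP c)) ` {M..<fst s rM2} \<subseteq> sig ` {..<m}"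
    using classified_rep[OF assms(1)] assms(2) by (intro image_subsetI imageI) force
  ultimately have "card {M..<fst s rM2} \<le> card (sig ` {..<m})"
    using card_inj_on_le by blast
  then show ?thesis by simp
qed

lemma classified_new:
  assumes J: "classified j s" and inv: "inv s" and j: "j < m" and none: "\<forall>c\<in>{M..<fst s rM2}. sig j \<noteq> sig (snd s aRP c)"
    and s': "fst s' rM2 = Suc (fst s rM2)" "snd s' aK = (snd s aK)(lb + m + j := fst s rM2)"
      "snd s' aRP = (snd s aRP)(fst s rM2 := j)" "snd s' aCB = (snd s aCB)(fst s rM2 := lb + m)"
  shows "classified (Suc j) s'"
proof -
  \<comment> \<open>An earlier element with the signature of \<open>j\<close> would share it with
    the representative of its class, and the search would have succeeded.\<close>
  have ne: "sig x \<noteq> sig j" if "x < j" for x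
  proof
    let ?c = "snd s aK (lb + m + x)"
    assume "sig x = sig j"
    moreover have c: "?c \<in> {M..<fst s rM2}" using classified_range[OF J that] .
    then have "snd s aRP ?c < j" "snd s aK (lb + m + snd s aRP ?c) = ?c"
      using classified_rep[OF J] by simp_all
    then have "sig (snd s aRP ?c) = sig x" using classified_eq[OF J _ that] by simp
    ultimately show False using none c by metis
  qed
  have lt: "snd s aK (lb + m + x) < fst s rM2" if "x < j" for x
    using classified_range[OF J that] by simp
  show ?thesis
    unfolding classified_def
  proof (intro conjI)
    show "M \<le> fst s' rM2" using J s' unfolding classified_def by simp
    show "\<forall>x<Suc j. snd s' aK (lb + m + x) \<in> {M..<fst s' rM2}"
      using J s' unfolding classified_def by (auto simp: less_Suc_eq)
    show "\<forall>x<Suc j. \<forall>y<Suc j. (snd s' aK (lb + m + x) = snd s' aK (lb + m + y)) = (sig x = sig y)"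
    proof (intro allI impI)
      fix x y assume "x < Suc j" "y < Suc j"
      then consider "x < j" "y < j" | "x = j" "y < j" | "x < j" "y = j" | "x = j" "y = j" by linarith
      then show "(snd s' aK (lb + m + x) = snd s' aK (lb + m + y)) = (sig x = sig y)"
        by cases (use J ne[of x] ne[of y] lt[of x] lt[of y] in \<open>auto simp: s' classified_def\<close>)
    qed
    show "\<forall>c\<in>{M..<fst s' rM2}. snd s' aRP c < Suc j \<and> snd s' aK (lb + m + snd s' aRP c) = c \<and> snd s' aCB c = lb + m"
      using J s' unfolding classified_def by (auto simp: less_Suc_eq)
  qed
qed

lemma classified_old:
  assumes J: "classified j s" and j: "j < m" and c: "c \<in> {M..<fst s rM2}" "sig j = sig (snd s aRP c)"
    and s': "fst s' rM2 = fst s rM2" "\<And>i. i \<noteq> lb + m + j \<Longrightarrow> snd s' aK i = snd s aK i" "snd s' aK (lb + m + j) = c"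
      "snd s' aRP = snd s aRP" "snd s' aCB = snd s aCB"
  shows "classified (Suc j) s'"
proof -
  have r: "snd s aRP c < j" "snd s aK (lb + m + snd s aRP c) = c" using classified_rep[OF J c(1)] by simp_all
  have eq: "snd s aK (lb + m + x) = c \<longleftrightarrow> sig x = sig j" if "x < j" for x
    using classified_eq[OF J that r(1)] r(2) c(2) by simp
  have old: "snd s' aK (lb + m + x) = snd s aK (lb + m + x)" if "x < j" for x using s'(2) that by simp
  show ?thesis
    unfolding classified_def
  proof (intro conjI)
    show "M \<le> fst s' rM2" using J s' unfolding classified_def by simp
    show "\<forall>x<Suc j. snd s' aK (lb + m + x) \<in> {M..<fst s' rM2}"
      using J s'(1,3) c old unfolding classified_def by (auto simp: less_Suc_eq)
    show "\<forall>x<Suc j. \<forall>y<Suc j. (snd s' aK (lb + m + x) = snd s' aK (lb + m + y)) = (sig x = sig y)"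
    proof (intro allI impI)
      fix x y assume "x < Suc j" "y < Suc j"
      then consider "x < j" "y < j" | "x = j" "y < j" | "x < j" "y = j" | "x = j" "y = j" by linarith
      then show "(snd s' aK (lb + m + x) = snd s' aK (lb + m + y)) = (sig x = sig y)"
      proof cases
        case 1
        show ?thesis unfolding old[OF 1(1)] old[OF 1(2)] by (rule classified_eq[OF J 1])
      next
        case 2
        show ?thesis unfolding 2(1) s'(3) old[OF 2(2)] using eq[OF 2(2)] by (simp only: eq_commute)
      next
        case 3
        show ?thesis unfolding 3(2) s'(3) old[OF 3(1)] by (rule eq[OF 3(1)])
      qed simp
    qed
    show "\<forall>c\<in>{M..<fst s' rM2}. snd s' aRP c < Suc j \<and> snd s' aK (lb + m + snd s' aRP c) = c \<and> snd s' aCB c = lb + m"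
    proof
      fix c' assume "c' \<in> {M..<fst s' rM2}"
      then have r: "snd s aRP c' < j \<and> snd s aK (lb + m + snd s aRP c') = c' \<and> snd s aCB c' = lb + m"
        unfolding s'(1) by (rule classified_rep[OF J])
      then show "snd s' aRP c' < Suc j \<and> snd s' aK (lb + m + snd s' aRP c') = c' \<and> snd s' aCB c' = lb + m"
        unfolding s'(4,5) using old[OF conjunct1[OF r]] by auto
    qed
  qed
qed

lemma classified_cong:
  "classified j s \<Longrightarrow> fst s' rM2 = fst s rM2 \<Longrightarrow> snd s' aK = snd s aK \<Longrightarrow> snd s' aRP = snd s aRP \<Longrightarrow>
    snd s' aCB = snd s aCB \<Longrightarrow> classified j s'"
  by (simp add: classified_def)

lemma wp_LEVELB:
  assumes J: "classified j s" and inv: "inv s" and j: "fst s rxx = j" "j < m"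
    and ZS: "card (sig ` {..<m}) + 1 \<le> Z"
  shows "wp LEVELB (\<lambda>t s'. t \<le> 600 * (Z * B) \<and> inv s' \<and> classified (Suc j) s') s"
proof -
  let ?s1 = "((fst s)(rlen := 1), (snd s)(aT := (snd s aT)(0 := j)))"
  let ?F = "For rcc (Minus (V rM2) (V rM)) SEARCHB"
  have ZB: "B \<le> Z * B" "1 \<le> Z * B" using Z B_bounds by auto
  have slack: "Suc (Suc (Suc (Suc (Suc t)))) \<le> 600 * (Z * B)" if "t \<le> 550 * (Z * B)" for t using that ZB by linarith
  have i1: "inv ?s1" by (rule inv_cong[OF inv]) auto
  have cl: "wp (CL aT) (\<lambda>t s'. t \<le> 180 * B \<and> holds aT s' (clo j) \<and> set (clo j) \<subseteq> {..<m}) ?s1"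
    by (rule wp_clo[OF i1]) (use j in auto)
  have "wp (CL aT ;; Assign rfd (N 0) ;; ?F ;; If (V rfd) Skip NEWCLASS)
     (\<lambda>t s'. t \<le> 550 * (Z * B) \<and> inv s' \<and> classified (Suc j) s') ?s1"
    unfolding wp_Seq[of "CL aT"]
  proof (rule wp_use[OF cl], goal_cases step)
    case (step t s2)
    note 2 = step(1,2)
    let ?s2 = "((fst s2)(rfd := 0), snd s2)"
    have i2: "inv ?s2" by (rule inv_cong[OF i1]) (use frame_reg[OF 2(2)] frame_arr[OF 2(2)] in auto)
    have J2: "classified j ?s2" by (rule classified_cong[OF J]) (use frame_reg[OF 2(2)] frame_arr[OF 2(2)] in auto)
    define M2 where "M2 = fst s rM2"
    have M2: "fst ?s2 rM2 = M2" using frame_reg[OF 2(2)] by (simp add: M2_def)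
    have M2Z: "M2 - M + 1 \<le> Z" using classified_bound[OF J] j ZS by (simp add: M2_def)
    have "wp ?F (\<lambda>t s'. t \<le> 310 * (Z * B) \<and> inv s' \<and>
     (\<forall>i. i \<noteq> lb + m + j \<longrightarrow> snd s' aK i = snd ?s2 aK i) \<and>
     (fst s' rfd = 0 \<and> (\<forall>c\<in>{M..<M2}. sig j \<noteq> sig (snd ?s2 aRP c)) \<or>
      fst s' rfd = 1 \<and> (\<exists>c\<in>{M..<M2}. sig j = sig (snd ?s2 aRP c) \<and> snd s' aK (lb + m + j) = c))) ?s2"
    proof (rule wp_search[OF i2 _ _ _ _ M2])
      show "\<forall>i<length (clo j). snd ?s2 aT i = clo j ! i" using 2(1) by (simp add: holds_def)
      show "fst ?s2 rxx = j" using frame_reg[OF 2(2)] j by simp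
      show "M \<le> M2" using J by (simp add: classified_def M2_def)
      fix c assume c: "M \<le> c" "c < M2"
      then have "snd s aRP c < j" using J by (simp add: classified_def M2_def)
      then show "snd ?s2 aRP c < m" using frame_arr[OF 2(2)] j by simp
    qed (use 2(1) j M2Z in auto)
    then show ?case
      unfolding wp_Seq wp_Assign aval.simps
    proof (rule wp_use, goal_cases step)
      case (step u s3)
      note 3 = step(1,2)
      have regs: "fst s3 rM2 = M2" "fst s3 rxx = j" "fst s3 rlb2 = lb + m"
        "snd s3 aRP = snd ?s2 aRP" "snd s3 aCB = snd ?s2 aCB"
        using frame_reg[OF 3(2)] frame_reg[OF 2(2)] frame_arr[OF 3(2)] M2 j i2 by (simp_all add: inv_def)
      have MM2: "M \<le> M2" using J by (simp add: classified_def M2_def)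
      have time: "t + (2 + (u + v)) \<le> 550 * (Z * B)" if "v \<le> 30" for v
        using 2(1) 3(1) that ZB by linarith
      show ?case
      proof (cases "fst s3 rfd = 0")
        case False
        with 3(1) obtain c where c: "c \<in> {M..<M2}" "sig j = sig (snd ?s2 aRP c)" "snd s3 aK (lb + m + j) = c" by auto
        have "classified (Suc j) s3"
          by (rule classified_old[OF J2 j(2), of c]) (use c 3(1) regs M2 in auto)
        then show ?thesis using False 3(1) time[of 3] by (simp add: wp_simps)
      next
        case True
        let ?s4 = "((fst s3)(rM2 := Suc M2), (snd s3)(aRP := (snd s3 aRP)(M2 := j),
           aCB := (snd s3 aCB)(M2 := lb + m), aK := (snd s3 aK)(lb + m + j := M2)))"
        have none: "\<forall>c\<in>{M..<M2}. sig j \<noteq> sig (snd ?s2 aRP c)" using 3(1) True by auto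
        let ?s3 = "(fst s3, (snd s3)(aK := (snd ?s2 aK)))"
        have i4: "inv ?s4" by (rule inv_cong[of s3]) (use 3(1) MM2 in auto)
        have "(snd s3 aK)(lb + m + j := M2) = (snd ?s2 aK)(lb + m + j := M2)"
          using 3(1) by (auto simp: fun_eq_iff)
        then have "classified (Suc j) ?s4"
          using none regs M2 by (intro classified_new[OF J2 i2 j(2)]) auto
        then show ?thesis using True i4 time[of 28] regs by (simp add: wp_simps NEWCLASS_def)
      qed
    qed
  qed
  then show ?thesis unfolding LEVELB_def
    using j(1) apply (simp add: wp_simps(1-3) wp_Seq[of "Assign rlen _"] wp_Seq[of "Store _ _ _"])
    apply (erule wp_mono)
    using slack by auto
qed

lemma wp_LEVEL:
  assumes G: "order_stored m le s" and s: "fst s rM = M" "fst s rd = d" "fst s rlb = lb"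
    "\<And>i. i < lb + m \<Longrightarrow> snd s aK i = K0 i" "\<And>c. c < M \<Longrightarrow> snd s aCB c = CB0 c"
    and ZS: "card (sig ` {..<m}) + 1 \<le> Z"
  shows "wp LEVEL (\<lambda>t s'. t \<le> 700 * ((m + 1) * (Z * B)) \<and> order_stored m le s' \<and> M \<le> fst s' rM \<and>
     fst s' rM - M \<le> card (sig ` {..<m}) \<and> fst s' rlb = lb + m \<and> fst s' rd = 2 * d + 1 \<and>
     (\<forall>i<lb + m. snd s' aK i = K0 i) \<and> (\<forall>c<M. snd s' aCB c = CB0 c) \<and>
     (\<forall>x<m. snd s' aK (lb + m + x) \<in> {M..<fst s' rM}) \<and>
     (\<forall>x<m. \<forall>y<m. snd s' aK (lb + m + x) = snd s' aK (lb + m + y) \<longleftrightarrow> sig x = sig y) \<and>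
     (\<forall>c\<in>{M..<fst s' rM}. snd s' aCB c = lb + m)) s"
proof -
  let ?F = "For rxx (V rm) LEVELB"
  let ?s1 = "((fst s)(rlb2 := lb + m, rM2 := M), snd s)"
  have ZB: "1 \<le> Z * B" using Z B_bounds by auto
  have i1: "inv ((fst s)(rlb2 := lb + m, rM2 := M, rxx := 0), snd s)"
    unfolding inv_def using s order_stored_cong[OF G] by simp
  have F: "wp ?F (\<lambda>t s'. t \<le> 608 * ((m + 1) * (Z * B)) \<and> inv s' \<and> classified m s') ?s1"
  proof (rule wp_For[where k = m and T = "600 * (Z * B)" and Inv = "\<lambda>j s'. inv s' \<and> classified j s'"], goal_cases fresh bound init body post)
    case (body j s')
    note j = body(1,2,3,4)
    then have "wp LEVELB (\<lambda>t s''. t \<le> 600 * (Z * B) \<and> inv s'' \<and> classified (Suc j) s'') s'"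
      by (intro wp_LEVELB ZS) auto
    then show ?case
    proof (rule wp_mono, goal_cases step)
      case (step t s'')
      note * = step(1)
      have "inv ((fst s'')(rxx := Suc j), snd s'')" by (rule inv_cong[of s'']) (use * in auto)
      moreover have "classified (Suc j) ((fst s'')(rxx := Suc j), snd s'')"
        by (rule classified_cong[of _ s'']) (use * in auto)
      ultimately show ?case using * by simp
    qed
  next
    case (bound s')
    show ?case using frame_reg[OF bound, of rm] G by (simp add: order_stored_def)
  next
    case (post t s')
    note post(1,4)
    then show ?case
      by (auto intro: loop_bound[OF _ ZB order.refl] simp del: mult_Suc)
  qed (use i1 in \<open>auto simp: classified_def\<close>)
  have "wp (?F ;; Assign rM (V rM2) ;; Assign rlb (V rlb2) ;; Assign rd (Plus (V rd) (Plus (V rd) (N 1))))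
    (\<lambda>t s'. t + 6 \<le> 700 * ((m + 1) * (Z * B)) \<and> order_stored m le s' \<and> M \<le> fst s' rM \<and>
     fst s' rM - M \<le> card (sig ` {..<m}) \<and> fst s' rlb = lb + m \<and> fst s' rd = 2 * d + 1 \<and>
     (\<forall>i<lb + m. snd s' aK i = K0 i) \<and> (\<forall>c<M. snd s' aCB c = CB0 c) \<and>
     (\<forall>x<m. snd s' aK (lb + m + x) \<in> {M..<fst s' rM}) \<and>
     (\<forall>x<m. \<forall>y<m. snd s' aK (lb + m + x) = snd s' aK (lb + m + y) \<longleftrightarrow> sig x = sig y) \<and>
     (\<forall>c\<in>{M..<fst s' rM}. snd s' aCB c = lb + m)) ?s1"
    unfolding wp_Seq[of ?F]
  proof (rule wp_mono[OF F], goal_cases step)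
    case (step t s')
    note * = step(1)
    have "1 \<le> (m + 1) * (Z * B)" by (rule order_trans[OF ZB]) simp
    then have t: "t + 16 \<le> 700 * ((m + 1) * (Z * B))" using * by linarith
    have "order_stored m le ((fst s')(rM := fst s' rM2, rlb := fst s' rlb2, rd := v), snd s')" for v
      by (rule order_stored_cong[of _ _ s']) (use * in \<open>auto simp: inv_def\<close>)
    then show ?case
      using * classified_bound[of m s'] t by (simp add: wp_simps inv_def classified_def)
  qed
  moreover have "fst s rm = m" using G by (simp add: order_stored_def)
  ultimately show ?thesis unfolding LEVEL_def
    using s apply (simp add: wp_simps(1-3) wp_Seq[of "Assign rlb2 _"] wp_Seq[of "Assign rM2 _"])
    apply (erule wp_mono)
    by simp
qed

end

section \<open>All levels and the candidate lists\<close>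

abbreviation (input) "rk \<equiv> 38::nat"

section \<open>Iterating the refinement and collecting candidates\<close>

primrec depth :: "nat \<Rightarrow> nat" where
  "depth 0 = 0"
| "depth (Suc k) = 2 * depth k + 1"

text \<open>Each closing round multiplies the length by one plus the number \<open>4 * M\<close> of
  class functions.\<close>

definition term_bound :: "nat \<Rightarrow> nat \<Rightarrow> nat" where
  "term_bound M d = Suc (4 * M) ^ d"

text \<open>The old classes plus all conceivable signatures of \<open>t\<close> terms: a vector of
  \<open>t\<close> class numbers and a \<open>t\<close> by \<open>t\<close> matrix of truth values,
  as counted in \<open>card_signatures\<close>.\<close>

primrec class_bound :: "nat \<Rightarrow> nat \<Rightarrow> nat" where
  "class_bound M 0 = M"
| "class_bound M (Suc k) = class_bound M k + class_bound M k ^ term_bound (class_bound M k) (depth k) * 2 ^ (term_bound (class_bound M k) (depth k) * term_bound (class_bound M k) (depth k))"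

lemma length_cl_class_funs: "length (cl (class_funs le m cls M) d xs) = length xs * term_bound M d"
  by (simp add: length_cl length_class_funs term_bound_def)

lemma term_bound_mono: assumes "M \<le> M'" "d \<le> d'" shows "term_bound M d \<le> term_bound M' d'"
proof -
  have "Suc (4 * M) ^ d \<le> Suc (4 * M') ^ d" using assms(1) by (intro power_mono) auto
  also have "\<dots> \<le> Suc (4 * M') ^ d'" using assms(2) by (intro power_increasing) auto
  finally show ?thesis unfolding term_bound_def .
qed

lemma term_bound_pos: "1 \<le> term_bound M d"
  by (simp add: term_bound_def)

lemma class_bound_pos: "1 \<le> M \<Longrightarrow> 1 \<le> class_bound M k"
  by (induction k) auto

lemma class_bound_mono: "k \<le> l \<Longrightarrow> class_bound M k \<le> class_bound M l"
  by (induction l rule: dec_induct) (auto intro: le_trans)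

lemma depth_mono: "k \<le> l \<Longrightarrow> depth k \<le> depth l"
  by (induction l rule: dec_induct) auto

lemma card_signatures:
  assumes "\<And>x. x \<in> X \<Longrightarrow> length (T x) = n" "\<And>x y. x \<in> X \<Longrightarrow> y \<in> set (T x) \<Longrightarrow> \<kappa> y < M"
  shows "card ((\<lambda>x. signature le \<kappa> (T x)) ` X) \<le> M ^ n * 2 ^ (n * n)"
proof -
  let ?A = "{xs. set xs \<subseteq> {..<M} \<and> length xs = n}" and ?B = "{xs. set xs \<subseteq> (UNIV :: bool set) \<and> length xs = n * n}"
  have fin: "finite ?A" "finite ?B" using finite_lists_length_eq[of "{..<M}" n] finite_lists_length_eq[of "UNIV :: bool set" "n * n"]
    by simp_all
  have "(\<lambda>x. signature le \<kappa> (T x)) ` X \<subseteq> ?A \<times> ?B"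
    using assms by (auto simp: signature_def)
  then have "card ((\<lambda>x. signature le \<kappa> (T x)) ` X) \<le> card (?A \<times> ?B)"
    by (rule card_mono[rotated]) (use fin in simp)
  also have "\<dots> = M ^ n * 2 ^ (n * n)"
    unfolding card_cartesian_product card_lists_length_eq[OF finite_lessThan] card_lists_length_eq[OF finite_UNIV] by simp
  finally show ?thesis .
qed

lemma class_funs_cong: "(\<And>c. c < M \<Longrightarrow> cls c = cls' c) \<Longrightarrow> class_funs le m cls M = class_funs le m cls' M"
  unfolding class_funs_def by (intro arg_cong[of _ _ concat] map_cong) auto

text \<open>\<open>Mf\<close>, \<open>\<kappa>\<close> and \<open>cls\<close> are ghost parameters
  that name the whole history of partitions. The machine keeps the level tables in \<open>aK\<close>
  but only the current number of classes and the current depth.\<close>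

definition levels_stored :: "nat \<Rightarrow> (nat \<Rightarrow> nat \<Rightarrow> bool) \<Rightarrow> nat \<Rightarrow> (nat \<Rightarrow> nat) \<Rightarrow> nat \<Rightarrow> state \<Rightarrow>
    (nat \<Rightarrow> nat) \<Rightarrow> (nat \<Rightarrow> nat \<Rightarrow> nat) \<Rightarrow> (nat \<Rightarrow> nat \<Rightarrow> bool) \<Rightarrow> bool" where
  "levels_stored m le M0 \<kappa>0 k s Mf \<kappa> cls \<longleftrightarrow> order_stored m le s \<and> fst s rd = depth k \<and> fst s rlb = k * m \<and>
     levels m le \<kappa> cls Mf depth k \<and> Mf k = fst s rM \<and> (\<forall>x<m. \<kappa> 0 x = \<kappa>0 x) \<and> (\<forall>l\<le>k. Mf l \<le> class_bound M0 l) \<and>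
     (\<forall>l\<le>k. \<forall>x<m. snd s aK (l * m + x) = \<kappa> l x) \<and> (\<forall>c<Mf k. snd s aCB c \<le> k * m) \<and>
     (\<forall>c<Mf k. \<forall>y<m. (snd s aK (snd s aCB c + y) = c) = cls c y)"

lemma levels_stored_cong: "levels_stored m le M0 \<kappa>0 k s Mf \<kappa> cls \<Longrightarrow> (\<And>r. r \<in> {rm, rtop, rM, rd, rlb} \<Longrightarrow> fst s' r = fst s r) \<Longrightarrow>
    (\<And>A. A \<in> {aLE, aOFF, aK, aCB} \<Longrightarrow> snd s' A = snd s A) \<Longrightarrow> levels_stored m le M0 \<kappa>0 k s' Mf \<kappa> cls"
  using order_stored_cong[of m le s s'] by (simp add: levels_stored_def)

lemma levels_stored_classes: "levels_stored m le M0 \<kappa>0 k s Mf \<kappa> cls \<Longrightarrow> classes_stored m cls (Mf k) s"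
  by (auto simp: levels_stored_def classes_stored_def)

lemma levels_stored_0:
  assumes "bposet m le" and G: "order_stored m le s" "fst s rd = 0" "fst s rlb = 0"
    and K: "\<And>x. x < m \<Longrightarrow> snd s aK x = \<kappa>0 x \<and> \<kappa>0 x < fst s rM" "\<And>c. snd s aCB c = 0" and M0: "fst s rM \<le> M0"
    and \<kappa>0: "\<And>x. x < m \<Longrightarrow> \<kappa>0 x = \<kappa>0 0 \<Longrightarrow> x = 0" "\<And>x. x < m \<Longrightarrow> \<kappa>0 x = \<kappa>0 (m - 1) \<Longrightarrow> x = m - 1"
      "\<And>x y. x < m \<Longrightarrow> y < m \<Longrightarrow> \<kappa>0 x = \<kappa>0 y \<Longrightarrow> le x y \<or> le y x"
  shows "levels_stored m le M0 \<kappa>0 0 s (\<lambda>_. fst s rM) (\<lambda>_. \<kappa>0) (\<lambda>c y. \<kappa>0 y = c)"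
proof -
  interpret bposet m le by fact
  have "levels m le (\<lambda>_. \<kappa>0) (\<lambda>c y. \<kappa>0 y = c) (\<lambda>_. fst s rM) depth 0"
    by unfold_locales (use K \<kappa>0 in \<open>auto simp: chain_on_def\<close>)
  then show ?thesis using assms unfolding levels_stored_def by auto
qed

lemma wp_LEVEL_step:
  assumes LI: "levels_stored m le M0 \<kappa>0 k s Mf \<kappa> cls" and kL: "k < L" and M0: "1 \<le> M0"
    and Z: "term_bound (class_bound M0 L) (depth L) + 1 \<le> Z" "class_bound M0 L + 1 \<le> Z" "depth L + 1 \<le> Z"
  defines "B \<equiv> Z * (Z * (Z * (m + 1)))"
  shows "wp LEVEL (\<lambda>t s'. t \<le> 700 * ((m + 1) * (Z * B)) \<and> (\<exists>Mf \<kappa> cls. levels_stored m le M0 \<kappa>0 (Suc k) s' Mf \<kappa> cls)) s"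
proof -
  from LI have lv: "levels m le \<kappa> cls Mf depth k" and G: "order_stored m le s" by (auto simp: levels_stored_def)
  from LI have L2: "fst s rd = depth k" "fst s rlb = k * m" "fst s rM = Mf k" "Mf k \<le> class_bound M0 k"
    "\<And>l x. l \<le> k \<Longrightarrow> x < m \<Longrightarrow> snd s aK (l * m + x) = \<kappa> l x" "\<And>c. c < Mf k \<Longrightarrow> snd s aCB c \<le> k * m"
    "\<And>c y. c < Mf k \<Longrightarrow> y < m \<Longrightarrow> (snd s aK (snd s aCB c + y) = c) = cls c y" by (auto simp: levels_stored_def)
  interpret levels m le \<kappa> cls Mf depth k by fact
  have MBL: "class_bound M0 k \<le> class_bound M0 L" "class_bound M0 (Suc k) \<le> class_bound M0 L" "depth k \<le> depth L"
    using kL by (auto intro!: class_bound_mono depth_mono simp del: class_bound.simps)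
  have "Mf k \<le> class_bound M0 L" using L2(4) MBL by simp
  then have szk: "term_bound (Mf k) (depth k) \<le> term_bound (class_bound M0 L) (depth L)" using MBL by (intro term_bound_mono)
  interpret S: level_step m le cls "Mf k" "depth k" "k * m" Z B "snd s aK" "snd s aCB" "\<kappa> k"
    by unfold_locales (use L2 m2 Z MBL szk in \<open>auto simp: B_def length_cl_class_funs\<close>)
  have clo_less: "y < m" if "x < m" "y \<in> set (S.clo x)" for x y
    using that terms_less[OF adjointable_fs[OF order.refl]] unfolding S.clo_def cl_singleton by auto
  have "card (S.sig ` {..<m}) \<le> Mf k ^ term_bound (Mf k) (depth k) * 2 ^ (term_bound (Mf k) (depth k) * term_bound (Mf k) (depth k))"
    unfolding S.sig_def
    by (rule card_signatures) (use clo_less \<kappa>_less in \<open>auto simp: S.clo_def length_cl_class_funs\<close>)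
  also have "\<dots> \<le> class_bound M0 k ^ term_bound (class_bound M0 k) (depth k) * 2 ^ (term_bound (class_bound M0 k) (depth k) * term_bound (class_bound M0 k) (depth k))"
  proof -
    have s: "term_bound (Mf k) (depth k) \<le> term_bound (class_bound M0 k) (depth k)" using L2(4) by (intro term_bound_mono) auto
    have "Mf k ^ term_bound (Mf k) (depth k) \<le> class_bound M0 k ^ term_bound (Mf k) (depth k)" using L2(4) by (intro power_mono) auto
    also have "\<dots> \<le> class_bound M0 k ^ term_bound (class_bound M0 k) (depth k)" using s class_bound_pos[OF M0] by (intro power_increasing) auto
    finally show ?thesis using s by (intro mult_le_mono power_increasing) auto
  qed
  finally have card: "class_bound M0 k + card (S.sig ` {..<m}) \<le> class_bound M0 (Suc k)" by simp
  have "wp LEVEL (\<lambda>t s'. t \<le> 700 * ((m + 1) * (Z * B)) \<and> order_stored m le s' \<and> Mf k \<le> fst s' rM \<and>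
     fst s' rM - Mf k \<le> card (S.sig ` {..<m}) \<and> fst s' rlb = k * m + m \<and> fst s' rd = 2 * depth k + 1 \<and>
     (\<forall>i<k * m + m. snd s' aK i = snd s aK i) \<and> (\<forall>c<Mf k. snd s' aCB c = snd s aCB c) \<and>
     (\<forall>x<m. snd s' aK (k * m + m + x) \<in> {Mf k..<fst s' rM}) \<and>
     (\<forall>x<m. \<forall>y<m. snd s' aK (k * m + m + x) = snd s' aK (k * m + m + y) \<longleftrightarrow> S.sig x = S.sig y) \<and>
     (\<forall>c\<in>{Mf k..<fst s' rM}. snd s' aCB c = k * m + m)) s"
    by (rule S.wp_LEVEL) (use G L2 card MBL Z in auto)
  then show ?thesis
  proof (rule wp_mono, goal_cases step)
    case (step t s')
    note * = step(1)
    define \<kappa>n where "\<kappa>n x = snd s' aK (k * m + m + x)" for x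
    have n: "\<And>x. x < m \<Longrightarrow> Mf k \<le> \<kappa>n x \<and> \<kappa>n x < fst s' rM"
      "\<And>x y. x < m \<Longrightarrow> y < m \<Longrightarrow> \<kappa>n x = \<kappa>n y \<longleftrightarrow> S.sig x = S.sig y" using * by (auto simp: \<kappa>n_def)
    \<comment> \<open>The identity is one of the terms, so a signature remembers the old class.
      Hence new classes refine old ones and are chains again.\<close>
    have sig\<kappa>: "\<kappa> k x = \<kappa> k y" if "S.sig x = S.sig y" for x y
    proof -
      have "map (\<kappa> k) (S.clo x) = map (\<kappa> k) (S.clo y)" using that by (simp add: S.sig_def signature_def)
      then have "\<kappa> k (id x) = \<kappa> k (id y)" using id_terms unfolding S.clo_def cl_singleton by fastforce
      then show ?thesis by simp
    qed
    define \<kappa>' where "\<kappa>' = \<kappa>(Suc k := \<kappa>n)"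
    define Mf' where "Mf' = Mf(Suc k := fst s' rM)"
    \<comment> \<open>Old numbers keep their meaning, so the class functions of all earlier levels
      stay literally the same and their refinement conditions carry over.\<close>
    define cls' where "cls' c = (if c < Mf k then cls c else (\<lambda>y. \<kappa>n y = c))" for c
    have old: "class_funs le m cls' (Mf l) = class_funs le m cls (Mf l)" if "l \<le> k" for l
      using M_mono'[OF that] by (intro class_funs_cong) (simp add: cls'_def)
    have lv': "levels m le \<kappa>' cls' Mf' depth (Suc k)"
    proof
      show "x = 0" if "x < m" "\<kappa>' 0 x = \<kappa>' 0 0" for x using \<kappa>_bot that by (simp add: \<kappa>'_def)
      show "x = m - 1" if "x < m" "\<kappa>' 0 x = \<kappa>' 0 (m - 1)" for x using \<kappa>_top that by (simp add: \<kappa>'_def)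
      show "\<kappa>' l x < Mf' l" if "l \<le> Suc k" "x < m" for l x
        using that \<kappa>_less[of l x] n(1)[of x] by (auto simp: \<kappa>'_def Mf'_def)
      show "Mf' l \<le> Mf' (Suc l)" if "l < Suc k" for l
        using that M_mono[of l] * by (auto simp: Mf'_def less_Suc_eq)
      show "cls' (\<kappa>' l x) y = (\<kappa>' l y = \<kappa>' l x)" if "l \<le> Suc k" "x < m" "y < m" for l x y
      proof (cases "l = Suc k")
        case True then show ?thesis using n(1)[of x] that by (simp add: \<kappa>'_def cls'_def)
      next
        case False
        then have "l \<le> k" using that by simp
        moreover then have "\<kappa> l x < Mf k" using \<kappa>_less[of l x] M_mono'[of l k] that by simp
        ultimately show ?thesis using False cls[of l x y] that by (simp add: \<kappa>'_def cls'_def)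
      qed
      show "chain_on (cls' c)" if "c < Mf' (Suc k)" for c
      proof (cases "c < Mf k")
        case True then show ?thesis using cls_chain by (simp add: cls'_def)
      next
        case False
        show ?thesis unfolding chain_on_def
        proof (intro allI impI)
          fix x y assume xy: "x < m" "y < m" "cls' c x" "cls' c y"
          then have "\<kappa>n x = \<kappa>n y" using False by (simp add: cls'_def)
          then have "\<kappa> k x = \<kappa> k y" using n(2) xy sig\<kappa> by blast
          then have "cls (\<kappa> k x) x" "cls (\<kappa> k x) y" using cls[of k x] xy by auto
          then show "le x y \<or> le y x" using cls_chain[OF \<kappa>_less[OF order.refl xy(1)]] xy unfolding chain_on_def by blast
        qed
      qed
      show "signature le (\<kappa>' l) (cl (class_funs le m cls' (Mf' l)) (depth l) [x]) = signature le (\<kappa>' l) (cl (class_funs le m cls' (Mf' l)) (depth l) [y])"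
        if "l < Suc k" "x < m" "y < m" "\<kappa>' (Suc l) x = \<kappa>' (Suc l) y" for l x y
      proof (cases "l = k")
        case True
        then have "S.sig x = S.sig y" using that n(2) by (simp add: \<kappa>'_def)
        then show ?thesis using True old[of k] by (simp add: \<kappa>'_def Mf'_def S.sig_def S.clo_def)
      next
        case False
        then show ?thesis using that \<kappa>_step[of l x y] old[of l] by (simp add: \<kappa>'_def Mf'_def)
      qed
      show "depth (Suc l) = 2 * depth l + 1" for l by simp
    qed
    have MBn: "fst s' rM \<le> class_bound M0 (Suc k)" using * card L2(4) by linarith
    have "levels_stored m le M0 \<kappa>0 (Suc k) s' Mf' \<kappa>' cls'"
      unfolding levels_stored_def
    proof (intro conjI allI impI)
      show "order_stored m le s'" "fst s' rd = depth (Suc k)" "fst s' rlb = Suc k * m" using * by auto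
      show "Mf' (Suc k) = fst s' rM" by (simp add: Mf'_def)
      show "\<kappa>' 0 x = \<kappa>0 x" if "x < m" for x using LI that by (simp add: \<kappa>'_def levels_stored_def)
      show "Mf' l \<le> class_bound M0 l" if "l \<le> Suc k" for l
        using LI that MBn by (cases "l = Suc k") (auto simp: Mf'_def levels_stored_def)
      show "snd s' aK (l * m + x) = \<kappa>' l x" if "l \<le> Suc k" "x < m" for l x
      proof (cases "l = Suc k")
        case True then show ?thesis by (simp add: \<kappa>'_def \<kappa>n_def algebra_simps)
      next
        case False
        then have lk: "l \<le> k" using that by simp
        then have "l * m + x < k * m + m" using that mult_le_mono1[of l k m] by linarith
        then show ?thesis using False * L2(5)[OF lk that(2)] by (simp add: \<kappa>'_def)
      qed
      show "snd s' aCB c \<le> Suc k * m" if "c < Mf' (Suc k)" for c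
      proof (cases "c < Mf k")
        case True then show ?thesis using * L2(6)[of c] by (simp add: algebra_simps trans_le_add1)
      next
        case False then show ?thesis using * that by (simp add: Mf'_def)
      qed
      show "(snd s' aK (snd s' aCB c + y) = c) = cls' c y" if "c < Mf' (Suc k)" "y < m" for c y
      proof (cases "c < Mf k")
        case True
        then have "snd s aCB c + y < k * m + m" using L2(6)[of c] that by linarith
        then show ?thesis using True * L2(7)[of c y] that by (simp add: cls'_def)
      next
        case False
        then show ?thesis using * that by (simp add: Mf'_def cls'_def \<kappa>n_def)
      qed
    qed (rule lv')
    then show ?case using * by blast
  qed
qed

text \<open>The terms only need to start from the least element 0. The extra start value 1 is an
  inner element as soon as \<open>3 \<le> m\<close> and will stand in for the ends.\<close>

primrec candidates :: "(nat \<Rightarrow> nat) list \<Rightarrow> nat \<Rightarrow> nat \<Rightarrow> nat list" where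
  "candidates fs d 0 = [0, 1]"
| "candidates fs d (Suc i) = cl fs d (candidates fs d i)"

lemma cl_prefix: "\<exists>zs. cl fs d xs = xs @ zs"
  by (induction d) (auto simp: close_def)

text \<open>Hence one array holds the ranges of all quantifier depths, and it suffices to record
  their lengths.\<close>

lemma candidates_prefix: "i \<le> j \<Longrightarrow> \<exists>zs. candidates fs d j = candidates fs d i @ zs"
proof (induction j rule: dec_induct)
  case (step j)
  then obtain zs where "candidates fs d j = candidates fs d i @ zs" by blast
  moreover obtain ys where "cl fs d (candidates fs d j) = candidates fs d j @ ys" using cl_prefix by blast
  ultimately show ?case by simp
qed simp

lemma length_candidates: "length (candidates (class_funs le m cls M) d i) = 2 * term_bound M d ^ i"
  by (induction i) (simp_all add: length_cl_class_funs algebra_simps)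

definition LEVELS :: com where
  "LEVELS = For rk (V rL) LEVEL"

definition CLEAN :: com where
  "CLEAN = If (Rd aW (V rk)) (If (Minus (V rtop) (Rd aW (V rk))) Skip (Store aW (V rk) (N 1))) (Store aW (V rk) (N 1))"

definition CANDB :: com where
  "CANDB = CL aW ;; Store aML (V rk) (V rlen)"

definition CAND :: com where
  "CAND = Store aW (N 0) (N 0) ;; Store aW (N 1) (N 1) ;; Assign rlen (N 2) ;;
     For rk (V rL) CANDB ;; For rk (V rlen) CLEAN"

lemma wregs_LEVEL [simp]: "wregs LEVEL = {rlb2, rM2, rxx, rM, rlb, rd, rcur, rf, rj, rfd, rcc} \<union> clregs"
  and warrs_LEVEL [simp]: "warrs LEVEL = {aT, aU, aK, aRP, aCB}"
  by (auto simp: LEVEL_def)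

lemma wregs_CAND [simp]: "wregs CAND = insert rk clregs" and warrs_CAND [simp]: "warrs CAND = {aW, aML}"
  by (auto simp: CAND_def CANDB_def CLEAN_def)

lemma wp_LEVELS:
  assumes LI: "levels_stored m le M0 \<kappa>0 0 s Mf \<kappa> cls" and L: "fst s rL = L" "L + 1 \<le> Z" and M0: "1 \<le> M0"
    and Z: "term_bound (class_bound M0 L) (depth L) + 1 \<le> Z" "class_bound M0 L + 1 \<le> Z" "depth L + 1 \<le> Z"
  defines "B \<equiv> Z * (Z * (Z * (m + 1)))"
  shows "wp LEVELS (\<lambda>t s'. t \<le> 708 * (Z * ((m + 1) * (Z * B))) \<and> (\<exists>Mf \<kappa> cls. levels_stored m le M0 \<kappa>0 L s' Mf \<kappa> cls)) s"
  unfolding LEVELS_def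
proof (rule wp_For[where k = L and T = "700 * ((m + 1) * (Z * B))" and
      Inv = "\<lambda>k s'. \<exists>Mf \<kappa> cls. levels_stored m le M0 \<kappa>0 k s' Mf \<kappa> cls"], goal_cases fresh bound init body post)
  case (body j s')
  note j = body(1,4)
  then obtain Mf \<kappa> cls where "levels_stored m le M0 \<kappa>0 j s' Mf \<kappa> cls" by blast
  from wp_LEVEL_step[OF this j(1) M0 Z]
  show ?case
    unfolding B_def
  proof (rule wp_mono, goal_cases step)
    case (step t s'')
    note * = step(1)
    then obtain Mf \<kappa> cls where "levels_stored m le M0 \<kappa>0 (Suc j) s'' Mf \<kappa> cls" by blast
    then have "levels_stored m le M0 \<kappa>0 (Suc j) ((fst s'')(rk := Suc j), snd s'') Mf \<kappa> cls"
      by (rule levels_stored_cong) auto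
    with * show ?case by blast
  qed
next
  case (bound s')
  show ?case using frame_reg[OF bound, of rL] L by simp
next
  have "1 \<le> B" unfolding B_def using Z by simp
  then have "1 \<le> Z * B" using Z by simp
  then have X: "1 \<le> (m + 1) * (Z * B)" by (rule order_trans) simp
  fix t s' assume "t \<le> (L + 1) * (acost (V rL) + 7 + 700 * ((m + 1) * (Z * B)))"
    and I: "\<exists>Mf \<kappa> cls. levels_stored m le M0 \<kappa>0 L s' Mf \<kappa> cls"
  from loop_bound[OF this(1) X L(2), of 708] I
  show "t \<le> 708 * (Z * ((m + 1) * (Z * B))) \<and> (\<exists>Mf \<kappa> cls. levels_stored m le M0 \<kappa>0 L s' Mf \<kappa> cls)" by simp
next
  have "levels_stored m le M0 \<kappa>0 0 ((fst s)(rk := 0), snd s) Mf \<kappa> cls" using LI by (rule levels_stored_cong) auto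
  then show "\<exists>Mf \<kappa> cls. levels_stored m le M0 \<kappa>0 0 ((fst s)(rk := 0), snd s) Mf \<kappa> cls" by blast
qed simp

text \<open>Overwriting the ends instead of deleting them preserves positions and hence the prefix
  structure. The inner part of a range is unchanged because 1 belongs to every list, and no range
  becomes empty.\<close>

definition clean :: "nat \<Rightarrow> nat \<Rightarrow> nat" where
  "clean m x = (if x = 0 \<or> x = m - 1 then 1 else x)"

lemma wp_CAND:
  assumes LI: "levels_stored m le M0 \<kappa>0 L s Mf \<kappa> cls" and L: "fst s rL = L" "L + 1 \<le> Z" and m: "3 \<le> m"
    and Z: "2 * term_bound (Mf L) (depth L) ^ L + 1 \<le> Z" "Mf L + 1 \<le> Z" "depth L + 1 \<le> Z"
  defines "B \<equiv> Z * (Z * (Z * (m + 1)))" and "ws \<equiv> candidates (class_funs le m cls (Mf L)) (depth L)"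
  shows "wp CAND (\<lambda>t s'. t \<le> 300 * (Z * B) \<and> (\<forall>i<L. snd s' aML i = length (ws (Suc i))) \<and>
     (\<forall>j<length (ws L). snd s' aW j = clean m (ws L ! j))) s"
proof -
  let ?fs = "class_funs le m cls (Mf L)"
  let ?s1 = "((fst s)(rlen := 2), (snd s)(aW := (snd s aW)(0 := 0, 1 := 1)))"
  have C: "classes_stored m cls (Mf L) s" "order_stored m le s" "fst s rd = depth L" using LI levels_stored_classes[OF LI] by (auto simp: levels_stored_def)
  have len: "length (ws i) + 1 \<le> Z" if "i \<le> L" for i
  proof -
    have "term_bound (Mf L) (depth L) ^ i \<le> term_bound (Mf L) (depth L) ^ L" using that term_bound_pos by (intro power_increasing) auto
    then show ?thesis using Z(1) unfolding ws_def length_candidates by linarith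
  qed
  have ZB: "B \<le> Z * B" "1 \<le> B" "1 \<le> Z * B" "Z \<le> Z * B" unfolding B_def using Z by simp_all
  have F1: "wp (For rk (V rL) CANDB) (\<lambda>t s'. t \<le> 192 * (Z * B) \<and> holds aW s' (ws L) \<and>
      (\<forall>i<L. snd s' aML i = length (ws (Suc i)))) ?s1"
  proof (rule wp_For[where k = L and T = "184 * B" and Inv = "\<lambda>j s'. holds aW s' (ws j) \<and> set (ws j) \<subseteq> {..<m} \<and>
      (\<forall>i<j. snd s' aML i = length (ws (Suc i)))"], goal_cases fresh bound init body post)
    case (body j s')
    note j = body(1,2,3) and I = body(4)
    have "wp (CL aW) (\<lambda>t s''. t \<le> 180 * B \<and> holds aW s'' (ws (Suc j)) \<and> set (ws (Suc j)) \<subseteq> {..<m}) s'"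
      unfolding B_def ws_def candidates.simps
    proof (rule wp_CL)
      show "order_stored m le s'" using C(2) by (rule order_stored_cong) (use frame_reg[OF j(2)] frame_arr[OF j(2)] in \<open>auto simp: CANDB_def\<close>)
      show "classes_stored m cls (Mf L) s'" using C(1) by (rule classes_stored_cong) (use frame_reg[OF j(2)] frame_arr[OF j(2)] in \<open>auto simp: CANDB_def\<close>)
      show "fst s' rd = depth L" using frame_reg[OF j(2), of rd] C(3) by (simp add: CANDB_def)
      show "length (cl ?fs (depth L) (candidates ?fs (depth L) j)) + 1 \<le> Z" using len[of "Suc j"] j(1) by (simp add: ws_def)
    qed (use I m Z in \<open>auto simp: ws_def\<close>)
    then show ?case
      unfolding CANDB_def wp_Seq
    proof (rule wp_use, goal_cases step)
      case (step t s2)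
      note 2 = step(1,2)
      have "fst s2 rk = j" "snd s2 aML = snd s' aML" using frame_reg[OF 2(2)] frame_arr[OF 2(2)] j(3) by auto
      then show ?case
        using 2(1) I ZB(2) by (auto simp: wp_simps holds_def less_Suc_eq simp del: candidates.simps)
    qed
  next
    case (bound s')
    show ?case using frame_reg[OF bound, of rL] L by (simp add: CANDB_def)
  next
    case (post t s')
    note post(1) and I = post(4)
    from loop_bound[OF this(1) ZB(2) L(2), of 192] I
    show ?case by simp
  next
    show "holds aW ((fst ?s1)(rk := 0), snd ?s1) (ws 0) \<and> set (ws 0) \<subseteq> {..<m} \<and>
      (\<forall>i<0. snd ((fst ?s1)(rk := 0), snd ?s1) aML i = length (ws (Suc i)))"
      using m by (auto simp: holds_def ws_def less_Suc_eq)
  qed (auto simp: CANDB_def)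
  have F2: "wp (For rk (V rlen) CLEAN) (\<lambda>t s'. t \<le> 30 * Z \<and> snd s' aML = snd s1 aML \<and>
      (\<forall>j<length (ws L). snd s' aW j = clean m (ws L ! j))) s1"
    if s1: "holds aW s1 (ws L)" "fst s1 rtop = m - 1" "set (ws L) \<subseteq> {..<m}" for s1
  proof (rule wp_For[where k = "length (ws L)" and T = 12 and Inv = "\<lambda>j s'.
       (\<forall>i<length (ws L). snd s' aW i = (if i < j then clean m (ws L ! i) else ws L ! i))"], goal_cases fresh bound init body post)
    case (body j s')
    note j = body(1,2,3) and I = body(4)
    have "fst s' rtop = m - 1" using frame_reg[OF j(2), of rtop] s1 by (simp add: CLEAN_def)
    moreover have "snd s' aW j = ws L ! j" using I j(1) by simp
    moreover have "ws L ! j < m" using subsetD[OF s1(3) nth_mem[OF j(1)]] by simp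
    ultimately show ?case
      using I j by (auto simp: CLEAN_def wp_simps clean_def less_Suc_eq)
  next
    case (bound s')
    show ?case using frame_reg[OF bound, of rlen] s1(1) by (simp add: CLEAN_def holds_def)
  next
    case (post t s')
    note t = post(1) and post(2) and I = post(4)
    then have "snd s' aML = snd s1 aML" by (simp add: frame_arr CLEAN_def)
    then show ?case
      using t I len[OF order.refl] by simp
  qed (use s1 in \<open>auto simp: holds_def CLEAN_def\<close>)
  have adj: "set (ws i) \<subseteq> {..<m}" for i
  proof (induction i)
    case 0 then show ?case using m by (simp add: ws_def)
  next
    case (Suc i)
    have "levels m le \<kappa> cls Mf depth L" using LI by (simp add: levels_stored_def)
    then interpret levels m le \<kappa> cls Mf depth L .
    show ?case using Suc terms_less[OF adjointable_fs[OF order.refl]] unfolding ws_def candidates.simps set_cl by auto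
  qed
  have "wp (For rk (V rL) CANDB ;; For rk (V rlen) CLEAN) (\<lambda>t s'. t + 8 \<le> 300 * (Z * B) \<and>
    (\<forall>i<L. snd s' aML i = length (ws (Suc i))) \<and> (\<forall>j<length (ws L). snd s' aW j = clean m (ws L ! j))) ?s1"
    unfolding wp_Seq
  proof (rule wp_use[OF F1], goal_cases step)
    case (step t s2)
    note 2 = step(1,2)
    have "fst s2 rtop = m - 1" using frame_reg[OF 2(2), of rtop] C(2) by (simp add: CANDB_def order_stored_def)
    then have "wp (For rk (V rlen) CLEAN) (\<lambda>t s'. t \<le> 30 * Z \<and> snd s' aML = snd s2 aML \<and>
      (\<forall>j<length (ws L). snd s' aW j = clean m (ws L ! j))) s2" using 2(1) adj by (intro F2) auto
    then show ?case
    proof (rule wp_mono, goal_cases step)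
      case (step u s')
      note * = step(1)
      have "t + u + 8 \<le> 300 * (Z * B)" using * 2(1) ZB by linarith
      then show ?case
        using * 2(1) by simp
    qed
  qed
  then show ?thesis unfolding CAND_def
    by (simp add: wp_simps(2,3) wp_Seq[of "Store _ _ _"] wp_Seq[of "Assign rlen _"]) (erule wp_mono, simp)
qed

section \<open>Chain partitions\<close>

abbreviation (input) "rnch \<equiv> 39::nat"
abbreviation (input) "aORD \<equiv> 22::nat"

context bposet
begin

definition width_le :: "nat \<Rightarrow> bool" where
  "width_le w \<longleftrightarrow> (\<forall>A \<subseteq> {..<m}. (\<forall>x\<in>A. \<forall>y\<in>A. x \<noteq> y \<longrightarrow> \<not> le x y) \<longrightarrow> card A \<le> w)"

definition group :: "nat \<Rightarrow> (nat \<Rightarrow> nat) \<Rightarrow> nat \<Rightarrow> nat set" where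
  "group k G g = {p. p < k \<and> G p = g}"

lemma finite_group [simp]: "finite (group k G g)"
  by (simp add: group_def)

text \<open>The chains, with heads \<open>H\<close>, are distributed over groups: the heads of the at most \<open>g\<close> chains
  in group \<open>g\<close> form an antichain.\<close>

definition chains :: "nat \<Rightarrow> nat set \<Rightarrow> nat \<Rightarrow> (nat \<Rightarrow> nat) \<Rightarrow> (nat \<Rightarrow> nat) \<Rightarrow> (nat \<Rightarrow> nat) \<Rightarrow> bool" where
  "chains w P k G H C \<longleftrightarrow> P \<subseteq> {..<m} \<and> (\<forall>p<k. H p \<in> P \<and> C (H p) = p) \<and>
     (\<forall>x\<in>P. C x < k \<and> le x (H (C x))) \<and> (\<forall>x\<in>P. \<forall>y\<in>P. C x = C y \<longrightarrow> le x y \<or> le y x) \<and>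
     (\<forall>g. card (group k G g) \<le> g) \<and> (\<forall>p<k. G p \<le> w) \<and>
     (\<forall>p<k. \<forall>q<k. p \<noteq> q \<longrightarrow> G p = G q \<longrightarrow> \<not> le (H p) (H q))"

lemma chains_empty: "chains w {} 0 G H C"
  by (simp add: chains_def group_def)

lemma chains_pos: "chains w P k G H C \<Longrightarrow> p < k \<Longrightarrow> 1 \<le> G p"
proof (rule ccontr)
  assume *: "chains w P k G H C" "p < k" "\<not> 1 \<le> G p"
  then have "p \<in> group k G 0" by (simp add: group_def)
  moreover have "card (group k G 0) = 0" using * unfolding chains_def by blast
  ultimately show False by simp
qed

text \<open>Group 0 is empty since its size is at most 0; the groups 1 to \<open>w\<close> have at
  most \<open>w\<close> chains each.\<close>

lemma chains_count:
  assumes "chains w P k G H C"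
  shows "k \<le> w * w"
proof -
  have "{..<k} \<subseteq> (\<Union>g\<in>{1..w}. group k G g)"
    using assms chains_pos[OF assms] unfolding chains_def group_def by auto
  then have "k \<le> card (\<Union>g\<in>{1..w}. group k G g)"
    using card_mono[of "\<Union>g\<in>{1..w}. group k G g" "{..<k}"] by simp
  also have "\<dots> \<le> (\<Sum>g\<in>{1..w}. card (group k G g))" by (rule card_UN_le) simp
  also have "\<dots> \<le> (\<Sum>g\<in>{1..w}. w)"
    using assms by (intro sum_mono) (auto simp: chains_def intro: le_trans)
  finally show ?thesis by simp
qed

lemma chains_inj: "chains w P k G H C \<Longrightarrow> p < k \<Longrightarrow> q < k \<Longrightarrow> H p = H q \<Longrightarrow> p = q"
  unfolding chains_def by metis

text \<open>No element placed before lies above \<open>x\<close>, as elements come in the order of a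
  linear extension. So only heads below \<open>x\<close> could be comparable with it.\<close>

lemma group_antichain:
  assumes c: "chains w P k G H C" and x: "x < m" "x \<notin> P" "\<And>y. y \<in> P \<Longrightarrow> \<not> le x y"
    and none: "\<And>p. p \<in> group k G g \<Longrightarrow> \<not> le (H p) x"
  shows "insert x (H ` group k G g) \<subseteq> {..<m}" "card (insert x (H ` group k G g)) = Suc (card (group k G g))"
    "\<forall>y\<in>insert x (H ` group k G g). \<forall>z\<in>insert x (H ` group k G g). y \<noteq> z \<longrightarrow> \<not> le y z"
proof -
  have H: "\<And>p. p < k \<Longrightarrow> H p \<in> P" and P: "P \<subseteq> {..<m}"
    using c unfolding chains_def by auto
  show "insert x (H ` group k G g) \<subseteq> {..<m}" using H P x(1) by (auto simp: group_def)
  have "inj_on H (group k G g)" using chains_inj[OF c] by (auto simp: inj_on_def group_def)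
  then have "card (H ` group k G g) = card (group k G g)" by (rule card_image)
  moreover have "x \<notin> H ` group k G g" using H x(2) by (auto simp: group_def)
  ultimately show "card (insert x (H ` group k G g)) = Suc (card (group k G g))" by simp
  show "\<forall>y\<in>insert x (H ` group k G g). \<forall>z\<in>insert x (H ` group k G g). y \<noteq> z \<longrightarrow> \<not> le y z"
  proof -
    have "\<not> le (H p) (H q)" if "p \<in> group k G g" "q \<in> group k G g" "H p \<noteq> H q" for p q
    proof -
      from that have "p < k" "q < k" "p \<noteq> q" "G p = G q" by (auto simp: group_def)
      then show ?thesis using c unfolding chains_def by blast
    qed
    moreover have "\<not> le x (H p)" "\<not> le (H p) x" if "p \<in> group k G g" for p
      using H x(3) none that by (auto simp: group_def)
    ultimately show ?thesis by auto
  qed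
qed

text \<open>Otherwise \<open>x\<close> and the heads of group \<open>m\<close> would be
  \<open>m + 1\<close> different elements. So \<open>m\<close> rounds always find a place, and the
  program can work without knowing the width.\<close>

lemma exists_group:
  assumes c: "chains w P k G H C" and x: "x < m" "x \<notin> P" "\<And>y. y \<in> P \<Longrightarrow> \<not> le x y"
  shows "(\<exists>p\<in>group k G m. le (H p) x) \<or> card (group k G m) < m"
proof (rule ccontr)
  assume "\<not> ?thesis"
  then have none: "\<And>p. p \<in> group k G m \<Longrightarrow> \<not> le (H p) x" and card: "m \<le> card (group k G m)"
    by auto
  from group_antichain(1,2)[OF c x none] card have "Suc m \<le> card {..<m}"
    using card_mono[of "{..<m}" "insert x (H ` group k G m)"] by simp
  then show False by simp
qed

definition regroup :: "(nat \<Rightarrow> nat) \<Rightarrow> nat \<Rightarrow> nat \<Rightarrow> nat" where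
  "regroup G i p = (if G p = i then Suc i else if G p = Suc i then i else G p)"

text \<open>The first suitable group is \<open>Suc i\<close>, so group \<open>i\<close> is full and
  none of its heads is below \<open>x\<close>: these heads and \<open>x\<close> form an antichain of
  size \<open>Suc i\<close>. It shows \<open>Suc i \<le> w\<close>, and the chains behind it, with
  \<open>x\<close> as the head of \<open>q\<close>, become the new group \<open>Suc i\<close>. What
  remains of the old group \<open>Suc i\<close> without \<open>q\<close> has at most
  \<open>i\<close> chains and takes the place of group \<open>i\<close>. For \<open>i = 0\<close>
  the empty group 0 plays the part of the full one.\<close>

lemma chains_insert:
  assumes w: "width_le w" and c: "chains w P k G H C" and x: "x < m" "x \<notin> P" "\<And>y. y \<in> P \<Longrightarrow> \<not> le x y"
    and below: "\<And>g. 1 \<le> g \<Longrightarrow> g \<le> i \<Longrightarrow> card (group k G g) = g \<and> (\<forall>p\<in>group k G g. \<not> le (H p) x)"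
    and q: "q \<in> group k G (Suc i) \<and> le (H q) x \<and> k' = k \<or> q = k \<and> card (group k G (Suc i)) \<le> i \<and> k' = Suc k"
    and G': "\<And>p. p < k \<Longrightarrow> p \<noteq> q \<Longrightarrow> G' p = regroup G i p" "G' q = Suc i"
  shows "chains w (insert x P) k' G' (H(q := x)) (C(x := q))"
proof -
  have c': "P \<subseteq> {..<m}" "\<And>p. p < k \<Longrightarrow> H p \<in> P \<and> C (H p) = p" "\<And>x. x \<in> P \<Longrightarrow> C x < k \<and> le x (H (C x))"
    "\<And>x y. x \<in> P \<Longrightarrow> y \<in> P \<Longrightarrow> C x = C y \<Longrightarrow> le x y \<or> le y x"
    "\<And>g. card (group k G g) \<le> g" "\<And>p. p < k \<Longrightarrow> G p \<le> w"
    "\<And>p q. p < k \<Longrightarrow> q < k \<Longrightarrow> p \<noteq> q \<Longrightarrow> G p = G q \<Longrightarrow> \<not> le (H p) (H q)"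
    using c unfolding chains_def by auto
  have qk: "q < k'" "k \<le> k'" "\<And>p. p < k' \<Longrightarrow> p \<noteq> q \<Longrightarrow> p < k" using q by (auto simp: group_def)
  have card_i: "card (group k G i) = i"
    using below[of i] c'(5)[of 0] by (cases i) auto
  have none: "\<not> le (H p) x" if "p \<in> group k G i" for p
    using below[of i] c'(5)[of 0] that by (cases i) auto
  have qi: "q \<notin> group k G i" using q by (auto simp: group_def)
  have "card (insert x (H ` group k G i)) = Suc i"
    using group_antichain(2)[OF c x none] card_i by simp
  then have iw: "Suc i \<le> w"
    using w group_antichain(1,3)[OF c x none] unfolding width_le_def by metis
  have Gq: "q < k \<Longrightarrow> G q = Suc i" using q by (auto simp: group_def)
  then have qi': "p < k \<Longrightarrow> G p = i \<Longrightarrow> p \<noteq> q" for p by auto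
  have k': "p < k' \<longleftrightarrow> p < k \<or> p = q" for p using qk by (auto intro: less_le_trans)
  have group_i: "group k' G' (Suc i) = insert q (group k G i)"
    unfolding group_def k' using G' qi' by (auto simp: regroup_def split: if_splits)
  have group_j: "group k' G' i = group k G (Suc i) - {q}"
  proof (rule set_eqI)
    fix p
    have "p < k \<Longrightarrow> p \<noteq> q \<Longrightarrow> G' p = i \<longleftrightarrow> G p = Suc i" using G'(1)[of p] by (simp add: regroup_def)
    moreover have "G' q \<noteq> i" using G'(2) by simp
    ultimately show "p \<in> group k' G' i \<longleftrightarrow> p \<in> group k G (Suc i) - {q}" using k'[of p] by (auto simp: group_def)
  qed
  have group_o: "group k' G' g = group k G g" if "g \<noteq> i" "g \<noteq> Suc i" for g
  proof (rule set_eqI)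
    fix p
    have "p < k \<Longrightarrow> p \<noteq> q \<Longrightarrow> G' p = g \<longleftrightarrow> G p = g" using G'(1)[of p] that by (auto simp: regroup_def)
    moreover have "G' q \<noteq> g" "q < k \<Longrightarrow> G q \<noteq> g" using G'(2) Gq that by auto
    ultimately show "p \<in> group k' G' g \<longleftrightarrow> p \<in> group k G g" using k'[of p] by (auto simp: group_def)
  qed
  have le_x: "le y x" if "y \<in> P" "C y = q" for y
  proof -
    have "q < k" using c'(3)[OF that(1)] that(2) by simp
    then have "le (H q) x" using q by auto
    then show ?thesis using trans[of y "H q" x] c'(1,2,3) that x(1) \<open>q < k\<close> by blast
  qed
  show ?thesis
    unfolding chains_def
  proof (intro conjI allI impI ballI)
    show "insert x P \<subseteq> {..<m}" using c'(1) x(1) by simp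
    fix p assume p: "p < k'"
    show "(H(q := x)) p \<in> insert x P" using c'(2) qk(3)[OF p] by auto
    show "(C(x := q)) ((H(q := x)) p) = p" using c'(2) qk(3)[OF p] x(2) by auto
    show "G' p \<le> w"
    proof (cases "p = q")
      case True then show ?thesis using G'(2) iw by simp
    next
      case False
      then show ?thesis using G'(1) qk(3)[OF p] c'(6) iw by (auto simp: regroup_def)
    qed
  next
    fix y assume y: "y \<in> insert x P"
    show "(C(x := q)) y < k'" using y c'(3) qk by (auto intro: less_le_trans)
    show "le y ((H(q := x)) ((C(x := q)) y))" using y c'(3) le_x refl[OF x(1)] by auto
    fix z assume z: "z \<in> insert x P" "(C(x := q)) y = (C(x := q)) z"
    then show "le y z \<or> le z y" using y c'(4) le_x refl[OF x(1)] by (auto split: if_splits)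
  next
    fix g
    show "card (group k' G' g) \<le> g"
    proof (cases "g = Suc i \<or> g = i")
      case True
      moreover have "card (group k' G' (Suc i)) \<le> Suc i" using group_i card_i qi by simp
      moreover have "card (group k' G' i) \<le> i"
        using q c'(5)[of "Suc i"] unfolding group_j by (auto simp: card_Diff_singleton_if)
      ultimately show ?thesis by blast
    next
      case False
      then show ?thesis using group_o c'(5) by simp
    qed
  next
    fix p r assume pr: "p < k'" "r < k'" "p \<noteq> r" "G' p = G' r"
    show "\<not> le ((H(q := x)) p) ((H(q := x)) r)"
    proof (cases "p = q \<or> r = q")
      case True
      then have "p \<in> group k' G' (Suc i)" "r \<in> group k' G' (Suc i)" using pr G'(2) by (auto simp: group_def)
      then have "p = q \<and> r \<in> group k G i \<or> r = q \<and> p \<in> group k G i"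
        using True pr(3) unfolding group_i by auto
      then show ?thesis using none c'(2) x(3) pr(3) by (auto simp: group_def)
    next
      case False
      then have l: "p < k" "r < k" using pr qk(3) by auto
      then have "G p = G r" using pr(4) G'(1)[of p] G'(1)[of r] False by (auto simp: regroup_def split: if_splits)
      then show ?thesis using c'(7)[OF l pr(3)] False by simp
    qed
  qed
qed

end

text \<open>Group \<open>i + 1\<close> is examined in round \<open>i\<close>.\<close>

abbreviation "gr \<equiv> Plus (V ri) (N 1)"

definition LOOKB :: com where
  "LOOKB = If (Neq (Rd aG (V rj)) gr) Skip (Assign rl (Plus (V rl) (N 1)) ;;
     If (LEq (Rd aHD (V rj)) (V rx)) (Assign rf (N 1) ;; Assign rcur (V rj)) Skip)"

definition SWAPB :: com where
  "SWAPB = If (Neq (Rd aG (V rj)) (V ri)) (If (Neq (Rd aG (V rj)) gr) Skip (Store aG (V rj) (V ri))) (Store aG (V rj) gr)"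

definition PLACE :: com where
  "PLACE = For rj (V rnch) SWAPB ;; Store aG (V rcur) gr ;; Store aHD (V rcur) (V rx) ;; Store aCH (V rx) (V rcur)"

definition TRY :: com where
  "TRY = Assign rl (N 0) ;; Assign rf (N 0) ;; For rj (V rnch) LOOKB ;;
     If (V rf) (Assign rfd (N 1))
       (If (Minus gr (V rl)) (Assign rfd (N 1) ;; Assign rcur (V rnch) ;; Assign rnch (Plus (V rnch) (N 1))) Skip) ;;
     If (V rfd) PLACE Skip"

definition INSERT :: com where
  "INSERT = Assign rfd (N 0) ;; For ri (V rm) (If (V rfd) Skip TRY)"

lemma wregs_LOOKB [simp]: "wregs LOOKB = {rl, rf, rcur}" and warrs_LOOKB [simp]: "warrs LOOKB = {}"
  by (auto simp: LOOKB_def)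

lemma wregs_SWAPB [simp]: "wregs SWAPB = {}" and warrs_SWAPB [simp]: "warrs SWAPB = {aG}"
  by (auto simp: SWAPB_def)

lemma wregs_PLACE [simp]: "wregs PLACE = {rj}" and warrs_PLACE [simp]: "warrs PLACE = {aG, aHD, aCH}"
  by (auto simp: PLACE_def)

lemma wregs_TRY [simp]: "wregs TRY = {rl, rf, rcur, rj, rfd, rnch}" and warrs_TRY [simp]: "warrs TRY = {aG, aHD, aCH}"
  by (auto simp: TRY_def)

lemma wregs_INSERT [simp]: "wregs INSERT = {rl, rf, rcur, rj, rfd, rnch, ri}" and warrs_INSERT [simp]: "warrs INSERT = {aG, aHD, aCH}"
  by (auto simp: INSERT_def)

context bposet
begin

lemma group_Suc: "group (Suc j) G g = (if G j = g then insert j (group j G g) else group j G g)"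
  by (auto simp: group_def less_Suc_eq)

lemma wp_LOOK:
  assumes G: "order_stored m le s" and k: "fst s rnch = k" and H: "\<And>p. p < k \<Longrightarrow> snd s aHD p < m" and x: "fst s rx < m"
    and i: "fst s ri = i" "fst s rl = 0" "fst s rf = 0"
  shows "wp (For rj (V rnch) LOOKB) (\<lambda>t s'. t \<le> 48 * (k + 1) \<and> snd s' = snd s \<and>
     fst s' rl = card (group k (snd s aG) (Suc i)) \<and>
     (fst s' rf = 0 \<and> (\<forall>p\<in>group k (snd s aG) (Suc i). \<not> le (snd s aHD p) (fst s rx)) \<or>
      fst s' rf = 1 \<and> fst s' rcur \<in> group k (snd s aG) (Suc i) \<and> le (snd s aHD (fst s' rcur)) (fst s rx))) s"
proof (rule wp_For[where k = k and T = 40 and Inv = "\<lambda>j s'. fst s' rl = card (group j (snd s aG) (Suc i)) \<and>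
     (fst s' rf = 0 \<and> (\<forall>p\<in>group j (snd s aG) (Suc i). \<not> le (snd s aHD p) (fst s rx)) \<or>
      fst s' rf = 1 \<and> fst s' rcur \<in> group j (snd s aG) (Suc i) \<and> le (snd s aHD (fst s' rcur)) (fst s rx))"], goal_cases fresh bound init body post)
  case (body j s')
  note j = body(1,2,3) and I = body(4)
  have arr: "snd s' = snd s" using frame_arr[OF j(2)] by auto
  have regs: "fst s' rx = fst s rx" "fst s' ri = i" using frame_reg[OF j(2)] i by auto
  have G': "order_stored m le ((fst s')(rl := v), snd s)" for v
    by (rule order_stored_cong[OF G]) (use frame_reg[OF j(2)] in auto)
  have new: "j \<notin> group j (snd s aG) (Suc i)" by (simp add: group_def)
  have lq: "aval (LEq (Rd aHD (V rj)) (V rx)) ((fst s')(rl := v), snd s) = of_bool (le (snd s aHD j) (fst s rx))" for v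
    using aval_LEq[OF G', of "Rd aHD (V rj)" v "V rx"] regs j(1,3) H x by simp
  show ?case
    using I new j(3) regs arr unfolding LOOKB_def group_Suc
    by (auto simp: wp_simps lq)
next
  case (bound s')
  show ?case using frame_reg[OF bound, of rnch] k by simp
next
  case (post t s')
  note post(1) and f = post(2) and I = post(4)
  moreover have "snd s' = snd s" using frame_arr[OF f] by auto
  ultimately show ?case by simp
qed (use i in \<open>auto simp: group_def\<close>)

lemma wp_PLACE:
  assumes k: "fst s rnch = k" and i: "fst s ri = i" and q: "fst s rcur = q" and x: "fst s rx = x"
  shows "wp PLACE (\<lambda>t s'. t \<le> 50 * (k + 1) \<and> (\<forall>p<k. p \<noteq> q \<longrightarrow> snd s' aG p = regroup (snd s aG) i p) \<and>
     snd s' aG q = Suc i \<and> snd s' aHD = (snd s aHD)(q := x) \<and> snd s' aCH = (snd s aCH)(x := q)) s"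
proof -
  have "wp (For rj (V rnch) SWAPB) (\<lambda>t s'. t \<le> 38 * (k + 1) \<and> (\<forall>p<k. snd s' aG p = regroup (snd s aG) i p)) s"
  proof (rule wp_For[where k = k and T = 30 and Inv = "\<lambda>j s'.
        \<forall>p. snd s' aG p = (if p < j then regroup (snd s aG) i p else snd s aG p)"], goal_cases fresh bound init body post)
    case (body j s')
    note j = body(1,2,3,4)
    have "fst s' ri = i" using frame_reg[OF j(2), of ri] i by simp
    then show ?case
      using j(3,4) by (auto simp: SWAPB_def wp_simps regroup_def less_Suc_eq)
  next
    case (bound s')
    show ?case using frame_reg[OF bound, of rnch] k by simp
  qed auto
  then show ?thesis unfolding PLACE_def wp_Seq[of "For _ _ _"]
  proof (rule wp_use, goal_cases step)
    case (step t s1)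
    note 1 = step(1,2)
    have "fst s1 ri = i" "fst s1 rcur = q" "fst s1 rx = x" "snd s1 aHD = snd s aHD" "snd s1 aCH = snd s aCH"
      using frame_reg[OF 1(2)] frame_arr[OF 1(2)] i q x by auto
    then show ?case
      using 1(1) by (simp add: wp_simps)
  qed
qed

lemma wp_TRY:
  assumes w: "width_le w" and G: "order_stored m le s" and x: "fst s rx = x" "x < m" "x \<notin> P" "\<And>y. y \<in> P \<Longrightarrow> \<not> le x y"
    and k: "fst s rnch = k" and c: "chains w P k (snd s aG) (snd s aHD) (snd s aCH)"
    and i: "fst s ri = i" "fst s rfd = 0"
    and below: "\<And>g. 1 \<le> g \<Longrightarrow> g \<le> i \<Longrightarrow> card (group k (snd s aG) g) = g \<and> (\<forall>p\<in>group k (snd s aG) g. \<not> le (snd s aHD p) x)"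
  shows "wp TRY (\<lambda>t s'. t \<le> 130 * (k + 2) \<and>
     (fst s' rfd = 1 \<and> chains w (insert x P) (fst s' rnch) (snd s' aG) (snd s' aHD) (snd s' aCH) \<or>
      fst s' rfd = 0 \<and> fst s' rnch = k \<and> snd s' = snd s \<and> card (group k (snd s aG) (Suc i)) = Suc i \<and>
        (\<forall>p\<in>group k (snd s aG) (Suc i). \<not> le (snd s aHD p) x))) s"
    (is "wp TRY ?Q s")
proof -
  let ?s1 = "((fst s)(rl := 0, rf := 0), snd s)"
  have G1: "order_stored m le ?s1" by (rule order_stored_cong[OF G]) auto
  have H: "snd s aHD p < m" if "p < k" for p using c that unfolding chains_def by auto
  have L: "wp (For rj (V rnch) LOOKB) (\<lambda>t s'. t \<le> 48 * (k + 1) \<and> snd s' = snd s \<and>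
     fst s' rl = card (group k (snd s aG) (Suc i)) \<and>
     (fst s' rf = 0 \<and> (\<forall>p\<in>group k (snd s aG) (Suc i). \<not> le (snd s aHD p) x) \<or>
      fst s' rf = 1 \<and> fst s' rcur \<in> group k (snd s aG) (Suc i) \<and> le (snd s aHD (fst s' rcur)) x)) ?s1"
    using wp_LOOK[OF G1, of k i] H x(1,2) k i by simp
  let ?rest = "If (V rf) (Assign rfd (N 1))
       (If (Minus gr (V rl)) (Assign rfd (N 1) ;; Assign rcur (V rnch) ;; Assign rnch (Plus (V rnch) (N 1))) Skip) ;;
     If (V rfd) PLACE Skip"
  have "wp (For rj (V rnch) LOOKB ;; ?rest) (\<lambda>t s'. ?Q (t + 4) s') ?s1"
    unfolding wp_Seq[of "For _ _ _"]
  proof (rule wp_use[OF L], goal_cases step)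
    case (step t s2)
    note 2 = step(1,2)
    have regs: "fst s2 ri = i" "fst s2 rx = x" "fst s2 rnch = k" "fst s2 rfd = 0"
      using frame_reg[OF 2(2)] i x k by auto
    have cl: "card (group k (snd s aG) (Suc i)) \<le> Suc i" using c unfolding chains_def by blast
    note ins = chains_insert[OF w c x(2-4) below]
    show ?case
    proof (cases "fst s2 rf = 0")
      case False
      let ?q = "fst s2 rcur"
      let ?s3 = "((fst s2)(rfd := 1), snd s2)"
      from False 2(1) have q: "?q \<in> group k (snd s aG) (Suc i)" "le (snd s aHD ?q) x" by auto
      have "wp PLACE (\<lambda>u s'. u \<le> 50 * (k + 1) \<and> (\<forall>p<k. p \<noteq> ?q \<longrightarrow> snd s' aG p = regroup (snd s aG) i p) \<and>
        snd s' aG ?q = Suc i \<and> snd s' aHD = (snd s aHD)(?q := x) \<and> snd s' aCH = (snd s aCH)(x := ?q)) ?s3"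
        using wp_PLACE[of ?s3 k i ?q x] regs 2(1) by simp
      then have "wp PLACE (\<lambda>u s'. ?Q (t + (2 + 1 + 1 + (1 + 1 + u)) + 4) s') ?s3"
      proof (rule wp_use, goal_cases step)
        case (step u s')
        note 3 = step(1,2)
        have "chains w (insert x P) k (snd s' aG) ((snd s aHD)(?q := x)) ((snd s aCH)(x := ?q))"
          by (rule ins) (use q 3(1) in auto)
        moreover have "fst s' rfd = 1" "fst s' rnch = k" using frame_reg[OF 3(2)] regs by auto
        ultimately show ?case using 3(1) 2(1) by simp
      qed
      then show ?thesis using False by (simp add: wp_simps)
    next
      case True
      then have none: "\<forall>p\<in>group k (snd s aG) (Suc i). \<not> le (snd s aHD p) x" using 2(1) by auto
      show ?thesis
      proof (cases "card (group k (snd s aG) (Suc i)) = Suc i")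
        case full: True
        then show ?thesis using True none 2(1) regs by (auto simp: wp_simps)
      next
        case False
        then have lt: "card (group k (snd s aG) (Suc i)) \<le> i" using cl by simp
        let ?s3 = "((fst s2)(rfd := 1, rcur := k, rnch := Suc k), snd s2)"
        have "wp PLACE (\<lambda>u s'. u \<le> 50 * (Suc k + 1) \<and> (\<forall>p<Suc k. p \<noteq> k \<longrightarrow> snd s' aG p = regroup (snd s aG) i p) \<and>
          snd s' aG k = Suc i \<and> snd s' aHD = (snd s aHD)(k := x) \<and> snd s' aCH = (snd s aCH)(x := k)) ?s3"
          using wp_PLACE[of ?s3 "Suc k" i k x] regs 2(1) by simp
        then have "wp PLACE (\<lambda>u s'. ?Q (t + (20 + u) + 4) s') ?s3"
        proof (rule wp_use, goal_cases step)
          case (step u s')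
          note 3 = step(1,2)
          have "chains w (insert x P) (Suc k) (snd s' aG) ((snd s aHD)(k := x)) ((snd s aCH)(x := k))"
            by (rule ins) (use lt 3(1) in auto)
          moreover have "fst s' rfd = 1" "fst s' rnch = Suc k" using frame_reg[OF 3(2)] by auto
          ultimately show ?case using 3(1) 2(1) by simp
        qed
        then show ?thesis using True lt regs 2(1) apply (simp add: wp_simps)
          apply (erule wp_mono) by auto
      qed
    qed
  qed
  then show ?thesis unfolding TRY_def
    by (simp add: wp_simps(2) wp_Seq[of "Assign _ _"])
qed

lemma wp_INSERT:
  assumes w: "width_le w" and G: "order_stored m le s" and x: "fst s rx = x" "x < m" "x \<notin> P" "\<And>y. y \<in> P \<Longrightarrow> \<not> le x y"
    and k: "fst s rnch = k" and c: "chains w P k (snd s aG) (snd s aHD) (snd s aCH)"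
  shows "wp INSERT (\<lambda>t s'. t \<le> 150 * ((m + 1) * (k + 2)) \<and>
     chains w (insert x P) (fst s' rnch) (snd s' aG) (snd s' aHD) (snd s' aCH)) s"
proof -
  let ?c = "If (V rfd) Skip TRY"
  let ?s1 = "((fst s)(rfd := 0), snd s)"
  define I where "I j s' \<longleftrightarrow>
    fst s' rfd = 1 \<and> chains w (insert x P) (fst s' rnch) (snd s' aG) (snd s' aHD) (snd s' aCH) \<or>
    fst s' rfd = 0 \<and> fst s' rnch = k \<and> snd s' = snd s \<and>
      (\<forall>g. 1 \<le> g \<longrightarrow> g \<le> j \<longrightarrow> card (group k (snd s aG) g) = g \<and> (\<forall>p\<in>group k (snd s aG) g. \<not> le (snd s aHD p) x))"
    for j and s' :: state
  have "wp (For ri (V rm) ?c) (\<lambda>t s'. t + 2 \<le> 150 * ((m + 1) * (k + 2)) \<and>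
     chains w (insert x P) (fst s' rnch) (snd s' aG) (snd s' aHD) (snd s' aCH)) ?s1"
  proof (rule wp_For[where k = m and T = "132 * (k + 2)" and Inv = I], goal_cases fresh bound init body post)
    case (body j s')
    note j = body(1,2,3,4)
    show ?case
    proof (cases "fst s' rfd = 0")
      case False
      then show ?thesis using j(4) by (auto simp: wp_simps I_def)
    next
      case True
      then have I: "fst s' rnch = k" "snd s' = snd s"
        "\<And>g. 1 \<le> g \<Longrightarrow> g \<le> j \<Longrightarrow> card (group k (snd s aG) g) = g \<and> (\<forall>p\<in>group k (snd s aG) g. \<not> le (snd s aHD p) x)"
        using j(4) by (auto simp: I_def)
      have G': "order_stored m le s'" by (rule order_stored_cong[OF G]) (use frame_reg[OF j(2)] I(2) in auto)
      have "wp TRY (\<lambda>t s''. t \<le> 130 * (k + 2) \<and>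
         (fst s'' rfd = 1 \<and> chains w (insert x P) (fst s'' rnch) (snd s'' aG) (snd s'' aHD) (snd s'' aCH) \<or>
          fst s'' rfd = 0 \<and> fst s'' rnch = k \<and> snd s'' = snd s' \<and> card (group k (snd s' aG) (Suc j)) = Suc j \<and>
            (\<forall>p\<in>group k (snd s' aG) (Suc j). \<not> le (snd s' aHD p) x))) s'"
        by (rule wp_TRY[OF w G' _ x(2-4) I(1) _ j(3) True]) (use frame_reg[OF j(2)] x c I in auto)
      then show ?thesis using True apply (simp add: wp_simps)
        apply (erule wp_mono)
        using I by (auto simp: I_def le_Suc_eq)
    qed
  next
    case (bound s')
    show ?case using frame_reg[OF bound, of rm] G by (simp add: order_stored_def)
  next
    case (post t s')
    note t = post(1) and post(4)
    moreover have "\<not> (card (group k (snd s aG) m) = m \<and> (\<forall>p\<in>group k (snd s aG) m. \<not> le (snd s aHD p) x))"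
      using exists_group[OF c x(2-4)] by auto
    moreover have "1 \<le> m" using m2 by simp
    ultimately have "chains w (insert x P) (fst s' rnch) (snd s' aG) (snd s' aHD) (snd s' aCH)"
      unfolding I_def by blast
    moreover have "t \<le> 140 * ((m + 1) * (k + 2))"
      by (rule loop_bound[OF t]) auto
    moreover have "1 \<le> (m + 1) * (k + 2)" by simp
    ultimately show ?case by linarith
  qed (use k in \<open>auto simp: I_def\<close>)
  then show ?thesis unfolding INSERT_def by (simp add: wp_simps(2) wp_Seq)
qed

definition down_card :: "nat \<Rightarrow> nat" where
  "down_card x = card {y. y < m \<and> le y x}"

text \<open>A bucket sort by the size of the down-set, with one pass over all elements per bucket;
  this is still quadratic.\<close>

definition ordering :: "nat \<Rightarrow> nat list" where
  "ordering n = concat (map (\<lambda>c. filter (\<lambda>x. down_card x = c) [0..<m]) [0..<n])"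

lemma set_ordering: "set (ordering n) = {x. x < m \<and> down_card x < n}"
  by (auto simp: ordering_def)

lemma down_card_le: "down_card x \<le> m"
  using card_mono[of "{..<m}" "{y. y < m \<and> le y x}"] by (auto simp: down_card_def)

lemma ordering_Suc: "ordering (Suc n) = ordering n @ filter (\<lambda>x. down_card x = n) [0..<m]"
  by (simp add: ordering_def)

lemma distinct_ordering: "distinct (ordering n)"
proof (induction n)
  case (Suc n)
  then show ?case using set_ordering[of n] by (auto simp: ordering_Suc)
qed (simp add: ordering_def)

lemma sorted_ordering: "sorted (map down_card (ordering n))"
proof (induction n)
  case (Suc n)
  have "sorted (map down_card (filter (\<lambda>x. down_card x = n) [0..<m]))"
    by (rule sorted_wrt_mono_rel[of _ "\<lambda>_ _. True"]) (auto simp: sorted_wrt_iff_nth_less)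
  then show ?case using Suc set_ordering[of n] by (auto simp: ordering_Suc sorted_append)
qed (simp add: ordering_def)

text \<open>If one element is strictly below another, its down-set is strictly contained in the
  other one and is therefore smaller.\<close>

lemma ordering_linear_extension:
  assumes ij: "i < j" "j < length (ordering n)"
  shows "\<not> le (ordering n ! j) (ordering n ! i)"
proof
  let ?x = "ordering n ! j" and ?y = "ordering n ! i"
  assume le: "le ?x ?y"
  have m: "?x < m" "?y < m" using set_ordering[of n] nth_mem[of j "ordering n"] nth_mem[of i "ordering n"] ij by auto
  have ne: "?x \<noteq> ?y" using distinct_ordering[of n] ij by (simp add: nth_eq_iff_index_eq)
  have "{z. z < m \<and> le z ?x} \<subset> {z. z < m \<and> le z ?y}"
    using le trans[OF _ m] antisym[OF m le] refl[OF m(2)] m ne by auto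
  then have "down_card ?x < down_card ?y" unfolding down_card_def by (rule psubset_card_mono[rotated]) simp
  moreover have "down_card ?y \<le> down_card ?x"
    using sorted_nth_mono[OF sorted_ordering, of i j n] ij by simp
  ultimately show False by simp
qed

end

definition COUNT :: com where
  "COUNT = For rx (V rm) (Assign rl (N 0) ;; For ry (V rm) (Assign rl (Plus (V rl) (LEq (V ry) (V rx)))) ;;
     Store aCNT (V rx) (V rl))"

definition ORDERB :: com where
  "ORDERB = If (Neq (Rd aCNT (V rx)) (V rc)) Skip (PUSH aORD rx)"

definition ORDER :: com where
  "ORDER = Assign rlen (N 0) ;; For rc (Plus (V rm) (N 1)) (For rx (V rm) ORDERB)"

definition CHAINS :: com where
  "CHAINS = COUNT ;; ORDER ;; Assign rnch (N 0) ;; For rk (V rlen) (Assign rx (Rd aORD (V rk)) ;; INSERT)"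

lemma wregs_COUNT [simp]: "wregs COUNT = {rx, rl, ry}" and warrs_COUNT [simp]: "warrs COUNT = {aCNT}"
  by (auto simp: COUNT_def)

lemma wregs_ORDERB [simp]: "wregs ORDERB = {rlen}" and warrs_ORDERB [simp]: "warrs ORDERB = {aORD}"
  by (auto simp: ORDERB_def)

lemma wregs_ORDER [simp]: "wregs ORDER = {rlen, rc, rx}" and warrs_ORDER [simp]: "warrs ORDER = {aORD}"
  by (auto simp: ORDER_def)

lemma wregs_CHAINS [simp]: "wregs CHAINS = {rx, rl, ry, rlen, rc, rnch, rk, rf, rcur, rj, rfd, ri}"
  and warrs_CHAINS [simp]: "warrs CHAINS = {aCNT, aORD, aG, aHD, aCH}"
  by (auto simp: CHAINS_def)

context bposet
begin

lemma card_Suc_less: "card {y. y < Suc j \<and> Q y} = card {y. y < j \<and> Q y} + of_bool (Q j)"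
proof -
  have "{y. y < Suc j \<and> Q y} = (if Q j then insert j {y. y < j \<and> Q y} else {y. y < j \<and> Q y})"
    by (auto simp: less_Suc_eq)
  then show ?thesis by simp
qed

lemma wp_COUNT:
  assumes G: "order_stored m le s"
  shows "wp COUNT (\<lambda>t s'. t \<le> 50 * ((m + 1) * (m + 1)) \<and> (\<forall>x<m. snd s' aCNT x = down_card x)) s"
proof -
  let ?b = "Assign rl (Plus (V rl) (LEq (V ry) (V rx)))"
  let ?c = "Assign rl (N 0) ;; For ry (V rm) ?b ;; Store aCNT (V rx) (V rl)"
  have inner: "wp (For ry (V rm) ?b) (\<lambda>t s'. t \<le> 20 * (m + 1) \<and> fst s' rl = down_card x) s1"
    if s1: "order_stored m le s1" "fst s1 rl = 0" "fst s1 rx = x" "x < m" for s1 x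
  proof (rule wp_For[where k = m and T = 12 and Inv = "\<lambda>j s'. fst s' rl = card {y. y < j \<and> le y x}"], goal_cases fresh bound init body post)
    case (body j s')
    note j = body(1,2,3,4)
    have G': "order_stored m le s'" by (rule order_stored_cong[OF s1(1)]) (use frame_reg[OF j(2)] frame_arr[OF j(2)] in auto)
    have "fst s' rx = x" using frame_reg[OF j(2)] s1 by simp
    then show ?case
      using j aval_LEq[OF G', of "V ry" "V rx"] s1(4) by (simp add: wp_simps card_Suc_less)
  next
    case (bound s')
    show ?case using frame_reg[OF bound, of rm] s1 by (simp add: order_stored_def)
  qed (use s1 in \<open>auto simp: down_card_def\<close>)
  show ?thesis unfolding COUNT_def
  proof (rule wp_For[where k = m and T = "28 * (m + 1)" and Inv = "\<lambda>j s'. \<forall>x<j. snd s' aCNT x = down_card x"], goal_cases fresh bound init body post)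
    case (body j s')
    note j = body(1,2,3,4)
    let ?s1 = "((fst s')(rl := 0), snd s')"
    have "order_stored m le ?s1" by (rule order_stored_cong[OF G]) (use frame_reg[OF j(2)] frame_arr[OF j(2)] in auto)
    then have "wp (For ry (V rm) ?b) (\<lambda>t s'. t \<le> 20 * (m + 1) \<and> fst s' rl = down_card j) ?s1"
      using j by (intro inner) auto
    then have "wp (For ry (V rm) ?b) (\<lambda>u s'. wp (Store aCNT (V rx) (V rl)) (\<lambda>v s''. 2 + (u + v) \<le> 28 * (m + 1) \<and>
         (\<forall>x<Suc j. snd ((fst s'')(rx := Suc j), snd s'') aCNT x = down_card x)) s') ?s1"
    proof (rule wp_use, goal_cases step)
      case (step u s2)
      note 2 = step(1,2)
      then show ?case
        using j frame_reg[OF 2(2), of rx] frame_arr[OF 2(2), of aCNT] by (auto simp: wp_simps less_Suc_eq)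
    qed
    then show ?case
      by (simp add: wp_simps(2) wp_Seq)
  next
    case (bound s')
    show ?case using frame_reg[OF bound, of rm] G by (simp add: order_stored_def)
  next
    case (post t s')
    note t = post(1) and post(4)
    moreover have "t \<le> 50 * ((m + 1) * (m + 1))" by (rule loop_bound[OF t]) auto
    ultimately show ?case by simp
  qed auto
qed

lemma wp_ORDER:
  assumes m: "fst s rm = m" and c: "\<forall>x<m. snd s aCNT x = down_card x"
  shows "wp ORDER (\<lambda>t s'. t \<le> 150 * ((m + 1) * (m + 1)) \<and> holds aORD s' (ordering (m + 1))) s"
proof -
  have inner: "wp (For rx (V rm) ORDERB) (\<lambda>t s'. t \<le> 33 * (m + 1) \<and>
      holds aORD s' (xs @ filter (\<lambda>x. down_card x = c) [0..<m])) s1"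
    if s1: "fst s1 rm = m" "\<forall>x<m. snd s1 aCNT x = down_card x" "holds aORD s1 xs" "fst s1 rc = c" for s1 xs c
  proof (rule wp_For[where k = m and T = 25 and Inv = "\<lambda>j s'. holds aORD s' (xs @ filter (\<lambda>x. down_card x = c) [0..<j])"], goal_cases fresh bound init body post)
    case (body j s')
    note j = body(1,2,3,4)
    have "fst s' rc = c" "snd s' aCNT j = down_card j" using frame_reg[OF j(2)] frame_arr[OF j(2)] s1 j(1) by auto
    moreover have "wp (PUSH aORD rx) (\<lambda>t s'. t = 7 \<and> holds aORD s' ((xs @ filter (\<lambda>x. down_card x = c) [0..<j]) @ [j])) s'"
      using wp_PUSH[OF j(4), of rx] j(3) by simp
    then have "wp (PUSH aORD rx) (\<lambda>u s''. 10 + u \<le> 25 \<and> holds aORD ((fst s'')(rx := Suc j), snd s'') (xs @ filter (\<lambda>x. down_card x = c) [0..<j] @ [j])) s'"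
      by (rule wp_mono) (auto simp: holds_def)
    ultimately show ?case
      using j(3,4) unfolding ORDERB_def wp_If by (auto simp: wp_Skip holds_def)
  next
    case (bound s')
    show ?case using frame_reg[OF bound, of rm] s1 by simp
  qed (use s1 in \<open>auto simp: holds_def\<close>)
  let ?c = "For rx (V rm) ORDERB"
  let ?s1 = "((fst s)(rlen := 0), snd s)"
  have "wp (For rc (Plus (V rm) (N 1)) ?c) (\<lambda>t s'. t + 2 \<le> 150 * ((m + 1) * (m + 1)) \<and> holds aORD s' (ordering (m + 1))) ?s1"
  proof (rule wp_For[where k = "m + 1" and T = "33 * (m + 1)" and Inv = "\<lambda>j s'. holds aORD s' (ordering j)"], goal_cases fresh bound init body post)
    case (body j s')
    note j = body(1,2,3,4)
    have "wp ?c (\<lambda>t s'. t \<le> 33 * (m + 1) \<and> holds aORD s' (ordering (Suc j))) s'"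
      unfolding ordering_Suc by (rule inner) (use frame_reg[OF j(2)] frame_arr[OF j(2)] m c j in auto)
    then show ?case
      by (rule wp_mono) (auto simp: holds_def)
  next
    case (bound s')
    show ?case using frame_reg[OF bound, of rm] m by simp
  next
    case (post t s')
    note t = post(1) and h = post(4)
    have "t \<le> 43 * (2 * (m + 1) * (m + 1))" by (rule loop_bound[OF t]) auto
    moreover have "1 \<le> (m + 1) * (m + 1)" by simp
    ultimately have "t + 2 \<le> 150 * ((m + 1) * (m + 1))" unfolding mult.assoc by linarith
    then show ?case using h by simp
  qed (auto simp: holds_def ordering_def)
  then show ?thesis unfolding ORDER_def by (simp add: wp_simps(2) wp_Seq)
qed

lemma wp_CHAINS:
  assumes w: "width_le w" and G: "order_stored m le s"
  shows "wp CHAINS (\<lambda>t s'. t \<le> 400 * ((m + 1) * ((m + 1) * (w * w + 2))) \<and> fst s' rnch \<le> w * w \<and>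
     (\<forall>x<m. snd s' aCH x < fst s' rnch) \<and>
     (\<forall>x<m. \<forall>y<m. snd s' aCH x = snd s' aCH y \<longrightarrow> le x y \<or> le y x)) s"
    (is "wp _ ?Q s")
proof -
  have len: "length (ordering (m + 1)) = m"
  proof -
    have "set (ordering (m + 1)) = {..<m}" using set_ordering[of "m + 1"] down_card_le by (auto simp: less_Suc_eq_le)
    then show ?thesis using distinct_card[OF distinct_ordering, of "m + 1"] by simp
  qed
  let ?c = "Assign rx (Rd aORD (V rk)) ;; INSERT"
  let ?B = "(m + 1) * (w * w + 2)"
  have B: "1 \<le> ?B" by simp
  have loop: "wp (For rk (V rlen) ?c) (\<lambda>t s'. t \<le> 165 * ((m + 1) * ?B) \<and>
     chains w {..<m} (fst s' rnch) (snd s' aG) (snd s' aHD) (snd s' aCH)) s1"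
    if s1: "order_stored m le s1" "holds aORD s1 (ordering (m + 1))" "fst s1 rnch = 0" for s1
  proof (rule wp_For[where k = m and T = "155 * ?B" and
        Inv = "\<lambda>j s'. chains w (set (take j (ordering (m + 1)))) (fst s' rnch) (snd s' aG) (snd s' aHD) (snd s' aCH)"], goal_cases fresh bound init body post)
    case (body j s')
    note j = body(1,2,3) and c = body(4)
    let ?x = "ordering (m + 1) ! j"
    let ?s2 = "((fst s')(rx := ?x), snd s')"
    have x: "snd s' aORD j = ?x" using s1(2) frame_arr[OF j(2), of aORD] j(1) len by (simp add: holds_def)
    have "?x \<in> set (ordering (m + 1))" using nth_mem[of j "ordering (m + 1)"] j(1) len by (simp only:)
    then have xm: "?x < m" unfolding set_ordering by simp
    have x1: "?x \<notin> set (take j (ordering (m + 1)))"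
    proof
      assume "?x \<in> set (take j (ordering (m + 1)))"
      then obtain i where "i < j" "ordering (m + 1) ! i = ?x" using j(1) len by (auto simp: in_set_conv_nth)
      then show False using nth_eq_iff_index_eq[OF distinct_ordering, of i "m + 1" j] j(1) len by simp
    qed
    have x2: "\<not> le ?x y" if "y \<in> set (take j (ordering (m + 1)))" for y
    proof -
      from that obtain i where "i < j" "ordering (m + 1) ! i = y" using j(1) len by (auto simp: in_set_conv_nth)
      then show ?thesis using ordering_linear_extension[of i j "m + 1"] j(1) len by simp
    qed
    have G2: "order_stored m le ?s2" by (rule order_stored_cong[OF s1(1)]) (use frame_reg[OF j(2)] frame_arr[OF j(2)] in auto)
    have "wp INSERT (\<lambda>t s''. t \<le> 150 * ((m + 1) * (fst s' rnch + 2)) \<and>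
       chains w (insert ?x (set (take j (ordering (m + 1))))) (fst s'' rnch) (snd s'' aG) (snd s'' aHD) (snd s'' aCH)) ?s2"
      by (rule wp_INSERT[OF w G2 _ xm x1 x2]) (use c in auto)
    moreover have "4 + t \<le> 155 * ?B" if "t \<le> 150 * ((m + 1) * (fst s' rnch + 2))" for t
    proof -
      have "(m + 1) * (fst s' rnch + 2) \<le> ?B" using chains_count[OF c] by (intro mult_le_mono2) simp
      with that B show ?thesis by linarith
    qed
    moreover have "insert ?x (set (take j (ordering (m + 1)))) = set (take (Suc j) (ordering (m + 1)))"
      using j(1) len by (simp add: take_Suc_conv_app_nth)
    ultimately have "wp INSERT (\<lambda>t s''. 4 + t \<le> 155 * ?B \<and>
       chains w (set (take (Suc j) (ordering (m + 1)))) (fst s'' rnch) (snd s'' aG) (snd s'' aHD) (snd s'' aCH)) ?s2"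
      by (elim wp_mono) auto
    then show ?case
      unfolding wp_Seq wp_Assign using j(3) x by simp (erule wp_mono, simp)
  next
    case (bound s')
    show ?case using frame_reg[OF bound, of rlen] s1 len by (simp add: holds_def)
  next
    case (post t s')
    note t = post(1) and c = post(4)
    have "t \<le> 165 * ((m + 1) * ?B)" by (rule loop_bound[OF t B]) auto
    moreover have "set (take m (ordering (m + 1))) = {..<m}"
      using len set_ordering[of "m + 1"] down_card_le by (auto simp: less_Suc_eq_le)
    ultimately show ?case using c by simp
  qed (use s1 in \<open>auto simp: chains_empty\<close>)
  have BB: "(m + 1) * (m + 1) \<le> (m + 1) * ?B" by (intro mult_le_mono2) simp
  show ?thesis
    unfolding CHAINS_def wp_Seq[of COUNT]
  proof (rule wp_use[OF wp_COUNT[OF G]], goal_cases step)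
    case (step t s1)
    note 1 = step(1,2)
    have m1: "fst s1 rm = m" using frame_reg[OF 1(2), of rm] G by (simp add: order_stored_def)
    have o: "wp ORDER (\<lambda>t s'. t \<le> 150 * ((m + 1) * (m + 1)) \<and> holds aORD s' (ordering (m + 1))) s1"
      using 1(1) m1 by (intro wp_ORDER) auto
    show ?case
      unfolding wp_Seq[of ORDER]
    proof (rule wp_use[OF o], goal_cases step)
      case (step u s2)
      note 2 = step(1,2)
      let ?s3 = "((fst s2)(rnch := 0), snd s2)"
      have "order_stored m le ?s3" by (rule order_stored_cong[OF G]) (use frame_reg[OF 1(2)] frame_reg[OF 2(2)] frame_arr[OF 1(2)] frame_arr[OF 2(2)] in auto)
      then have "wp (For rk (V rlen) ?c) (\<lambda>t s'. t \<le> 165 * ((m + 1) * ?B) \<and>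
         chains w {..<m} (fst s' rnch) (snd s' aG) (snd s' aHD) (snd s' aCH)) ?s3"
        using 2(1) by (intro loop) (auto simp: holds_def)
      then have "wp (For rk (V rlen) ?c) (\<lambda>v. ?Q (t + (u + (2 + v)))) ?s3"
      proof (rule wp_mono, goal_cases step)
        case (step v s')
        note 3 = step(1)
        have "1 \<le> (m + 1) * ?B" by simp
        then have "t + (u + (2 + v)) \<le> 400 * ((m + 1) * ?B)" using 1(1) 2(1) 3 BB by linarith
        moreover have "fst s' rnch \<le> w * w" using chains_count 3 by blast
        ultimately show ?case using 3 unfolding chains_def by auto
      qed
      then show ?case
        unfolding wp_Seq wp_Assign by simp
    qed
  qed
qed

end

section \<open>Reading the input\<close>

text \<open>Element \<open>x + 1\<close> is the \<open>x\<close>-th element of the input; \<open>0\<close> and \<open>n + 1\<close> are a new least and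
  a new greatest element.\<close>

definition ext_le :: "nat \<Rightarrow> (nat \<Rightarrow> nat \<Rightarrow> bool) \<Rightarrow> nat \<Rightarrow> nat \<Rightarrow> bool" where
  "ext_le n rel x y \<longleftrightarrow> x = 0 \<or> y = n + 1 \<or> (0 < x \<and> x \<le> n \<and> 0 < y \<and> y \<le> n \<and> rel (x - 1) (y - 1))"

section \<open>Codes for colours and tables for the order\<close>

primrec lastpos :: "(nat \<Rightarrow> nat) \<Rightarrow> nat \<Rightarrow> nat \<Rightarrow> nat" where
  "lastpos f c 0 = 0"
| "lastpos f c (Suc j) = (if f j = c then Suc j else lastpos f c j)"

lemma lastpos_le: "lastpos f c j \<le> j"
  by (induction j) auto

lemma lastpos_hit: "lastpos f c j \<noteq> 0 \<Longrightarrow> f (lastpos f c j - 1) = c"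
  by (induction j) (auto split: if_splits)

lemma lastpos_pos: "i < j \<Longrightarrow> f i = c \<Longrightarrow> lastpos f c j \<noteq> 0"
  by (induction j) (auto simp: less_Suc_eq)

text \<open>A colour is represented by its last occurrence in the code of the formula, if there is one.\<close>

definition color_code :: "nat \<Rightarrow> nat \<Rightarrow> (nat \<Rightarrow> nat) \<Rightarrow> (nat \<Rightarrow> nat) \<Rightarrow> nat \<Rightarrow> nat" where
  "color_code n L code color x = (if x = 0 then L + 1 else if x = n + 1 then L + 2 else lastpos code (color (x - 1)) L)"

text \<open>Products such as \<open>n * n\<close> are formed by repeated addition. The length
  \<open>L\<close> of the code of the formula is what remains of the input word after the
  poset.\<close>

definition SETUP :: com where
  "SETUP = Assign rn (Rd 0 (N 0)) ;; Assign rm (Plus (V rn) (N 2)) ;; Assign rtop (Plus (V rn) (N 1)) ;;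
     Assign rcb (N 1) ;; For ri (V rn) (Assign rcb (Plus (V rcb) (V rn))) ;;
     Assign rfb (Plus (V rcb) (V rn)) ;; Assign rL (Minus (V 0) (V rfb)) ;;
     Assign rl (N 0) ;; For rx (V rm) (Store aOFF (V rx) (V rl) ;; Assign rl (Plus (V rl) (V rm)))"

abbreviation "cell \<equiv> Plus (Rd aOFF (V rx)) (V ry)"

text \<open>For an inner row, \<open>rl\<close> equals \<open>(x - 1) * n\<close>, so
  \<open>rl + y\<close> is the input address \<open>1 + (x - 1) * n + (y - 1)\<close>: the header
  cell cancels the shift of the columns.\<close>

definition MATB :: com where
  "MATB = If (V rx)
     (If (Minus (V rtop) (V ry))
       (If (V ry)
         (If (Minus (V rtop) (V rx)) (Store aLE cell (Rd 0 (Plus (V rl) (V ry)))) (Store aLE cell (N 0)))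
         (Store aLE cell (N 0)))
       (Store aLE cell (N 1)))
     (Store aLE cell (N 1))"

definition MATRIX :: com where
  "MATRIX = Assign rl (N 0) ;; For rx (V rm) (For ry (V rm) MATB ;; If (V rx) (Assign rl (Plus (V rl) (V rn))) Skip)"

definition COLB :: com where
  "COLB = If (Neq (Rd 0 (Plus (V rfb) (V ry))) (Rd 0 (Minus (Plus (V rcb) (V rx)) (N 1)))) Skip
     (Assign rl (Plus (V ry) (N 1)))"

definition COLORS :: com where
  "COLORS = For rx (V rm) (If (V rx)
     (If (Minus (V rtop) (V rx)) (Assign rl (N 0) ;; For ry (V rL) COLB) (Assign rl (Plus (V rL) (N 2))))
     (Assign rl (Plus (V rL) (N 1))) ;; Store aNC (V rx) (V rl))"

text \<open>The initial class of an element combines its chain and its colour code as digits in base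
  \<open>L + 3\<close>; colour codes are at most \<open>L + 2\<close>.\<close>

definition BASE :: com where
  "BASE = For rx (V rm) (Assign rl (Rd aNC (V rx)) ;;
       For ry (Rd aCH (V rx)) (Assign rl (Plus (V rl) (Plus (V rL) (N 3)))) ;; Store aK (V rx) (V rl)) ;;
     Assign rM (N 0) ;; For ry (V rnch) (Assign rM (Plus (V rM) (Plus (V rL) (N 3)))) ;;
     Assign rd (N 0) ;; Assign rlb (N 0)"

lemma wregs_SETUP [simp]: "wregs SETUP = {rn, rm, rtop, rcb, ri, rfb, rL, rl, rx}" and warrs_SETUP [simp]: "warrs SETUP = {aOFF}"
  by (auto simp: SETUP_def)

lemma wregs_MATB [simp]: "wregs MATB = {}" and warrs_MATB [simp]: "warrs MATB = {aLE}"
  by (auto simp: MATB_def)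

lemma wregs_MATRIX [simp]: "wregs MATRIX = {rl, rx, ry}" and warrs_MATRIX [simp]: "warrs MATRIX = {aLE}"
  by (auto simp: MATRIX_def)

lemma wregs_COLB [simp]: "wregs COLB = {rl}" and warrs_COLB [simp]: "warrs COLB = {}"
  by (auto simp: COLB_def)

lemma wregs_COLORS [simp]: "wregs COLORS = {rl, rx, ry}" and warrs_COLORS [simp]: "warrs COLORS = {aNC}"
  by (auto simp: COLORS_def)

lemma wregs_BASE [simp]: "wregs BASE = {rx, rl, ry, rM, rd, rlb}" and warrs_BASE [simp]: "warrs BASE = {aK}"
  by (auto simp: BASE_def)

lemma wp_SETUP:
  assumes n: "snd s 0 0 = n" and len: "fst s 0 = 1 + n * n + n + L"
  shows "wp SETUP (\<lambda>t s'. t \<le> 100 * (n + 2) \<and> fst s' rn = n \<and> fst s' rm = n + 2 \<and> fst s' rtop = n + 1 \<and>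
     fst s' rcb = 1 + n * n \<and> fst s' rfb = 1 + n * n + n \<and> fst s' rL = L \<and> (\<forall>x<n + 2. snd s' aOFF x = x * (n + 2))) s"
proof -
  let ?s1 = "((fst s)(rn := n, rm := n + 2, rtop := n + 1, rcb := 1), snd s)"
  let ?F1 = "For ri (V rn) (Assign rcb (Plus (V rcb) (V rn)))"
  let ?c2 = "Store aOFF (V rx) (V rl) ;; Assign rl (Plus (V rl) (V rm))"
  have F1: "wp ?F1 (\<lambda>t s'. t \<le> 12 * (n + 1) \<and> fst s' rcb = 1 + n * n) ?s1"
  proof (rule wp_For[where k = n and T = 4 and Inv = "\<lambda>j s'. fst s' rcb = 1 + j * n"], goal_cases fresh bound init body post)
    case (body j s')
    note j = body(1,2,3,4)
    have "fst s' rn = n" using frame_reg[OF j(2), of rn] by simp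
    then show ?case
      using j(4) by (simp add: wp_simps)
  next
    case (bound s')
    show ?case using frame_reg[OF bound, of rn] by simp
  qed auto
  have F2: "wp (For rx (V rm) ?c2) (\<lambda>t s'. t \<le> 15 * (n + 2 + 1) \<and> (\<forall>x<n + 2. snd s' aOFF x = x * (n + 2))) s1"
    if s1: "fst s1 rm = n + 2" "fst s1 rl = 0" for s1
  proof (rule wp_For[where k = "n + 2" and T = 7 and Inv = "\<lambda>j s'. fst s' rl = j * (n + 2) \<and> (\<forall>x<j. snd s' aOFF x = x * (n + 2))"], goal_cases fresh bound init body post)
    case (body j s')
    note j = body(1,2,3,4)
    have "fst s' rm = n + 2" using frame_reg[OF j(2), of rm] s1 by simp
    then show ?case
      using j(3,4) by (auto simp: wp_simps less_Suc_eq)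
  next
    case (bound s')
    show ?case using frame_reg[OF bound, of rm] s1 by simp
  qed (use s1 in auto)
  have "wp (?F1 ;; Assign rfb (Plus (V rcb) (V rn)) ;; Assign rL (Minus (V 0) (V rfb)) ;; Assign rl (N 0) ;; For rx (V rm) ?c2)
    (\<lambda>t s'. t + 14 \<le> 100 * (n + 2) \<and> fst s' rn = n \<and> fst s' rm = n + 2 \<and> fst s' rtop = n + 1 \<and>
     fst s' rcb = 1 + n * n \<and> fst s' rfb = 1 + n * n + n \<and> fst s' rL = L \<and> (\<forall>x<n + 2. snd s' aOFF x = x * (n + 2))) ?s1"
    unfolding wp_Seq[of ?F1]
  proof (rule wp_use[OF F1], goal_cases step)
    case (step t s2)
    note 2 = step(1,2)
    have regs: "fst s2 rn = n" "fst s2 rm = n + 2" "fst s2 rtop = n + 1" "fst s2 0 = 1 + n * n + n + L"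
      using frame_reg[OF 2(2)] len by auto
    let ?s3 = "((fst s2)(rfb := 1 + n * n + n, rL := L, rl := 0), snd s2)"
    have "wp (For rx (V rm) ?c2) (\<lambda>t s'. t \<le> 15 * (n + 2 + 1) \<and> (\<forall>x<n + 2. snd s' aOFF x = x * (n + 2))) ?s3"
      by (rule F2) (use regs in auto)
    then have "wp (For rx (V rm) ?c2) (\<lambda>u s'. t + (10 + u) + 14 \<le> 100 * (n + 2) \<and> fst s' rn = n \<and> fst s' rm = n + 2 \<and> fst s' rtop = n + 1 \<and>
      fst s' rcb = 1 + n * n \<and> fst s' rfb = 1 + n * n + n \<and> fst s' rL = L \<and> (\<forall>x<n + 2. snd s' aOFF x = x * (n + 2))) ?s3"
    proof (rule wp_use, goal_cases step)
      case (step u s')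
      note 4 = step(1,2)
      then show ?case
        using frame_reg[OF 4(2)] 2(1) regs by simp
    qed
    then show ?case
      using 2(1) regs by (simp add: wp_simps(2) wp_Seq[of "Assign _ _"])
  qed
  then show ?thesis unfolding SETUP_def using n
    by (simp add: wp_simps(2) wp_Seq[of "Assign _ _"]) (erule wp_mono, simp)
qed

lemma row_less: "x' < x \<Longrightarrow> y < m \<Longrightarrow> x' * m + y < x * (m::nat)"
  using mult_le_mono1[of "Suc x'" x m] by simp

lemma wp_MATRIX:
  assumes regs: "fst s rn = n" "fst s rm = n + 2" "fst s rtop = n + 1" and off: "\<forall>x<n + 2. snd s aOFF x = x * (n + 2)"
    and inp: "\<And>i j. i < n \<Longrightarrow> j < n \<Longrightarrow> snd s 0 (1 + i * n + j) = of_bool (rel i j)"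
  shows "wp MATRIX (\<lambda>t s'. t \<le> 100 * ((n + 3) * (n + 3)) \<and>
     (\<forall>x<n + 2. \<forall>y<n + 2. snd s' aLE (x * (n + 2) + y) = of_bool (ext_le n rel x y))) s"
proof -
  let ?m = "n + 2"
  let ?c = "For ry (V rm) MATB ;; If (V rx) (Assign rl (Plus (V rl) (V rn))) Skip"
  have inner: "wp (For ry (V rm) MATB) (\<lambda>t s'. t \<le> 48 * (?m + 1) \<and>
      (\<forall>i. snd s' aLE i = (if x * ?m \<le> i \<and> i < x * ?m + ?m then of_bool (ext_le n rel x (i - x * ?m)) else snd s1 aLE i))) s1"
    if s1: "fst s1 rn = n" "fst s1 rm = ?m" "fst s1 rtop = n + 1" "snd s1 aOFF = snd s aOFF" "snd s1 0 = snd s 0"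
      "fst s1 rx = x" "x < ?m" "fst s1 rl = (x - 1) * n" for s1 x
  proof (rule wp_For[where k = "?m" and T = 40 and Inv = "\<lambda>j s'.
      \<forall>i. snd s' aLE i = (if x * ?m \<le> i \<and> i < x * ?m + j then of_bool (ext_le n rel x (i - x * ?m)) else snd s1 aLE i)"], goal_cases fresh bound init body post)
    case (body j s')
    note j = body(1,2,3) and I = body(4)
    have r: "fst s' rx = x" "fst s' rtop = n + 1" "fst s' rl = (x - 1) * n" "snd s' aOFF x = x * ?m" "snd s' 0 = snd s 0"
      using frame_reg[OF j(2)] frame_arr[OF j(2)] s1 off by auto
    have v: "snd s 0 ((x - 1) * n + j) = of_bool (ext_le n rel x j)" if "0 < x" "x \<le> n" "0 < j" "j \<le> n"
      using inp[of "x - 1" "j - 1"] that by (simp add: ext_le_def)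
    have "wp MATB (\<lambda>t s''. t \<le> 40 \<and> snd s'' aLE = (snd s' aLE)(x * ?m + j := of_bool (ext_le n rel x j))) s'"
    proof -
      consider "x = 0" | "x \<noteq> 0" "j = n + 1" | "x \<noteq> 0" "j \<noteq> n + 1" "j = 0" | "x = n + 1" "j \<noteq> n + 1" "j \<noteq> 0"
        | "0 < x" "x \<le> n" "0 < j" "j \<le> n" using \<open>x < ?m\<close> j(1) by linarith
      then show ?thesis using r j(1,3) v by cases (auto simp: MATB_def wp_simps ext_le_def)
    qed
    then show ?case
      by (rule wp_mono) (use I in \<open>auto simp: less_Suc_eq\<close>)
  next
    case (bound s')
    show ?case using frame_reg[OF bound, of rm] s1 by simp
  qed auto
  let ?s1 = "((fst s)(rl := 0), snd s)"
  have "wp (For rx (V rm) ?c) (\<lambda>t s'. t + 2 \<le> 100 * ((n + 3) * (n + 3)) \<and>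
     (\<forall>x<n + 2. \<forall>y<n + 2. snd s' aLE (x * (n + 2) + y) = of_bool (ext_le n rel x y))) ?s1"
  proof (rule wp_For[where k = "?m" and T = "56 * (n + 3)" and Inv = "\<lambda>j s'. fst s' rl = (j - 1) * n \<and>
      (\<forall>x<j. \<forall>y<?m. snd s' aLE (x * ?m + y) = of_bool (ext_le n rel x y))"], goal_cases fresh bound init body post)
    case (body j s')
    note j = body(1,2,3) and I = body(4)
    have "wp (For ry (V rm) MATB) (\<lambda>t s''. t \<le> 48 * (?m + 1) \<and>
      (\<forall>i. snd s'' aLE i = (if j * ?m \<le> i \<and> i < j * ?m + ?m then of_bool (ext_le n rel j (i - j * ?m)) else snd s' aLE i))) s'"
      by (rule inner) (use regs frame_reg[OF j(2)] frame_arr[OF j(2)] j I in auto)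
    then show ?case
      unfolding wp_Seq
    proof (rule wp_use, goal_cases step)
      case (step t s2)
      note 2 = step(1,2)
      have rows: "snd s2 aLE (x * ?m + y) = of_bool (ext_le n rel x y)" if "x < Suc j" "y < ?m" for x y
      proof (cases "x = j")
        case True then show ?thesis using 2(1) that by simp
      next
        case False
        then have "x < j" using that by simp
        then show ?thesis using row_less[of x j y ?m] that 2(1) I by simp
      qed
      have "fst s2 rx = j" "fst s2 rn = n" "fst s2 rl = (j - 1) * n"
        using frame_reg[OF 2(2)] frame_reg[OF j(2)] regs j I by auto
      moreover have "(j - 1) * n + n = j * n" if "0 < j" using that by (cases j) auto
      ultimately show ?case
        using rows 2(1) by (auto simp: wp_simps)
    qed
  next
    case (bound s')
    show ?case using frame_reg[OF bound, of rm] regs by simp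
  next
    case (post t s')
    note t = post(1) and I = post(4)
    have "t \<le> 64 * ((n + 3) * (n + 3))" by (rule loop_bound[OF t]) auto
    moreover have "1 \<le> (n + 3) * (n + 3)" by simp
    ultimately have "t + 2 \<le> 100 * ((n + 3) * (n + 3))" by linarith
    then show ?case using I by simp
  qed auto
  then show ?thesis unfolding MATRIX_def by (simp add: wp_simps(2) wp_Seq[of "Assign _ _"])
qed

lemma wp_COLORS:
  assumes regs: "fst s rm = n + 2" "fst s rtop = n + 1" "fst s rcb = 1 + n * n" "fst s rfb = 1 + n * n + n" "fst s rL = L"
    and inp: "\<And>i. i < n \<Longrightarrow> snd s 0 (1 + n * n + i) = color i" "\<And>i. i < L \<Longrightarrow> snd s 0 (1 + n * n + n + i) = code i"
  shows "wp COLORS (\<lambda>t s'. t \<le> 60 * ((n + 3) * (L + 1)) \<and> (\<forall>x<n + 2. snd s' aNC x = color_code n L code color x)) s"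
proof -
  let ?m = "n + 2"
  let ?i = "If (V rx) (If (Minus (V rtop) (V rx)) (Assign rl (N 0) ;; For ry (V rL) COLB) (Assign rl (Plus (V rL) (N 2))))
     (Assign rl (Plus (V rL) (N 1)))"
  let ?c = "?i ;; Store aNC (V rx) (V rl)"
  have inner: "wp (For ry (V rL) COLB) (\<lambda>t s'. t \<le> 38 * (L + 1) \<and> fst s' rl = lastpos code (color (x - 1)) L) s1"
    if s1: "fst s1 rL = L" "fst s1 rfb = 1 + n * n + n" "fst s1 rcb = 1 + n * n" "fst s1 rx = x" "0 < x" "x \<le> n"
      "fst s1 rl = 0" "snd s1 0 = snd s 0" for s1 x
  proof (rule wp_For[where k = L and T = 30 and Inv = "\<lambda>j s'. fst s' rl = lastpos code (color (x - 1)) j"], goal_cases fresh bound init body post)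
    case (body j s')
    note j = body(1,2,3,4)
    have "fst s' rfb = 1 + n * n + n" "fst s' rcb = 1 + n * n" "fst s' rx = x" "snd s' 0 = snd s 0"
      using frame_reg[OF j(2)] frame_arr[OF j(2)] s1 by auto
    moreover have "snd s 0 (n * n + x) = color (x - 1)" using inp(1)[of "x - 1"] s1(5,6) by simp
    ultimately show ?case
      using j inp(2)[of j] by (simp add: COLB_def wp_simps)
  next
    case (bound s')
    show ?case using frame_reg[OF bound, of rL] s1 by simp
  qed (use s1 in auto)
  show ?thesis unfolding COLORS_def
  proof (rule wp_For[where k = ?m and T = "52 * (L + 1)" and Inv = "\<lambda>j s'. \<forall>x<j. snd s' aNC x = color_code n L code color x"], goal_cases fresh bound init body post)
    case (body j s')
    note j = body(1,2,3) and I = body(4)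
    have r: "fst s' rtop = n + 1" "fst s' rL = L" "fst s' rfb = 1 + n * n + n" "fst s' rcb = 1 + n * n" "snd s' 0 = snd s 0"
      using frame_reg[OF j(2)] frame_arr[OF j(2)] regs by auto
    have "wp ?i (\<lambda>t s''. t \<le> 48 * (L + 1) \<and> fst s'' rl = color_code n L code color j) s'"
    proof (cases "0 < j \<and> j \<le> n")
      case True
      have "wp (For ry (V rL) COLB) (\<lambda>t s'. t \<le> 38 * (L + 1) \<and> fst s' rl = lastpos code (color (j - 1)) L) ((fst s')(rl := 0), snd s')"
        by (rule inner) (use r j True in auto)
      then have "wp (For ry (V rL) COLB) (\<lambda>t s'. t + 8 \<le> 48 * (L + 1) \<and> fst s' rl = color_code n L code color j) ((fst s')(rl := 0), snd s')"
        by (rule wp_mono) (use True in \<open>auto simp: color_code_def\<close>)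
      then show ?thesis using True j(3) r by (simp add: wp_simps)
    next
      case False
      then have "j = 0 \<or> j = n + 1" using j(1) by auto
      then show ?thesis using j(3) r by (auto simp: wp_simps color_code_def)
    qed
    then show ?case
      unfolding wp_Seq[of ?i]
    proof (rule wp_use, goal_cases step)
      case (step t s2)
      note 2 = step(1,2)
      have "fst s2 rx = j" "snd s2 aNC = snd s' aNC" using frame_reg[OF 2(2)] frame_arr[OF 2(2)] j by auto
      then show ?case
        using 2(1) I by (auto simp: wp_simps less_Suc_eq)
    qed
  next
    case (bound s')
    show ?case using frame_reg[OF bound, of rm] regs by simp
  next
    case (post t s')
    note t = post(1) and I = post(4)
    have "t \<le> 60 * ((n + 3) * (L + 1))" by (rule loop_bound[OF t]) auto
    then show ?case using I by simp
  qed auto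
qed

lemma wp_BASE:
  assumes regs: "fst s rm = m" "fst s rL = L" "fst s rnch = k" and ch: "\<And>x. x < m \<Longrightarrow> snd s aCH x < k" and k: "k \<le> W"
  shows "wp BASE (\<lambda>t s'. t \<le> 60 * ((m + 1) * (W + 1)) \<and> fst s' rM = k * (L + 3) \<and> fst s' rd = 0 \<and> fst s' rlb = 0 \<and>
     (\<forall>x<m. snd s' aK x = snd s aNC x + snd s aCH x * (L + 3))) s"
proof -
  let ?b = "Assign rl (Plus (V rl) (Plus (V rL) (N 3)))"
  let ?c = "Assign rl (Rd aNC (V rx)) ;; For ry (Rd aCH (V rx)) ?b ;; Store aK (V rx) (V rl)"
  let ?d = "Assign rM (Plus (V rM) (Plus (V rL) (N 3)))"
  have inner: "wp (For ry (Rd aCH (V rx)) ?b) (\<lambda>t s'. t \<le> 15 * (W + 1) \<and> fst s' rl = v + snd s1 aCH x * (L + 3)) s1"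
    if s1: "fst s1 rL = L" "fst s1 rx = x" "snd s1 aCH x \<le> W" "fst s1 rl = v" for s1 x v
  proof (rule wp_For[where k = "snd s1 aCH x" and T = 6 and Inv = "\<lambda>j s'. fst s' rl = v + j * (L + 3)"], goal_cases fresh bound init body post)
    case (body j s')
    note j = body(2,4)
    have "fst s' rL = L" using frame_reg[OF j(1)] s1 by simp
    then show ?case
      using j(2) by (simp add: wp_simps)
  next
    case (bound s')
    show ?case using frame_reg[OF bound, of rx] frame_arr[OF bound, of aCH] s1 by simp
  next
    case (post t s')
    note t = post(1) and I = post(4)
    have "t \<le> (snd s1 aCH x + 1) * 15" using t by simp
    also have "\<dots> \<le> (W + 1) * 15" using s1(3) by (intro mult_le_mono1) simp
    finally show ?case using I by simp
  qed (use s1 in auto)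
  have F1: "wp (For rx (V rm) ?c) (\<lambda>t s'. t \<le> 32 * ((m + 1) * (W + 1)) \<and>
     (\<forall>x<m. snd s' aK x = snd s aNC x + snd s aCH x * (L + 3))) s"
  proof (rule wp_For[where k = m and T = "22 * (W + 1)" and Inv = "\<lambda>j s'. \<forall>x<j. snd s' aK x = snd s aNC x + snd s aCH x * (L + 3)"], goal_cases fresh bound init body post)
    case (body j s')
    note j = body(1,2,3) and I = body(4)
    have r: "fst s' rL = L" "snd s' aNC = snd s aNC" "snd s' aCH = snd s aCH"
      using frame_reg[OF j(2)] frame_arr[OF j(2)] regs by auto
    let ?s1 = "((fst s')(rl := snd s aNC j), snd s')"
    have "wp (For ry (Rd aCH (V rx)) ?b) (\<lambda>t s''. t \<le> 15 * (W + 1) \<and> fst s'' rl = snd s aNC j + snd ?s1 aCH j * (L + 3)) ?s1"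
      by (rule inner) (use r j ch[OF j(1)] k in auto)
    then have "wp (For ry (Rd aCH (V rx)) ?b) (\<lambda>u s''. wp (Store aK (V rx) (V rl)) (\<lambda>v s''. 3 + (u + v) \<le> 22 * (W + 1) \<and>
      (\<forall>x<Suc j. snd ((fst s'')(rx := Suc j), snd s'') aK x = snd s aNC x + snd s aCH x * (L + 3))) s'') ?s1"
    proof (rule wp_use, goal_cases step)
      case (step u s2)
      note 2 = step(1,2)
      have "fst s2 rx = j" "snd s2 aK = snd s' aK" using frame_reg[OF 2(2)] frame_arr[OF 2(2)] j by auto
      then show ?case
        using 2(1) I r by (auto simp: wp_simps less_Suc_eq)
    qed
    then show ?case
      using j(3) r by (simp add: wp_simps(2) wp_Seq)
  next
    case (bound s')
    show ?case using frame_reg[OF bound, of rm] regs by simp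
  next
    case (post t s')
    note t = post(1) and I = post(4)
    have "t \<le> 32 * ((m + 1) * (W + 1))" by (rule loop_bound[OF t]) auto
    then show ?case using I by simp
  qed auto
  have F2: "wp (For ry (V rnch) ?d) (\<lambda>t s'. t \<le> 14 * (W + 1) \<and> fst s' rM = k * (L + 3)) s1"
    if s1: "fst s1 rL = L" "fst s1 rnch = k" "fst s1 rM = 0" for s1
  proof (rule wp_For[where k = k and T = 6 and Inv = "\<lambda>j s'. fst s' rM = j * (L + 3)"], goal_cases fresh bound init body post)
    case (body j s')
    note j = body(2,4)
    have "fst s' rL = L" using frame_reg[OF j(1)] s1 by simp
    then show ?case
      using j(2) by (simp add: wp_simps)
  next
    case (bound s')
    show ?case using frame_reg[OF bound, of rnch] s1 by simp
  qed (use s1 k in auto)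
  show ?thesis
    unfolding BASE_def wp_Seq[of "For rx _ _"]
  proof (rule wp_use[OF F1], goal_cases step)
    case (step t s1)
    note 1 = step(1,2)
    let ?s2 = "((fst s1)(rM := 0), snd s1)"
    have "wp (For ry (V rnch) ?d) (\<lambda>t s'. t \<le> 14 * (W + 1) \<and> fst s' rM = k * (L + 3)) ?s2"
      by (rule F2) (use frame_reg[OF 1(2)] regs in auto)
    then have "wp (For ry (V rnch) ?d) (\<lambda>u s'. wp (Assign rd (N 0) ;; Assign rlb (N 0)) (\<lambda>v s''. t + (2 + (u + v)) \<le> 60 * ((m + 1) * (W + 1)) \<and>
       fst s'' rM = k * (L + 3) \<and> fst s'' rd = 0 \<and> fst s'' rlb = 0 \<and>
       (\<forall>x<m. snd s'' aK x = snd s aNC x + snd s aCH x * (L + 3))) s') ?s2"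
    proof (rule wp_use, goal_cases step)
      case (step u s')
      note 3 = step(1,2)
      have "snd s' aK = snd s1 aK" using frame_arr[OF 3(2)] by simp
      moreover have X: "t + (2 + (u + 4)) \<le> 60 * X" if "t \<le> 32 * X" "W + 1 \<le> X" for X
        using that conjunct1[OF 3(1)] by simp
      have "t + (2 + (u + 4)) \<le> 60 * ((m + 1) * (W + 1))" by (rule X) (use 1(1) in simp_all)
      ultimately show ?case
        using 1(1) 3(1) by (simp add: wp_simps)
    qed
    then show ?case
      unfolding wp_Seq[of "Assign rM _"] wp_Seq[of "For _ _ _"] wp_Assign by simp
  qed
qed

section \<open>Evaluation of formulas\<close>

abbreviation (input) "rmode \<equiv> 40::nat"
abbreviation (input) "rp \<equiv> 41::nat"
abbreviation (input) "rv \<equiv> 42::nat"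
abbreviation (input) "rh \<equiv> 43::nat"
abbreviation (input) "rdep \<equiv> 44::nat"
abbreviation (input) "rtok \<equiv> 45::nat"

abbreviation (input) "aEV \<equiv> 16::nat"
abbreviation (input) "aST \<equiv> 17::nat"
abbreviation (input) "aSP \<equiv> 18::nat"
abbreviation (input) "aSI \<equiv> 19::nat"
abbreviation (input) "aSA \<equiv> 20::nat"
abbreviation (input) "aSO \<equiv> 21::nat"

abbreviation (input) "arg1 \<equiv> Rd 0 (Plus (V rp) (N 1))"
abbreviation (input) "arg2 \<equiv> Rd 0 (Plus (V rp) (N 2))"
abbreviation (input) "tos \<equiv> Minus (V rh) (N 1)"

text \<open>In mode 0 the subformula at position \<open>rp\<close> is to be evaluated, in mode 1 its value \<open>rv\<close>
  is handed to the top frame of the stack, in mode 2 the quantifier in the top frame tries its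
  next candidate; mode 3 is final. The frames of the stack are spread over the arrays
  \<open>aST\<close> (operator, increased by 4 once the first operand is known), \<open>aSP\<close> (position),
  \<open>aSI\<close> (next candidate), \<open>aSA\<close> (accumulated value) and \<open>aSO\<close> (shadowed variable value).\<close>

definition ATOM :: com where
  "ATOM = If (V rtok)
     (If (Minus (V rtok) (N 1))
       (If (Neq (Rd 0 (Minus (Plus (V rcb) (Rd aEV arg2)) (N 1))) arg1) (Assign rv (N 0)) (Assign rv (N 1)))
       (Assign rv (LEq (Rd aEV arg1) (Rd aEV arg2))))
     (If (Neq (Rd aEV arg1) (Rd aEV arg2)) (Assign rv (N 0)) (Assign rv (N 1))) ;;
   Assign rp (Plus (V rp) (N 3)) ;; Assign rmode (N 1)"

text \<open>The initial accumulator \<open>rtok - 6\<close> is 0 for \<open>Ex\<close> and 1 for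
  \<open>All\<close>, the value of the quantifier over no candidates.\<close>

definition DOWN :: com where
  "DOWN = Assign rtok (Rd 0 (V rp)) ;;
     If (Minus (V rtok) (N 2))
       (If (Minus (V rtok) (N 5))
         (Store aST (V rh) (V rtok) ;; Store aSO (V rh) (Rd aEV arg1) ;; Store aSP (V rh) (V rp) ;;
          Store aSI (V rh) (N 0) ;; Store aSA (V rh) (Minus (V rtok) (N 6)) ;;
          Assign rh (Plus (V rh) (N 1)) ;; Assign rmode (N 2))
         (Store aST (V rh) (V rtok) ;; Assign rh (Plus (V rh) (N 1)) ;; Assign rp (Plus (V rp) (N 1))))
       ATOM"

text \<open>When the candidates are exhausted, \<open>rp\<close> still points behind the body, where
  its last evaluation left it. This is how the end of the quantified formula is found, and it
  requires every range to be nonempty.\<close>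

definition NEXT :: com where
  "NEXT = If (Minus (Rd aML (V rdep)) (Rd aSI tos))
     (Store aEV (Rd 0 (Plus (Rd aSP tos) (N 1))) (Rd aW (Rd aSI tos)) ;;
      Store aSI tos (Plus (Rd aSI tos) (N 1)) ;; Assign rp (Plus (Rd aSP tos) (N 2)) ;;
      Assign rdep (Plus (V rdep) (N 1)) ;; Assign rmode (N 0))
     (Store aEV (Rd 0 (Plus (Rd aSP tos) (N 1))) (Rd aSO tos) ;; Assign rv (Rd aSA tos) ;;
      Assign rh tos ;; Assign rmode (N 1))"

text \<open>There is no short-circuit evaluation: the second operand of a connective is located only
  by walking through the first, and the end of the formula by walking through the second.\<close>

definition UP :: com where
  "UP = If (V rh)
     (Assign rtok (Rd aST tos) ;;
      If (Minus (V rtok) (N 5))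
        (If (Minus (V rtok) (N 7))
          (If (Minus (V rtok) (N 8)) (If (Rd aSA tos) (Assign rv (N 1)) Skip)
             (If (Rd aSA tos) Skip (Assign rv (N 0))) ;; Assign rh tos)
          (If (Minus (V rtok) (N 6)) (If (V rv) Skip (Store aSA tos (N 0)))
             (If (V rv) (Store aSA tos (N 1)) Skip) ;;
           Assign rdep (Minus (V rdep) (N 1)) ;; Assign rmode (N 2)))
        (If (Minus (V rtok) (N 3))
          (Store aST tos (Plus (V rtok) (N 4)) ;; Store aSA tos (V rv) ;; Assign rmode (N 0))
          (Assign rv (Minus (N 1) (V rv)) ;; Assign rh tos)))
     (Assign rmode (N 3))"

definition BODY :: com where
  "BODY = If (V rmode) (If (Minus (V rmode) (N 1)) NEXT UP) DOWN"

definition EVAL :: com where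
  "EVAL = Assign rmode (N 0) ;; Assign rp (V rfb) ;; Assign rh (N 0) ;; Assign rdep (N 0) ;;
     While (Minus (N 3) (V rmode)) BODY ;; Assign 0 (V rv)"

lemma wregs_BODY [simp]: "wregs BODY = {rtok, rv, rp, rmode, rh, rdep}"
  and warrs_BODY [simp]: "warrs BODY = {aEV, aST, aSP, aSI, aSA, aSO}"
  by (auto simp: BODY_def NEXT_def UP_def DOWN_def ATOM_def)

inductive steps :: "state \<Rightarrow> nat \<Rightarrow> state \<Rightarrow> bool" where
  steps_refl: "steps s 0 s"
| steps_step: "fst s rmode < 3 \<Longrightarrow> exec BODY s t s' \<Longrightarrow> steps s' u s'' \<Longrightarrow> steps s (4 + t + u) s''"

lemma steps_trans: "steps s t s' \<Longrightarrow> steps s' u s'' \<Longrightarrow> steps s (t + u) s''"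
proof (induction rule: steps.induct)
  case (steps_step s t s' u s2)
  from steps.steps_step[OF steps_step.hyps(1,2) steps_step.IH[OF steps_step.prems]] show ?case
    by (simp add: add.assoc)
qed simp

lemma steps_While: "steps s t s' \<Longrightarrow> fst s' rmode = 3 \<Longrightarrow> exec (While (Minus (N 3) (V rmode)) BODY) s (t + 4) s'"
proof (induction rule: steps.induct)
  case (steps_refl s)
  then show ?case using exec.WhileFalse[of "Minus (N 3) (V rmode)" s BODY] by (simp add: numeral_eq_Suc)
next
  case (steps_step s t s' u s'')
  then show ?case using exec.WhileTrue[of "Minus (N 3) (V rmode)" s BODY t s' "u + 4" s'']
    by (simp add: numeral_eq_Suc)
qed

lemma steps_frame: "steps s t s' \<Longrightarrow> frame BODY s s'"
proof (induction rule: steps.induct)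
  case (steps_step s t s' u s'')
  then show ?case using exec_frame[OF steps_step.hyps(2)] unfolding frame_def by metis
qed (simp add: frame_def)

definition reach :: "nat \<Rightarrow> (state \<Rightarrow> bool) \<Rightarrow> state \<Rightarrow> bool" where
  "reach k Q s \<longleftrightarrow> (\<exists>t s'. steps s t s' \<and> t \<le> k \<and> Q s')"

lemma reach_refl: "Q s \<Longrightarrow> reach k Q s"
  unfolding reach_def using steps_refl by blast

text \<open>The guard of the main loop costs 4 and a round of \<open>BODY\<close> is allowed 96, so
  time is counted in units of 100.\<close>

lemma reach_step:
  assumes "fst s rmode < 3" "wp BODY (\<lambda>t s'. t \<le> 96 \<and> reach k Q s') s"
  shows "reach (100 + k) Q s"
proof -
  obtain t s' where 1: "exec BODY s t s'" "t \<le> 96" "reach k Q s'" using assms(2) by (auto elim: wpE)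
  then obtain u s'' where 2: "steps s' u s''" "u \<le> k" "Q s''" unfolding reach_def by blast
  have "4 + t + u \<le> 100 + k" using 1(2) 2(2) by simp
  then show ?thesis unfolding reach_def using steps_step[OF assms(1) 1(1) 2(1)] 2(3) by blast
qed

lemma reach_trans:
  assumes "reach k P s" "\<And>s'. P s' \<Longrightarrow> frame BODY s s' \<Longrightarrow> reach l Q s'"
  shows "reach (k + l) Q s"
proof -
  obtain t s' where 1: "steps s t s'" "t \<le> k" "P s'" using assms(1) unfolding reach_def by blast
  with assms(2) steps_frame obtain u s'' where 2: "steps s' u s''" "u \<le> l" "Q s''" unfolding reach_def by meson
  have "t + u \<le> k + l" using 1(2) 2(2) by simp
  then show ?thesis unfolding reach_def using steps_trans[OF 1(1) 2(1)] 2(3) by blast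
qed

lemma reach_mono: "reach k P s \<Longrightarrow> k \<le> l \<Longrightarrow> (\<And>s'. P s' \<Longrightarrow> Q s') \<Longrightarrow> reach l Q s"
  unfolding reach_def by (meson le_trans)

definition code_at :: "nat \<Rightarrow> nat list \<Rightarrow> state \<Rightarrow> bool" where
  "code_at p xs s \<longleftrightarrow> (\<forall>i<length xs. snd s 0 (p + i) = xs ! i)"

lemma code_at_Cons: "code_at p (x # xs) s \<longleftrightarrow> snd s 0 p = x \<and> code_at (p + 1) xs s"
  unfolding code_at_def by (auto simp: nth_Cons less_Suc_eq_0_disj split: nat.splits)

lemma code_at_append: "code_at p (xs @ ys) s \<Longrightarrow> code_at p xs s \<and> code_at (p + length xs) ys s"
  unfolding code_at_def by (auto simp: nth_append add.assoc)

lemma code_at_cong: "code_at p xs s \<Longrightarrow> snd s' 0 = snd s 0 \<Longrightarrow> code_at p xs s'"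
  by (simp add: code_at_def)

definition same_stack :: "nat \<Rightarrow> state \<Rightarrow> state \<Rightarrow> bool" where
  "same_stack h s s' \<longleftrightarrow> (\<forall>i<h. snd s' aST i = snd s aST i \<and> snd s' aSP i = snd s aSP i \<and>
     snd s' aSI i = snd s aSI i \<and> snd s' aSA i = snd s aSA i \<and> snd s' aSO i = snd s aSO i)"

fun eval_time :: "nat \<Rightarrow> 'c fm \<Rightarrow> nat" where
  "eval_time Z (Neg \<phi>) = 200 + eval_time Z \<phi>"
| "eval_time Z (And \<phi> \<psi>) = 300 + eval_time Z \<phi> + eval_time Z \<psi>"
| "eval_time Z (Or \<phi> \<psi>) = 300 + eval_time Z \<phi> + eval_time Z \<psi>"
| "eval_time Z (Ex x \<phi>) = 200 + Z * (200 + eval_time Z \<phi>)"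
| "eval_time Z (All x \<phi>) = 200 + Z * (200 + eval_time Z \<phi>)"
| "eval_time Z _ = 100"

locale evaluator =
  fixes m :: nat and le :: "nat \<Rightarrow> nat \<Rightarrow> bool" and col :: "nat \<Rightarrow> nat" and cb L Z :: nat and Q :: "nat \<Rightarrow> nat set"
  assumes Q: "\<And>i. i < L \<Longrightarrow> Q i \<noteq> {} \<and> Q i \<subseteq> {0<..<m - 1}"
begin

definition static :: "state \<Rightarrow> bool" where
  "static s \<longleftrightarrow> order_stored m le s \<and> fst s rcb = cb \<and> (\<forall>x\<in>{0<..<m - 1}. snd s 0 (cb + x - 1) = col x) \<and>
     (\<forall>i<L. snd s aML i \<le> Z \<and> snd s aW ` {..<snd s aML i} = Q i)"

lemma static_frame: "static s \<Longrightarrow> frame BODY s s' \<Longrightarrow> static s'"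
  using order_stored_cong[of m le s s'] unfolding static_def by (simp add: frame_reg frame_arr)

abbreviation "R \<equiv> {(x, y). le x y}"

definition goal :: "nat fm \<Rightarrow> nat \<Rightarrow> nat \<Rightarrow> nat \<Rightarrow> state \<Rightarrow> state \<Rightarrow> bool" where
  "goal \<phi> p h dep s s' \<longleftrightarrow> fst s' rmode = 1 \<and> fst s' rp = p + length (encode_fm \<phi>) \<and> fst s' rh = h \<and> fst s' rdep = dep \<and>
     fst s' rv = of_bool (qsat Q R col dep (snd s aEV) \<phi>) \<and> snd s' aEV = snd s aEV \<and> same_stack h s s'"

definition start :: "nat fm \<Rightarrow> nat \<Rightarrow> nat \<Rightarrow> nat \<Rightarrow> state \<Rightarrow> bool" where
  "start \<phi> p h dep s \<longleftrightarrow> static s \<and> code_at p (encode_fm \<phi>) s \<and> fst s rmode = 0 \<and> fst s rp = p \<and> fst s rh = h \<and> fst s rdep = dep \<and>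
     qrank \<phi> + dep \<le> L \<and> (\<forall>v\<in>free_vars \<phi>. snd s aEV v \<in> {0<..<m - 1})"

lemma reach_atom:
  assumes "start \<phi> p h dep s" "atomic \<phi>"
  shows "reach 100 (goal \<phi> p h dep s) s"
proof -
  from assms(1) have st: "static s" "code_at p (encode_fm \<phi>) s" "fst s rmode = 0" "fst s rp = p" "fst s rh = h" "fst s rdep = dep"
    "\<And>v. v \<in> free_vars \<phi> \<Longrightarrow> 0 < snd s aEV v \<and> snd s aEV v < m - 1"
    by (auto simp: start_def)
  have G: "order_stored m le ((fst s)(rtok := v), snd s)" for v
    by (rule order_stored_cong[of _ _ s]) (use st(1) in \<open>auto simp: static_def\<close>)
  have "wp BODY (\<lambda>t s'. t \<le> 96 \<and> goal \<phi> p h dep s s') s"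
  proof (cases \<phi>)
    case (Eq x y)
    then show ?thesis using st
      by (simp add: BODY_def DOWN_def ATOM_def wp_simps code_at_Cons goal_def same_stack_def)
  next
    case (Leq x y)
    then have xy: "snd s aEV x < m" "snd s aEV y < m" using st(7)[of x] st(7)[of y] by auto
    have tok: "snd s 0 p = 1" "snd s 0 (p + 1) = x" "snd s 0 (p + 2) = y" using st(2) Leq by (simp_all add: code_at_Cons)
    have "aval (LEq (Rd aEV arg1) (Rd aEV arg2)) ((fst s)(rtok := Suc 0), snd s) = of_bool (le (snd s aEV x) (snd s aEV y))"
      using aval_LEq[OF G, of "Rd aEV arg1" _ "Rd aEV arg2"] xy tok st(4) by simp
    then show ?thesis using Leq st tok
      by (simp add: BODY_def DOWN_def ATOM_def wp_simps goal_def same_stack_def)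
  next
    case (Color c x)
    then have "snd s 0 (cb + snd s aEV x - 1) = col (snd s aEV x)" "fst s rcb = cb"
      using st(1) st(7)[of x] by (auto simp: static_def)
    then show ?thesis using Color st
      by (auto simp: BODY_def DOWN_def ATOM_def wp_simps code_at_Cons goal_def same_stack_def)
  qed (use assms(2) in auto)
  then have "wp BODY (\<lambda>t s'. t \<le> 96 \<and> reach 0 (goal \<phi> p h dep s) s') s"
    by (rule wp_mono) (auto intro: reach_refl)
  then show ?thesis using reach_step[of s 0] st(3) by simp
qed

lemma reach_Neg:
  assumes IH: "\<And>p h dep s. start \<phi> p h dep s \<Longrightarrow> reach (eval_time Z \<phi>) (goal \<phi> p h dep s) s"
    and s: "start (Neg \<phi>) p h dep s"
  shows "reach (eval_time Z (Neg \<phi>)) (goal (Neg \<phi>) p h dep s) s"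
proof -
  from s have st: "static s" "code_at p (3 # encode_fm \<phi>) s" "fst s rmode = 0" "fst s rp = p" "fst s rh = h" "fst s rdep = dep"
    "\<And>v. v \<in> free_vars \<phi> \<Longrightarrow> snd s aEV v \<in> {0<..<m - 1}" "qrank \<phi> + dep \<le> L"
    by (auto simp: start_def)
  have "wp BODY (\<lambda>t s'. t \<le> 96 \<and> reach (eval_time Z \<phi> + (100 + 0)) (goal (Neg \<phi>) p h dep s) s') s"
  proof (rule wp_use)
    let ?P = "\<lambda>t s'. t \<le> 96 \<and> fst s' rmode = 0 \<and> fst s' rp = p + 1 \<and> fst s' rh = h + 1 \<and> fst s' rdep = dep \<and>
      snd s' aEV = snd s aEV \<and> same_stack h s s' \<and> snd s' aST h = 3"
    show "wp BODY ?P s"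
      using st by (simp add: BODY_def DOWN_def wp_simps code_at_Cons same_stack_def)
    fix t s' assume 1: "?P t s'" and f: "frame BODY s s'"
    have "start \<phi> (p + 1) (h + 1) dep s'"
      unfolding start_def using 1 st static_frame[OF st(1) f] frame_arr[OF f, of 0] by (auto simp: code_at_Cons code_at_def)
    from IH[OF this] have "reach (eval_time Z \<phi> + (100 + 0)) (goal (Neg \<phi>) p h dep s) s'"
    proof (rule reach_trans, goal_cases step)
      case (step s2)
      note 2 = step(1)
      then have "snd s2 aST h = 3" using 1 by (simp add: goal_def same_stack_def)
      then have "wp BODY (\<lambda>t s3. t \<le> 96 \<and> goal (Neg \<phi>) p h dep s s3) s2"
        using 1 2 by (simp add: BODY_def UP_def wp_simps goal_def same_stack_def split: split_of_bool)
      then show ?case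
        using 2 by (intro reach_step) (auto simp: goal_def elim!: wp_mono intro: reach_refl)
    qed
    then show "t \<le> 96 \<and> reach (eval_time Z \<phi> + (100 + 0)) (goal (Neg \<phi>) p h dep s) s'" using 1 by blast
  qed
  then have "reach (100 + (eval_time Z \<phi> + (100 + 0))) (goal (Neg \<phi>) p h dep s) s"
    using st(3) by (intro reach_step) auto
  then show ?thesis by (simp add: add.commute)
qed

lemma reach_binary:
  fixes tok :: nat
  assumes IH: "\<And>p h dep s. start \<phi> p h dep s \<Longrightarrow> reach (eval_time Z \<phi>) (goal \<phi> p h dep s) s"
      "\<And>p h dep s. start \<psi> p h dep s \<Longrightarrow> reach (eval_time Z \<psi>) (goal \<psi> p h dep s) s"
    and \<chi>: "\<chi> = And \<phi> \<psi> \<and> tok = 4 \<or> \<chi> = Or \<phi> \<psi> \<and> tok = 5"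
    and s: "start \<chi> p h dep s"
  shows "reach (300 + eval_time Z \<phi> + eval_time Z \<psi>) (goal \<chi> p h dep s) s"
proof -
  from s \<chi> have st: "static s" "code_at p (tok # encode_fm \<phi> @ encode_fm \<psi>) s" "fst s rmode = 0" "fst s rp = p" "fst s rh = h" "fst s rdep = dep"
    "\<And>v. v \<in> free_vars \<phi> \<union> free_vars \<psi> \<Longrightarrow> snd s aEV v \<in> {0<..<m - 1}" "qrank \<phi> + dep \<le> L" "qrank \<psi> + dep \<le> L"
    by (auto simp: start_def)
  have code: "snd s 0 p = tok" "code_at (p + 1) (encode_fm \<phi>) s" "code_at (p + 1 + length (encode_fm \<phi>)) (encode_fm \<psi>) s"
    using st(2) code_at_append unfolding code_at_Cons by blast+
  have "wp BODY (\<lambda>t s'. t \<le> 96 \<and> reach (eval_time Z \<phi> + (100 + (eval_time Z \<psi> + (100 + 0)))) (goal \<chi> p h dep s) s') s"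
  proof (rule wp_use)
    let ?P = "\<lambda>t s'. t \<le> 96 \<and> fst s' rmode = 0 \<and> fst s' rp = p + 1 \<and> fst s' rh = h + 1 \<and> fst s' rdep = dep \<and>
      snd s' aEV = snd s aEV \<and> same_stack h s s' \<and> snd s' aST h = tok"
    show "wp BODY ?P s"
      using st code \<chi> by (auto simp: BODY_def DOWN_def wp_simps same_stack_def)
    fix t s1 assume 1: "?P t s1" and f1: "frame BODY s s1"
    have st1: "static s1" using static_frame[OF st(1) f1] .
    have inp1: "snd s1 0 = snd s 0" using frame_arr[OF f1] by simp
    have "start \<phi> (p + 1) (h + 1) dep s1"
      unfolding start_def using 1 st st1 code_at_cong[OF code(2) inp1] by auto
    from IH(1)[OF this] have "reach (eval_time Z \<phi> + (100 + (eval_time Z \<psi> + (100 + 0)))) (goal \<chi> p h dep s) s1"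
    proof (rule reach_trans, goal_cases step)
      case (step s2)
      note 2 = step(1) and f2 = step(2)
      have tok2: "snd s2 aST h = tok" using 1 2 by (simp add: goal_def same_stack_def)
      have st2: "static s2" using static_frame[OF st1 f2] .
      have inp2: "snd s2 0 = snd s 0" using frame_arr[OF f2] inp1 by simp
      have "wp BODY (\<lambda>t s'. t \<le> 96 \<and> reach (eval_time Z \<psi> + (100 + 0)) (goal \<chi> p h dep s) s') s2"
      proof (rule wp_use)
        let ?P = "\<lambda>t s'. t \<le> 96 \<and> fst s' rmode = 0 \<and> fst s' rp = p + 1 + length (encode_fm \<phi>) \<and> fst s' rh = h + 1 \<and> fst s' rdep = dep \<and>
          snd s' aEV = snd s aEV \<and> same_stack h s s' \<and> snd s' aST h = tok + 4 \<and>
          snd s' aSA h = of_bool (qsat Q R col dep (snd s aEV) \<phi>)"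
        show "wp BODY ?P s2"
          using 1 2 tok2 \<chi> by (auto simp: BODY_def UP_def wp_simps goal_def same_stack_def)
        fix t s3 assume 3: "?P t s3" and f3: "frame BODY s2 s3"
        have inp3: "snd s3 0 = snd s 0" using frame_arr[OF f3] inp2 by simp
        have "start \<psi> (p + 1 + length (encode_fm \<phi>)) (h + 1) dep s3"
          unfolding start_def using 3 st static_frame[OF st2 f3] code_at_cong[OF code(3) inp3] by auto
        from IH(2)[OF this] have "reach (eval_time Z \<psi> + (100 + 0)) (goal \<chi> p h dep s) s3"
        proof (rule reach_trans, goal_cases step)
          case (step s4)
          note 4 = step(1)
          have "snd s4 aST h = tok + 4" "snd s4 aSA h = of_bool (qsat Q R col dep (snd s aEV) \<phi>)"
            using 3 4 by (auto simp: goal_def same_stack_def)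
          then have "wp BODY (\<lambda>t s5. t \<le> 96 \<and> goal \<chi> p h dep s s5) s4"
            using 3 4 \<chi> by (auto simp: BODY_def UP_def wp_simps goal_def same_stack_def split: split_of_bool)
          then show ?case
            using 4 by (intro reach_step) (auto simp: goal_def elim!: wp_mono intro: reach_refl)
        qed
        then show "t \<le> 96 \<and> reach (eval_time Z \<psi> + (100 + 0)) (goal \<chi> p h dep s) s3" using 3 by blast
      qed
      then show ?case
        using 2 by (intro reach_step) (auto simp: goal_def)
    qed
    then show "t \<le> 96 \<and> reach (eval_time Z \<phi> + (100 + (eval_time Z \<psi> + (100 + 0)))) (goal \<chi> p h dep s) s1" using 1 by blast
  qed
  then have "reach (100 + (eval_time Z \<phi> + (100 + (eval_time Z \<psi> + (100 + 0))))) (goal \<chi> p h dep s) s"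
    using st(3) by (intro reach_step) auto
  then show ?thesis by (rule reach_mono) auto
qed

definition qacc :: "bool \<Rightarrow> (nat \<Rightarrow> bool) \<Rightarrow> nat \<Rightarrow> bool" where
  "qacc ex P i = (if ex then \<exists>j<i. P j else \<forall>j<i. P j)"

lemma qacc_Suc: "qacc ex P (Suc i) = (if ex then qacc ex P i \<or> P i else qacc ex P i \<and> P i)"
  by (auto simp: qacc_def less_Suc_eq)

text \<open>\<open>s0\<close> is the state in which the quantifier was met. The environment may
  differ from that of \<open>s0\<close> only at \<open>x\<close>, whose old value waits in
  \<open>aSO\<close>; restoring it on exit makes the evaluation correct even if an outer quantifier
  binds the same variable.\<close>

lemma reach_loop:
  fixes P :: "nat \<Rightarrow> bool" and G :: "nat \<Rightarrow> bool \<Rightarrow> state \<Rightarrow> bool"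
  assumes IH: "\<And>p h dep s. start \<phi> p h dep s \<Longrightarrow> reach (eval_time Z \<phi>) (goal \<phi> p h dep s) s"
    and code: "snd s0 0 (p + 1) = x" "code_at (p + 2) (encode_fm \<phi>) s0"
    and dep: "Suc (qrank \<phi>) + dep \<le> L"
    and fv: "\<And>v. v \<in> free_vars \<phi> - {x} \<Longrightarrow> snd s0 aEV v \<in> {0<..<m - 1}"
    and lim: "snd s0 aML dep = k"
  defines "P \<equiv> \<lambda>j. qsat Q R col (Suc dep) ((snd s0 aEV)(x := snd s0 aW j)) \<phi>"
    and "G \<equiv> \<lambda>h ex s'. fst s' rmode = 1 \<and> fst s' rp = p + 2 + length (encode_fm \<phi>) \<and>
     fst s' rh = h \<and> fst s' rdep = dep \<and> fst s' rv = of_bool (qacc ex P k) \<and> snd s' aEV = snd s0 aEV \<and> same_stack h s0 s'"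
  shows "\<lbrakk>static s; frame BODY s0 s; fst s rmode = 2; fst s rh = Suc h; fst s rdep = dep; same_stack h s0 s;
     snd s aST h = (if ex then 6 else 7); snd s aSP h = p; snd s aSI h = i; snd s aSA h = of_bool (qacc ex P i);
     snd s aSO h = snd s0 aEV x; (snd s aEV)(x := snd s0 aEV x) = snd s0 aEV; i \<le> k;
     i = k \<Longrightarrow> fst s rp = p + 2 + length (encode_fm \<phi>)\<rbrakk> \<Longrightarrow>
   reach (100 + (k - i) * (200 + eval_time Z \<phi>)) (G h ex) s"
proof (induction "k - i" arbitrary: i s)
  case 0
  have arr: "snd s 0 = snd s0 0" "snd s aML = snd s0 aML" using frame_arr[OF 0(3)] by auto
  have ik: "i = k" using 0 by simp
  then have rp: "fst s rp = p + 2 + length (encode_fm \<phi>)" using 0 by simp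
  have "wp BODY (\<lambda>t s'. t \<le> 96 \<and> (G h ex) s') s"
    using 0(4-12) rp ik arr code lim by (simp add: G_def BODY_def NEXT_def wp_simps same_stack_def) (rule 0(13))
  then have "reach (100 + 0) (G h ex) s"
    using 0(4) by (intro reach_step) (auto elim!: wp_mono intro: reach_refl)
  then show ?case using ik by simp
next
  case (Suc r)
  have arr: "snd s 0 = snd s0 0" "snd s aML = snd s0 aML" "snd s aW = snd s0 aW" using frame_arr[OF Suc(4)] by auto
  have ik: "i < k" using Suc(2) by simp
  have "wp BODY (\<lambda>t s'. t \<le> 96 \<and> reach (eval_time Z \<phi> + (100 + (100 + (k - Suc i) * (200 + eval_time Z \<phi>)))) (G h ex) s') s"
  proof (rule wp_use)
    let ?P = "\<lambda>t s'. t \<le> 96 \<and> fst s' rmode = 0 \<and> fst s' rp = p + 2 \<and> fst s' rh = Suc h \<and> fst s' rdep = Suc dep \<and>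
      same_stack h s0 s' \<and> snd s' aST h = (if ex then 6 else 7) \<and> snd s' aSP h = p \<and> snd s' aSI h = Suc i \<and>
      snd s' aSA h = of_bool (qacc ex P i) \<and> snd s' aSO h = snd s0 aEV x \<and> snd s' aEV = (snd s aEV)(x := snd s0 aW i)"
    show "wp BODY ?P s"
      using Suc(3-14) ik arr code lim by (simp add: BODY_def NEXT_def wp_simps same_stack_def)
    fix t s1 assume 1: "?P t s1"
      and f1: "frame BODY s s1"
    have ev: "snd s1 aEV = (snd s0 aEV)(x := snd s0 aW i)"
      using 1 Suc(14) by (metis fun_upd_upd)
    have st1: "static s1" using static_frame[OF Suc(3) f1] .
    have inp1: "snd s1 0 = snd s0 0" using frame_arr[OF f1] arr by simp
    have "snd s0 aW i \<in> Q dep"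
      using Suc(3) dep arr lim ik unfolding static_def by (metis Suc_le_lessD add_Suc image_eqI le_add2 lessThan_iff le_trans Suc_leI order_le_less_trans)
    then have "snd s0 aW i \<in> {0<..<m - 1}" using Q[of dep] dep by auto
    then have env: "\<forall>v\<in>free_vars \<phi>. snd s1 aEV v \<in> {0<..<m - 1}" unfolding ev using fv by auto
    have "fst s1 rmode = 0" "fst s1 rp = p + 2" "fst s1 rh = Suc h" "fst s1 rdep = Suc dep" using 1 by blast+
    then have "start \<phi> (p + 2) (Suc h) (Suc dep) s1"
      unfolding start_def using st1 code_at_cong[OF code(2) inp1] dep env by simp
    from IH[OF this] have "reach (eval_time Z \<phi> + (100 + (100 + (k - Suc i) * (200 + eval_time Z \<phi>)))) (G h ex) s1"
    proof (rule reach_trans, goal_cases step)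
      case (step s2)
      note 2 = step(1) and f2 = step(2)
      have stk: "same_stack h s0 s2" "snd s2 aST h = (if ex then 6 else 7)" "snd s2 aSP h = p" "snd s2 aSI h = Suc i"
        "snd s2 aSA h = of_bool (qacc ex P i)" "snd s2 aSO h = snd s0 aEV x"
        using 1 2 by (auto simp: goal_def same_stack_def)
      have v: "fst s2 rv = of_bool (P i)" using 2 ev by (simp add: goal_def P_def)
      have "wp BODY (\<lambda>t s'. t \<le> 96 \<and> reach (100 + (k - Suc i) * (200 + eval_time Z \<phi>)) (G h ex) s') s2"
      proof (rule wp_use)
        let ?P = "\<lambda>t s'. t \<le> 96 \<and> fst s' rmode = 2 \<and> fst s' rh = Suc h \<and> fst s' rdep = dep \<and> same_stack h s0 s' \<and>
          snd s' aST h = (if ex then 6 else 7) \<and> snd s' aSP h = p \<and> snd s' aSI h = Suc i \<and>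
          snd s' aSA h = of_bool (qacc ex P (Suc i)) \<and> snd s' aSO h = snd s0 aEV x \<and> snd s' aEV = snd s2 aEV \<and>
          fst s' rp = p + 2 + length (encode_fm \<phi>)"
        show "wp BODY ?P s2"
        proof -
          have regs: "fst s2 rmode = 1" "fst s2 rp = p + 2 + length (encode_fm \<phi>)" "fst s2 rh = Suc h" "fst s2 rdep = Suc dep"
            using 2 unfolding goal_def by blast+
          show ?thesis using regs stk(2-6) stk(1)[unfolded same_stack_def] v
            by (cases ex; cases "P i"; cases "qacc ex P i") (simp_all add: BODY_def UP_def wp_simps same_stack_def qacc_Suc)
        qed
        fix t s3 assume 3: "?P t s3" and f3: "frame BODY s2 s3"
        have f03: "frame BODY s0 s3" using Suc(4) f1 f2 f3 unfolding frame_def by metis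
        have st3: "static s3" using static_frame[OF static_frame[OF st1 f2] f3] .
        have "snd s3 aEV = (snd s0 aEV)(x := snd s0 aW i)" using 3 2 ev by (simp add: goal_def)
        then have "(snd s3 aEV)(x := snd s0 aEV x) = snd s0 aEV" by simp
        then have "reach (100 + (k - Suc i) * (200 + eval_time Z \<phi>)) (G h ex) s3"
          using 3 ik Suc(2) f03 st3 by (intro Suc.hyps(1)) auto
        then show "t \<le> 96 \<and> reach (100 + (k - Suc i) * (200 + eval_time Z \<phi>)) (G h ex) s3" using 3 by blast
      qed
      then show ?case
        using 2 by (intro reach_step) (auto simp: goal_def)
    qed
    then show "t \<le> 96 \<and> reach (eval_time Z \<phi> + (100 + (100 + (k - Suc i) * (200 + eval_time Z \<phi>)))) (G h ex) s1" using 1 by blast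
  qed
  then have *: "reach (100 + (eval_time Z \<phi> + (100 + (100 + (k - Suc i) * (200 + eval_time Z \<phi>))))) (G h ex) s"
    using Suc(5) by (intro reach_step) auto
  have "k - i = Suc (k - Suc i)" using ik by simp
  then have "100 + (k - i) * (200 + eval_time Z \<phi>) = 100 + (eval_time Z \<phi> + (100 + (100 + (k - Suc i) * (200 + eval_time Z \<phi>))))" by simp
  with * show ?case by simp
qed

lemma reach_quantifier:
  assumes IH: "\<And>p h dep s. start \<phi> p h dep s \<Longrightarrow> reach (eval_time Z \<phi>) (goal \<phi> p h dep s) s"
    and \<chi>: "\<chi> = (if ex then Ex x \<phi> else All x \<phi>)"
    and s: "start \<chi> p h dep s"
  shows "reach (200 + Z * (200 + eval_time Z \<phi>)) (goal \<chi> p h dep s) s"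
proof -
  define tok where "tok = (if ex then 6 else 7::nat)"
  from s \<chi> have st: "static s" "code_at p (tok # x # encode_fm \<phi>) s" "fst s rmode = 0" "fst s rp = p" "fst s rh = h" "fst s rdep = dep"
    "\<And>v. v \<in> free_vars \<phi> - {x} \<Longrightarrow> snd s aEV v \<in> {0<..<m - 1}" "Suc (qrank \<phi>) + dep \<le> L"
    by (auto simp: start_def tok_def split: if_splits)
  have code: "snd s 0 p = tok" "snd s 0 (p + 1) = x" "code_at (p + 2) (encode_fm \<phi>) s"
    using st(2) unfolding code_at_Cons by (simp_all add: numeral_2_eq_2)
  let ?k = "snd s aML dep"
  have k: "?k \<le> Z" "snd s aW ` {..<?k} = Q dep" using st(1,8) by (auto simp: static_def)
  \<comment> \<open>At least one candidate is tried, so \<open>rp\<close> gets past the body;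
    otherwise the premise of \<open>reach_loop\<close> for \<open>i = k\<close> would have to hold
    at the start.\<close>
  then have k0: "0 < ?k" using Q[of dep] st(8) by (cases ?k) auto
  define P where "P = (\<lambda>j. qsat Q R col (Suc dep) ((snd s aEV)(x := snd s aW j)) \<phi>)"
  let ?G = "\<lambda>s'. fst s' rmode = 1 \<and> fst s' rp = p + 2 + length (encode_fm \<phi>) \<and>
     fst s' rh = h \<and> fst s' rdep = dep \<and> fst s' rv = of_bool (qacc ex P ?k) \<and> snd s' aEV = snd s aEV \<and> same_stack h s s'"
  have sem: "qacc ex P ?k \<longleftrightarrow> qsat Q R col dep (snd s aEV) \<chi>"
    unfolding \<chi> qacc_def P_def by (auto simp: k(2)[symmetric])
  have "wp BODY (\<lambda>t s'. t \<le> 96 \<and> reach (100 + (?k - 0) * (200 + eval_time Z \<phi>)) ?G s') s"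
  proof (rule wp_use)
    let ?P = "\<lambda>t s'. t \<le> 96 \<and> fst s' rmode = 2 \<and> fst s' rh = Suc h \<and> fst s' rdep = dep \<and> same_stack h s s' \<and>
      snd s' aST h = tok \<and> snd s' aSP h = p \<and> snd s' aSI h = 0 \<and> snd s' aSA h = tok - 6 \<and> snd s' aSO h = snd s aEV x \<and>
      snd s' aEV = snd s aEV"
    show "wp BODY ?P s"
      using st code by (cases ex) (simp_all add: BODY_def DOWN_def wp_simps same_stack_def tok_def)
    fix t s1 assume 1: "?P t s1" and f: "frame BODY s s1"
    have "reach (100 + (?k - 0) * (200 + eval_time Z \<phi>)) ?G s1"
      unfolding P_def
      by (rule reach_loop[OF IH code(2,3) st(8,7) HOL.refl static_frame[OF st(1) f] f])
        (use 1 k0 in \<open>auto simp: tok_def qacc_def\<close>)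
    then show "t \<le> 96 \<and> reach (100 + (?k - 0) * (200 + eval_time Z \<phi>)) ?G s1" using 1 by blast
  qed
  then have "reach (100 + (100 + (?k - 0) * (200 + eval_time Z \<phi>))) ?G s"
    using st(3) by (intro reach_step) auto
  then show ?thesis
    by (rule reach_mono) (use k(1) sem in \<open>auto simp: goal_def \<chi>\<close>)
qed

lemma reach_eval: "start \<phi> p h dep s \<Longrightarrow> reach (eval_time Z \<phi>) (goal \<phi> p h dep s) s"
proof (induction \<phi> arbitrary: p h dep s)
  case (Neg \<phi>)
  show ?case by (rule reach_Neg[OF Neg])
next
  case (And \<phi> \<psi>)
  show ?case using reach_binary[OF And.IH _ And.prems, of 4] by simp
next
  case (Or \<phi> \<psi>)
  show ?case using reach_binary[OF Or.IH _ Or.prems, of 5] by simp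
next
  case (Ex x \<phi>)
  show ?case using reach_quantifier[OF Ex.IH _ Ex.prems, of True] by simp
next
  case (All x \<phi>)
  show ?case using reach_quantifier[OF All.IH _ All.prems, of False] by simp
qed (auto intro: reach_atom)

lemma wp_EVAL:
  assumes s: "static s" "fst s rfb = p" "code_at p (encode_fm \<phi>) s" and \<phi>: "qrank \<phi> \<le> L" "free_vars \<phi> = {}"
  shows "wp EVAL (\<lambda>t s'. t \<le> 120 + eval_time Z \<phi> \<and> fst s' 0 = of_bool (qsat Q R col 0 (snd s aEV) \<phi>)) s"
proof -
  let ?s1 = "((fst s)(rmode := 0, rp := p, rh := 0, rdep := 0), snd s)"
  have "static ?s1" using s(1) order_stored_cong[of m le s ?s1] by (simp add: static_def)
  then have "start \<phi> p 0 0 ?s1" using s \<phi> by (simp add: start_def code_at_def)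
  from reach_eval[OF this] have "reach (eval_time Z \<phi> + (100 + 0)) (\<lambda>s'. fst s' rmode = 3 \<and>
      fst s' rv = of_bool (qsat Q R col 0 (snd s aEV) \<phi>)) ?s1"
  proof (rule reach_trans, goal_cases step)
    case (step s2)
    note 2 = step(1)
    then have "wp BODY (\<lambda>t s'. t \<le> 96 \<and> fst s' rmode = 3 \<and> fst s' rv = of_bool (qsat Q R col 0 (snd s aEV) \<phi>)) s2"
      by (simp add: BODY_def UP_def wp_simps goal_def)
    then show ?case
      using 2 by (intro reach_step) (auto simp: goal_def elim!: wp_mono intro: reach_refl)
  qed
  then obtain t s' where 1: "steps ?s1 t s'" "t \<le> eval_time Z \<phi> + 100" "fst s' rmode = 3"
    "fst s' rv = of_bool (qsat Q R col 0 (snd s aEV) \<phi>)" unfolding reach_def by auto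
  have "wp (While (Minus (N 3) (V rmode)) BODY) (\<lambda>t s'. t + 10 \<le> 120 + eval_time Z \<phi> \<and>
      fst s' rv = of_bool (qsat Q R col 0 (snd s aEV) \<phi>)) ?s1"
    by (rule wpI[OF steps_While[OF 1(1,3)]]) (use 1 in auto)
  then show ?thesis unfolding EVAL_def using s(2)
    by (simp add: wp_simps(2) wp_Seq)
qed

end

section \<open>The model checking program\<close>

lemma levels_stored_bound: "levels_stored m le M0 \<kappa>0 k s Mf \<kappa> cls \<Longrightarrow> Mf k \<le> class_bound M0 k"
  unfolding levels_stored_def by blast

lemma levels_stored_qsat:
  assumes LI: "levels_stored m le M0 \<kappa>0 L s Mf \<kappa> cls" and m: "3 \<le> m"
    and col: "\<And>x y c. x \<in> {0<..<m - 1} \<Longrightarrow> y \<in> {0<..<m - 1} \<Longrightarrow> \<kappa>0 x = \<kappa>0 y \<Longrightarrow> c \<in> \<Lambda> \<Longrightarrow> col x = c \<longleftrightarrow> col y = c"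
  defines "W \<equiv> \<lambda>i. set (candidates (class_funs le m cls (Mf L)) (depth L) i)"
  shows "clean m ` W (Suc i) \<subseteq> {0<..<m - 1}" "clean m ` W (Suc i) \<noteq> {}"
    "qrank \<phi> \<le> L \<Longrightarrow> set_fm \<phi> \<subseteq> \<Lambda> \<Longrightarrow> free_vars \<phi> = {} \<Longrightarrow>
      qsat (\<lambda>i. clean m ` W (Suc i)) {(x, y). le x y} col 0 e \<phi> \<longleftrightarrow> sat {0<..<m - 1} {(x, y). le x y} col e \<phi>"
proof -
  have "levels m le \<kappa> cls Mf depth L" "\<And>x. x < m \<Longrightarrow> \<kappa> 0 x = \<kappa>0 x" using LI by (auto simp: levels_stored_def)
  then interpret levels m le \<kappa> cls Mf depth L by simp
  interpret colored_levels m le \<kappa> cls Mf depth L col \<Lambda>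
  proof
    fix x y c assume *: "x \<in> {0<..<m - 1}" "y \<in> {0<..<m - 1}" "\<kappa> 0 x = \<kappa> 0 y" "c \<in> \<Lambda>"
    have "x < m" "y < m" using *(1,2) by auto
    with *(3) have "\<kappa>0 x = \<kappa>0 y" using \<open>\<And>x. x < m \<Longrightarrow> \<kappa> 0 x = \<kappa>0 x\<close> by metis
    then show "col x = c \<longleftrightarrow> col y = c" using * by (intro col)
  qed
  have W_Suc: "W (Suc i) = (\<Union>t\<in>TS L. t ` W i)" for i
    unfolding W_def TS_def by (simp add: set_cl)
  have mono: "W i \<subseteq> W (Suc i)" for i
    unfolding W_Suc by (intro subsetI UN_I[OF id_TS]) simp
  have W0: "{0, 1} \<subseteq> W i" for i
  proof (induction i)
    case (Suc i) then show ?case using mono by blast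
  qed (simp add: W_def)
  have W_less: "W i \<subseteq> {..<m}" for i
  proof (induction i)
    case 0 then show ?case using m by (simp add: W_def)
  next
    case (Suc i) then show ?case unfolding W_Suc using TS_less[OF order.refl] by auto
  qed
  have clean: "clean m ` W i = W i \<inter> {0<..<m - 1}" for i
  proof
    show "clean m ` W i \<subseteq> W i \<inter> {0<..<m - 1}"
      using W0[of i] W_less[of i] m by (force simp: clean_def)
    show "W i \<inter> {0<..<m - 1} \<subseteq> clean m ` W i"
    proof
      fix x assume "x \<in> W i \<inter> {0<..<m - 1}"
      then show "x \<in> clean m ` W i" by (intro image_eqI[of _ _ x]) (auto simp: clean_def)
    qed
  qed
  show "clean m ` W (Suc i) \<subseteq> {0<..<m - 1}" unfolding clean by blast
  show "clean m ` W (Suc i) \<noteq> {}" using W0 by blast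
  assume "qrank \<phi> \<le> L" "set_fm \<phi> \<subseteq> \<Lambda>" "free_vars \<phi> = {}"
  then show "qsat (\<lambda>i. clean m ` W (Suc i)) {(x, y). le x y} col 0 e \<phi> \<longleftrightarrow> sat {0<..<m - 1} {(x, y). le x y} col e \<phi>"
    unfolding clean by (intro qsat_iff_sat) (use W_less W0 mono W_Suc in auto)
qed

lemma ext_le_bposet:
  assumes n: "1 \<le> n" and rel: "\<And>i. i < n \<Longrightarrow> rel i i"
    "\<And>i j k. i < n \<Longrightarrow> j < n \<Longrightarrow> k < n \<Longrightarrow> rel i j \<Longrightarrow> rel j k \<Longrightarrow> rel i k"
    "\<And>i j. i < n \<Longrightarrow> j < n \<Longrightarrow> rel i j \<Longrightarrow> rel j i \<Longrightarrow> i = j"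
  shows "bposet (n + 2) (ext_le n rel)"
proof
  show "ext_le n rel x x" if "x < n + 2" for x
    using rel(1)[of "x - 1"] that by (auto simp: ext_le_def)
  show "ext_le n rel x z" if "x < n + 2" "y < n + 2" "z < n + 2" "ext_le n rel x y" "ext_le n rel y z" for x y z
    using rel(2)[of "x - 1" "y - 1" "z - 1"] that by (auto simp: ext_le_def)
  show "x = y" if "x < n + 2" "y < n + 2" "ext_le n rel x y" "ext_le n rel y x" for x y
    using rel(3)[of "x - 1" "y - 1"] that by (cases x; cases y) (auto simp: ext_le_def)
qed (auto simp: ext_le_def)

text \<open>An end is comparable with everything, so an antichain containing one is a singleton;
  this is where \<open>1 \<le> w\<close> enters. All other antichains are shifted copies of
  antichains of the given poset.\<close>

lemma ext_le_width_le:
  assumes "bposet (n + 2) (ext_le n rel)" and w: "1 \<le> w"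
    "\<And>A. A \<subseteq> {..<n} \<Longrightarrow> \<forall>i\<in>A. \<forall>j\<in>A. i \<noteq> j \<longrightarrow> \<not> rel i j \<Longrightarrow> card A \<le> w"
  shows "bposet.width_le (n + 2) (ext_le n rel) w"
proof -
  interpret bposet "n + 2" "ext_le n rel" by fact
  show ?thesis
    unfolding width_le_def
  proof (intro allI impI)
    fix A assume A: "A \<subseteq> {..<n + 2}" "\<forall>x\<in>A. \<forall>y\<in>A. x \<noteq> y \<longrightarrow> \<not> ext_le n rel x y"
    show "card A \<le> w"
    proof (cases "0 \<in> A \<or> n + 1 \<in> A")
      case True
      then obtain x where "A \<subseteq> {x}"
      proof
        assume "0 \<in> A" then have "A \<subseteq> {0}" using A(2) by (auto simp: ext_le_def)
        then show ?thesis by (rule that)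
      next
        assume "n + 1 \<in> A" then have "A \<subseteq> {n + 1}" using A(2) by (auto simp: ext_le_def)
        then show ?thesis by (rule that)
      qed
      then have "card A \<le> card {x}" by (intro card_mono) auto
      then show ?thesis using w(1) by simp
    next
      case False
      have in1: "0 < x \<and> x \<le> n" if "x \<in> A" for x
      proof -
        have "x \<noteq> 0" "x \<noteq> n + 1" using that False by metis+
        moreover have "x < n + 2" using that A(1) by auto
        ultimately show ?thesis by simp
      qed
      have "inj_on (\<lambda>x. x - 1) A"
      proof (rule inj_onI)
        fix x y assume "x \<in> A" "y \<in> A" "x - 1 = y - 1"
        then show "x = y" using in1[of x] in1[of y] by (cases x; cases y) auto
      qed
      then have "card ((\<lambda>x. x - 1) ` A) = card A" by (rule card_image)
      moreover have "card ((\<lambda>x. x - 1) ` A) \<le> w"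
      proof (rule w(2))
        show "(\<lambda>x. x - 1) ` A \<subseteq> {..<n}" using in1 by force
        show "\<forall>i\<in>(\<lambda>x. x - 1) ` A. \<forall>j\<in>(\<lambda>x. x - 1) ` A. i \<noteq> j \<longrightarrow> \<not> rel i j"
          using A(2) in1 by (force simp: ext_le_def)
      qed
      ultimately show ?thesis by simp
    qed
  qed
qed

text \<open>Lets the program use the length of the code as the number of levels, instead of
  computing the quantifier rank.\<close>

lemma qrank_le_length: "qrank \<phi> \<le> length (encode_fm \<phi>)"
  by (induction \<phi>) auto

text \<open>Colours are looked up among all entries of the code. Operators and variables occur there
  too, which can only make the first partition finer.\<close>

lemma set_fm_encode: "set_fm \<phi> \<subseteq> set (encode_fm \<phi>)"
  by (induction \<phi>) auto

lemma eval_time_binary_le: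
  fixes Z :: nat
  assumes "1 \<le> Z" "x \<le> u" "y \<le> v" "1 \<le> u" "1 \<le> v"
  shows "300 + x + y \<le> 600 * Z * (u * v)"
proof -
  have "u \<le> u * v" "v \<le> u * v" "1 \<le> u * v" using assms(4,5) by simp_all
  moreover have "u * v \<le> Z * (u * v)" using assms(1) by simp
  ultimately have "300 + x + y \<le> 600 * (Z * (u * v))" using assms(2,3) by linarith
  then show ?thesis by (simp only: mult.assoc)
qed

lemma eval_time_quantifier_le:
  fixes Z :: nat
  assumes "1 \<le> Z" "x \<le> u" "1 \<le> u"
  shows "200 + Z * (200 + x) \<le> 600 * Z * (600 * Z * u)"
proof -
  have "200 + x \<le> 201 * u" using assms(2,3) by linarith
  then have "Z * (200 + x) \<le> Z * (201 * u)" by (rule mult_le_mono2)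
  moreover have "1 \<le> Z * u" "Z * u \<le> Z * (Z * u)" using assms(1,3) by simp_all
  ultimately have "200 + Z * (200 + x) \<le> 360000 * (Z * (Z * u))" by linarith
  then show ?thesis by (simp add: mult.assoc mult.left_commute)
qed

text \<open>Every entry of the code pays a factor \<open>600 * Z\<close>. The sum of the costs of
  two operands is dominated by the product of their bounds, both being at least 1.\<close>

lemma eval_time_le: "1 \<le> Z \<Longrightarrow> eval_time Z \<phi> \<le> (600 * Z) ^ length (encode_fm \<phi>)"
proof (induction \<phi>)
  case (Neg \<phi>)
  let ?u = "(600 * Z) ^ length (encode_fm \<phi>)"
  have "1 \<le> ?u" "?u \<le> Z * ?u" using Neg.prems by auto
  then have "200 + ?u \<le> 600 * (Z * ?u)" by linarith
  then show ?case using Neg by (simp add: mult.assoc)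
next
  case (And \<phi> \<psi>)
  then show ?case using eval_time_binary_le[OF And.prems And.IH] by (simp add: power_add)
next
  case (Or \<phi> \<psi>)
  then show ?case using eval_time_binary_le[OF Or.prems Or.IH] by (simp add: power_add)
next
  case (Ex x \<phi>)
  then show ?case using eval_time_quantifier_le[OF Ex.prems Ex.IH] by simp
next
  case (All x \<phi>)
  then show ?case using eval_time_quantifier_le[OF All.prems All.IH] by simp
qed (simp_all add: numeral_3_eq_3)

definition CHECK :: com where
  "CHECK = SETUP ;; MATRIX ;; COLORS ;; CHAINS ;; BASE ;; LEVELS ;; CAND ;; EVAL"

locale instance_data =
  fixes n w L Z :: nat and rel :: "nat \<Rightarrow> nat \<Rightarrow> bool" and color :: "nat \<Rightarrow> nat" and \<phi> :: "nat fm" and s0 :: state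
  assumes n: "1 \<le> n"
    and rel: "\<And>i. i < n \<Longrightarrow> rel i i"
      "\<And>i j k. i < n \<Longrightarrow> j < n \<Longrightarrow> k < n \<Longrightarrow> rel i j \<Longrightarrow> rel j k \<Longrightarrow> rel i k"
      "\<And>i j. i < n \<Longrightarrow> j < n \<Longrightarrow> rel i j \<Longrightarrow> rel j i \<Longrightarrow> i = j"
    and w: "1 \<le> w" "\<And>A. A \<subseteq> {..<n} \<Longrightarrow> \<forall>i\<in>A. \<forall>j\<in>A. i \<noteq> j \<longrightarrow> \<not> rel i j \<Longrightarrow> card A \<le> w"
    and L: "L = length (encode_fm \<phi>)" and sentence: "free_vars \<phi> = {}"
    and inp: "snd s0 0 0 = n" "fst s0 0 = 1 + n * n + n + L"
      "\<And>i j. i < n \<Longrightarrow> j < n \<Longrightarrow> snd s0 0 (1 + i * n + j) = of_bool (rel i j)"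
      "\<And>i. i < n \<Longrightarrow> snd s0 0 (1 + n * n + i) = color i"
      "\<And>i. i < L \<Longrightarrow> snd s0 0 (1 + n * n + n + i) = encode_fm \<phi> ! i"
      "\<And>c. snd s0 aCB c = 0"
    and Z: "term_bound (class_bound (w * w * (L + 3)) L) (depth L) + 1 \<le> Z" "class_bound (w * w * (L + 3)) L + 1 \<le> Z" "depth L + 1 \<le> Z"
      "2 * term_bound (class_bound (w * w * (L + 3)) L) (depth L) ^ L + 1 \<le> Z" "w * w + 2 \<le> Z" "L + 3 \<le> Z"
begin

abbreviation "m \<equiv> n + 2"
abbreviation "le \<equiv> ext_le n rel"

lemma bposet: "bposet m le"
  by (rule ext_le_bposet[OF n rel])

definition input :: "state \<Rightarrow> bool" where
  "input s \<longleftrightarrow> snd s 0 = snd s0 0 \<and> fst s rcb = 1 + n * n \<and> fst s rfb = 1 + n * n + n \<and> fst s rL = L"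

definition col :: "nat \<Rightarrow> nat" where
  "col x = color (x - 1)"

definition nc :: "nat \<Rightarrow> nat" where
  "nc = color_code n L (\<lambda>i. encode_fm \<phi> ! i) color"

lemma nc_less: "x < m \<Longrightarrow> nc x < L + 3"
  by (auto simp: nc_def color_code_def intro!: le_less_trans[OF lastpos_le])

text \<open>As \<open>c\<close> occurs in the code, an element coloured \<open>c\<close> has a
  nonzero position, and the entry at this position is its colour. Equal positions then give equal
  colours. Elements with colours absent from the code share position 0, and none of them has colour
  \<open>c\<close>.\<close>

lemma nc_col:
  assumes x: "x \<in> {0<..<m - 1}" "y \<in> {0<..<m - 1}" and eq: "nc x = nc y" and c: "c \<in> set_fm \<phi>"
  shows "col x = c \<longleftrightarrow> col y = c"
proof -
  have "c \<in> set (encode_fm \<phi>)" using c set_fm_encode by blast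
  then obtain i where i: "i < L" "encode_fm \<phi> ! i = c" unfolding L in_set_conv_nth by blast
  let ?p = "\<lambda>x. lastpos (\<lambda>i. encode_fm \<phi> ! i) (col x) L"
  have p: "?p x = ?p y" using eq x by (simp add: nc_def color_code_def col_def)
  have "col x' = col y'" if "?p x' = ?p y'" "col x' = c" for x' y'
  proof -
    have "?p x' \<noteq> 0" using lastpos_pos[of i L "\<lambda>i. encode_fm \<phi> ! i" c] i that(2) by simp
    then have "encode_fm \<phi> ! (?p x' - 1) = col x'" "encode_fm \<phi> ! (?p y' - 1) = col y'"
      using lastpos_hit[of "\<lambda>i. encode_fm \<phi> ! i" "col x'" L] lastpos_hit[of "\<lambda>i. encode_fm \<phi> ! i" "col y'" L] that(1)
      by simp_all
    then show ?thesis using that(1) by simp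
  qed
  from this[of x y] this[of y x] show ?thesis using p by auto
qed

lemma frame_input: "frame c s s' \<Longrightarrow> input s \<Longrightarrow> 0 \<notin> warrs c \<Longrightarrow> {rcb, rfb, rL} \<inter> wregs c = {} \<Longrightarrow> input s'"
  unfolding input_def by (auto simp: frame_def)

lemma wp_SETUP_COLORS:
  "wp (SETUP ;; MATRIX ;; COLORS) (\<lambda>t s'. t \<le> 300 * ((m + 1) * ((m + 1) * Z)) \<and> order_stored m le s' \<and> input s' \<and>
     (\<forall>x<m. snd s' aNC x = nc x)) s0"
  unfolding wp_Seq
proof (rule wp_use[OF wp_SETUP[OF inp(1,2)]], goal_cases step)
  case (step t1 s1)
  note 1 = step(1) and f1 = step(2)
  have i1: "input s1" using 1 frame_arr[OF f1] by (simp add: input_def)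
  have "wp MATRIX (\<lambda>t s'. t \<le> 100 * ((n + 3) * (n + 3)) \<and>
     (\<forall>x<n + 2. \<forall>y<n + 2. snd s' aLE (x * (n + 2) + y) = of_bool (le x y))) s1"
    by (rule wp_MATRIX) (use 1 i1 inp in \<open>auto simp: input_def\<close>)
  then show ?case
  proof (rule wp_use, goal_cases step)
    case (step t2 s2)
    note 2 = step(1) and f2 = step(2)
    have i2: "input s2" by (rule frame_input[OF f2 i1]) auto
    have G2: "order_stored m le s2" unfolding order_stored_def using 1 2 frame_reg[OF f2] frame_arr[OF f2] by simp
    have "wp COLORS (\<lambda>t s'. t \<le> 60 * ((n + 3) * (L + 1)) \<and> (\<forall>x<n + 2. snd s' aNC x = color_code n L (\<lambda>i. encode_fm \<phi> ! i) color x)) s2"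
      by (rule wp_COLORS) (use i2 G2 inp in \<open>auto simp: input_def order_stored_def\<close>)
    then show ?case
    proof (rule wp_use, goal_cases step)
      case (step t3 s3)
      note 3 = step(1) and f3 = step(2)
      have i3: "input s3" by (rule frame_input[OF f3 i2]) auto
      have G3: "order_stored m le s3" by (rule order_stored_cong[OF G2]) (use frame_reg[OF f3] frame_arr[OF f3] in auto)
      have z: "1 \<le> Z" "L + 1 \<le> Z" using Z(6) by auto
      have "(n + 3) * (n + 3) = (m + 1) * ((m + 1) * 1)" by (simp add: eval_nat_numeral)
      also have "\<dots> \<le> (m + 1) * ((m + 1) * Z)" by (intro mult_le_mono order.refl z(1))
      finally have "(n + 3) * (n + 3) \<le> (m + 1) * ((m + 1) * Z)" .
      moreover have "(n + 3) * (L + 1) \<le> (m + 1) * ((m + 1) * Z)"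
        by (intro mult_le_mono) (use z in \<open>auto intro: le_trans\<close>)
      moreover have "n + 2 \<le> (m + 1) * ((m + 1) * Z)"
        using mult_le_mono[of "n + 2" "m + 1" 1 "(m + 1) * Z"] z by simp
      moreover have "t1 + (t2 + t3) \<le> 300 * T"
        if "a \<le> T" "b \<le> T" "c \<le> T" "t1 \<le> 100 * c" "t2 \<le> 100 * a" "t3 \<le> 60 * b" for a b c T
        using that by linarith
      ultimately have "t1 + (t2 + t3) \<le> 300 * ((m + 1) * ((m + 1) * Z))"
        using conjunct1[OF 1] conjunct1[OF 2] conjunct1[OF 3] by blast
      then show ?case
        using i3 G3 3 by (simp add: nc_def)
    qed
  qed
qed

definition \<kappa>0 :: "(nat \<Rightarrow> nat) \<Rightarrow> nat \<Rightarrow> nat" where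
  "\<kappa>0 C x = nc x + C x * (L + 3)"

lemma \<kappa>0_eq:
  assumes "x < m" "y < m" "\<kappa>0 C x = \<kappa>0 C y"
  shows "nc x = nc y" "C x = C y"
proof -
  have "\<kappa>0 C z mod (L + 3) = nc z" "\<kappa>0 C z div (L + 3) = C z" if "z < m" for z
    using nc_less[OF that] by (simp_all add: \<kappa>0_def)
  then show "nc x = nc y" "C x = C y" using assms by metis+
qed

lemma nc_ends: "x < m \<Longrightarrow> nc x = nc 0 \<Longrightarrow> x = 0" "x < m \<Longrightarrow> nc x = nc (m - 1) \<Longrightarrow> x = m - 1"
  using lastpos_le[of "\<lambda>i. encode_fm \<phi> ! i" "color (x - 1)" L]
  by (auto simp: nc_def color_code_def split: if_splits)

abbreviation "M0 \<equiv> w * w * (L + 3)"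

lemma wp_CHAINS_BASE:
  assumes G: "order_stored m le s" and i: "input s" and nc: "\<forall>x<m. snd s aNC x = nc x" and CB: "\<And>c. snd s aCB c = 0"
  shows "wp (CHAINS ;; BASE) (\<lambda>t s'. t \<le> 460 * ((m + 1) * ((m + 1) * Z)) \<and> input s' \<and>
     (\<exists>C Mf \<kappa> cls. levels_stored m le M0 (\<kappa>0 C) 0 s' Mf \<kappa> cls)) s"
proof -
  interpret bposet m le by (rule bposet)
  have "width_le w" by (rule ext_le_width_le[OF bposet w])
  from wp_CHAINS[OF this G] show ?thesis
    unfolding wp_Seq
  proof (rule wp_use, goal_cases step)
    case (step t1 s1)
    note 1 = step(1) and f1 = step(2)
    have i1: "input s1" by (rule frame_input[OF f1 i]) auto
    have "wp BASE (\<lambda>t s'. t \<le> 60 * ((m + 1) * (w * w + 1)) \<and> fst s' rM = fst s1 rnch * (L + 3) \<and> fst s' rd = 0 \<and> fst s' rlb = 0 \<and>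
     (\<forall>x<m. snd s' aK x = snd s1 aNC x + snd s1 aCH x * (L + 3))) s1"
      by (rule wp_BASE) (use 1 i1 frame_reg[OF f1] G in \<open>auto simp: order_stored_def input_def\<close>)
    then show ?case
    proof (rule wp_use, goal_cases step)
      case (step t2 s2)
      note 2 = step(1) and f2 = step(2)
      let ?C = "snd s1 aCH"
      have i2: "input s2" by (rule frame_input[OF f2 i1]) auto
      have G2: "order_stored m le s2"
        by (rule order_stored_cong[OF G]) (use frame_reg[OF f1] frame_reg[OF f2] frame_arr[OF f1] frame_arr[OF f2] in auto)
      have K: "snd s2 aK x = \<kappa>0 ?C x \<and> \<kappa>0 ?C x < fst s2 rM" if "x < m" for x
      proof -
        have "snd s1 aNC x = nc x" using nc that frame_arr[OF f1, of aNC] by simp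
        then have "snd s2 aK x = \<kappa>0 ?C x" using 2 that by (simp add: \<kappa>0_def)
        moreover have "Suc (?C x) * (L + 3) \<le> fst s1 rnch * (L + 3)"
          using 1 that by (intro mult_le_mono1) (simp add: Suc_leI)
        then have "\<kappa>0 ?C x < fst s2 rM" using 2 nc_less[OF that] by (simp add: \<kappa>0_def)
        ultimately show ?thesis by simp
      qed
      have "levels_stored m le M0 (\<kappa>0 ?C) 0 s2 (\<lambda>_. fst s2 rM) (\<lambda>_. \<kappa>0 ?C) (\<lambda>c y. \<kappa>0 ?C y = c)"
      proof (rule levels_stored_0[OF bposet G2 _ _ K])
        show "snd s2 aCB c = 0" for c using CB frame_arr[OF f1] frame_arr[OF f2] by simp
        show "fst s2 rM \<le> M0" using 1 2 by (simp add: mult_le_mono1)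
        show "x = 0" if "x < m" "\<kappa>0 ?C x = \<kappa>0 ?C 0" for x using \<kappa>0_eq(1)[OF that(1) _ that(2)] nc_ends(1) that by simp
        show "x = m - 1" if "x < m" "\<kappa>0 ?C x = \<kappa>0 ?C (m - 1)" for x
          using \<kappa>0_eq(1)[OF that(1) _ that(2)] nc_ends(2)[OF that(1)] by simp
        show "le x y \<or> le y x" if "x < m" "y < m" "\<kappa>0 ?C x = \<kappa>0 ?C y" for x y
          using \<kappa>0_eq(2)[OF that] 1 that(1,2) by blast
      qed (use 2 in auto)
      moreover have "t1 + t2 \<le> 460 * ((m + 1) * ((m + 1) * Z))"
      proof -
        have "(m + 1) * ((m + 1) * (w * w + 2)) \<le> (m + 1) * ((m + 1) * Z)" using Z(5) by (intro mult_le_mono2)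
        moreover have "(m + 1) * (w * w + 1) \<le> (m + 1) * ((m + 1) * Z)"
          using mult_le_mono[of 1 "m + 1" "w * w + 1" Z] Z(5) by (intro mult_le_mono2) simp
        ultimately show ?thesis using conjunct1[OF 1] conjunct1[OF 2] by linarith
      qed
      ultimately show ?case using i2 by blast
    qed
  qed
qed

lemma wp_EVAL':
  assumes LI: "levels_stored m le M0 (\<kappa>0 C) L s Mf \<kappa> cls" and i: "input s"
    and W: "\<forall>i<L. snd s aML i = length (candidates (class_funs le m cls (Mf L)) (depth L) (Suc i))"
      "\<forall>j<length (candidates (class_funs le m cls (Mf L)) (depth L) L). snd s aW j = clean m (candidates (class_funs le m cls (Mf L)) (depth L) L ! j)"
  shows "wp EVAL (\<lambda>t s'. t \<le> 120 + eval_time Z \<phi> \<and>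
     fst s' 0 = of_bool (sat {0<..<m - 1} {(x, y). le x y} col (snd s aEV) \<phi>)) s"
proof -
  define ws where "ws = candidates (class_funs le m cls (Mf L)) (depth L)"
  define Q where "Q i = clean m ` set (ws (Suc i))" for i
  have m3: "3 \<le> m" using n by simp
  have \<kappa>0_col: "col x = c \<longleftrightarrow> col y = c"
    if "x \<in> {0<..<m - 1}" "y \<in> {0<..<m - 1}" "\<kappa>0 C x = \<kappa>0 C y" "c \<in> set_fm \<phi>" for x y c
    using that \<kappa>0_eq(1)[of x y C] by (intro nc_col) auto
  note q = levels_stored_qsat[OF LI m3, where col = col and \<Lambda> = "set_fm \<phi>", folded ws_def]
  have Q: "Q i \<subseteq> {0<..<m - 1}" "Q i \<noteq> {}" for i
  proof -
    show "Q i \<subseteq> {0<..<m - 1}" unfolding Q_def by (rule q(1)) (rule \<kappa>0_col)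
    show "Q i \<noteq> {}" unfolding Q_def by (rule q(2)) (rule \<kappa>0_col)
  qed
  interpret E: evaluator m le col "1 + n * n" L Z Q
    by unfold_locales (use Q in auto)
  have img: "snd s aW ` {..<snd s aML i} = Q i" if iL: "i < L" for i
  proof -
    have len: "snd s aML i = length (ws (Suc i))" using W(1) iL by (simp add: ws_def)
    obtain zs where zs: "ws L = ws (Suc i) @ zs"
      using candidates_prefix[of "Suc i" L "class_funs le m cls (Mf L)" "depth L"] iL unfolding ws_def by (auto simp del: candidates.simps)
    have "snd s aW j = clean m (ws (Suc i) ! j)" if "j < length (ws (Suc i))" for j
      using W(2) that zs unfolding ws_def[symmetric] by (simp add: nth_append)
    then show ?thesis unfolding len Q_def set_conv_nth by (auto simp: image_iff)
  qed
  have lenZ: "snd s aML i \<le> Z" if "i < L" for i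
  proof -
    have "Mf L \<le> class_bound M0 L" using levels_stored_bound[OF LI] .
    then have "term_bound (Mf L) (depth L) \<le> term_bound (class_bound M0 L) (depth L)" by (intro term_bound_mono) auto
    then have "term_bound (Mf L) (depth L) ^ Suc i \<le> term_bound (class_bound M0 L) (depth L) ^ Suc i" by (intro power_mono) auto
    also have "\<dots> \<le> term_bound (class_bound M0 L) (depth L) ^ L" using that term_bound_pos by (intro power_increasing) auto
    finally show ?thesis using W(1) that Z(4) unfolding length_candidates by simp
  qed
  have rfb: "fst s rfb = 1 + n * n + n" using i by (simp add: input_def)
  have rank: "qrank \<phi> \<le> L" using qrank_le_length L by simp
  have "E.static s"
    unfolding E.static_def
  proof (intro conjI ballI allI impI)
    show "order_stored m le s" using LI by (simp add: levels_stored_def)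
    show "fst s rcb = 1 + n * n" using i by (simp add: input_def)
    fix x assume "x \<in> {0<..<m - 1}"
    then show "snd s 0 (1 + n * n + x - 1) = col x"
      using inp(4)[of "x - 1"] i by (auto simp: input_def col_def)
  qed (use img lenZ in auto)
  moreover have "code_at (1 + n * n + n) (encode_fm \<phi>) s"
    using i inp(5) unfolding code_at_def input_def L[symmetric] by simp
  ultimately have "wp EVAL (\<lambda>t s'. t \<le> 120 + eval_time Z \<phi> \<and>
      fst s' 0 = of_bool (qsat Q {(x, y). le x y} col 0 (snd s aEV) \<phi>)) s"
    using E.wp_EVAL[OF _ rfb _ rank sentence] by blast
  moreover have "qsat Q {(x, y). le x y} col 0 (snd s aEV) \<phi> \<longleftrightarrow> sat {0<..<m - 1} {(x, y). le x y} col (snd s aEV) \<phi>"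
    unfolding Q_def by (rule q(3)[OF _ rank order.refl sentence]) (rule \<kappa>0_col)
  ultimately show ?thesis by simp
qed

definition B :: nat where
  "B = Z * (Z * (Z * (m + 1)))"

text \<open>The refinement dominates: at most \<open>Z\<close> levels, \<open>m + 1\<close> for the
  elements, \<open>Z\<close> for the representatives compared with each, and \<open>B\<close> for a
  closure, which contains the second factor \<open>m + 1\<close>.\<close>

lemma wp_CHECK:
  "wp CHECK (\<lambda>t s'. t \<le> 2000 * (Z * ((m + 1) * (Z * B))) + (120 + eval_time Z \<phi>) \<and>
     (\<exists>e. fst s' 0 = of_bool (sat {0<..<m - 1} {(x, y). le x y} col e \<phi>))) s0"
proof -
  have M0: "1 \<le> M0" using w(1) by simp
  have z: "1 \<le> Z" "L + 1 \<le> Z" using Z(6) by auto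
  have bounds: "(m + 1) * ((m + 1) * Z) \<le> Z * ((m + 1) * (Z * B))" "Z * B \<le> Z * ((m + 1) * (Z * B))"
  proof -
    have "(m + 1) * Z \<le> B" unfolding B_def using z(1) by (simp add: mult.commute mult.left_commute)
    then have "(m + 1) * ((m + 1) * Z) \<le> (m + 1) * B" by (rule mult_le_mono2)
    also have "\<dots> \<le> (m + 1) * (Z * B)" using z(1) by (intro mult_le_mono2) simp
    also have "\<dots> \<le> Z * ((m + 1) * (Z * B))" using mult_le_mono1[OF z(1), of "(m + 1) * (Z * B)"] by simp
    finally show "(m + 1) * ((m + 1) * Z) \<le> Z * ((m + 1) * (Z * B))" .
    have "Z * B \<le> (m + 1) * (Z * B)" by simp
    also have "\<dots> \<le> Z * ((m + 1) * (Z * B))" using mult_le_mono1[OF z(1), of "(m + 1) * (Z * B)"] by simp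
    finally show "Z * B \<le> Z * ((m + 1) * (Z * B))" .
  qed
  let ?T = "Z * ((m + 1) * (Z * B))"
  let ?Q = "\<lambda>t s'. t \<le> 2000 * ?T + (120 + eval_time Z \<phi>) \<and>
     (\<exists>e. fst s' 0 = of_bool (sat {0<..<m - 1} {(x, y). le x y} col e \<phi>))"
  have "wp (SETUP ;; MATRIX ;; COLORS) (\<lambda>t. wp (CHAINS ;; BASE) (\<lambda>u. wp LEVELS (\<lambda>v. wp CAND (\<lambda>x. wp EVAL
     (\<lambda>y. ?Q (t + u + v + x + y)))))) s0"
  proof (rule wp_use[OF wp_SETUP_COLORS], goal_cases step)
    case (step t1 s1)
    note 1 = step(1) and f1 = step(2)
    have "snd s1 aCB c = 0" for c using frame_arr[OF f1, of aCB] inp(6) by simp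
    with 1 have "wp (CHAINS ;; BASE) (\<lambda>t s'. t \<le> 460 * ((m + 1) * ((m + 1) * Z)) \<and> input s' \<and>
     (\<exists>C Mf \<kappa> cls. levels_stored m le M0 (\<kappa>0 C) 0 s' Mf \<kappa> cls)) s1" by (intro wp_CHAINS_BASE) auto
    then show ?case
    proof (rule wp_mono, goal_cases step)
      case (step t2 s2)
      note 2 = step(1)
      then obtain C Mf \<kappa> cls where LI: "levels_stored m le M0 (\<kappa>0 C) 0 s2 Mf \<kappa> cls" and i2: "input s2" by blast
      have L2: "fst s2 rL = L" using i2 by (simp add: input_def)
      have "wp LEVELS (\<lambda>t s'. t \<le> 708 * ?T \<and> (\<exists>Mf \<kappa> cls. levels_stored m le M0 (\<kappa>0 C) L s' Mf \<kappa> cls)) s2"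
        unfolding B_def by (rule wp_LEVELS[OF LI L2 z(2) M0 Z(1-3)])
      then show ?case
      proof (rule wp_use, goal_cases step)
        case (step t3 s3)
        note 3 = step(1) and f3 = step(2)
        then obtain Mf \<kappa> cls where LI: "levels_stored m le M0 (\<kappa>0 C) L s3 Mf \<kappa> cls" by blast
        have i3: "input s3" by (rule frame_input[OF f3 i2]) (auto simp: LEVELS_def)
        have L3: "fst s3 rL = L" using i3 by (simp add: input_def)
        have Mle: "Mf L \<le> class_bound M0 L" using levels_stored_bound[OF LI] .
        have "term_bound (Mf L) (depth L) ^ L \<le> term_bound (class_bound M0 L) (depth L) ^ L" using term_bound_mono[OF Mle order.refl, of "depth L"] by (intro power_mono) auto
        then have Z': "2 * term_bound (Mf L) (depth L) ^ L + 1 \<le> Z" "Mf L + 1 \<le> Z" using Z(2,4) Mle by linarith+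
        have "wp CAND (\<lambda>t s'. t \<le> 300 * (Z * B) \<and>
          (\<forall>i<L. snd s' aML i = length (candidates (class_funs le m cls (Mf L)) (depth L) (Suc i))) \<and>
          (\<forall>j<length (candidates (class_funs le m cls (Mf L)) (depth L) L). snd s' aW j = clean m (candidates (class_funs le m cls (Mf L)) (depth L) L ! j))) s3"
          unfolding B_def by (rule wp_CAND[OF LI L3 z(2) _ Z' Z(3)]) (use n in simp)
        then show ?case
        proof (rule wp_use, goal_cases step)
          case (step t4 s4)
          note 4 = step(1) and f4 = step(2)
          have i4: "input s4" by (rule frame_input[OF f4 i3]) auto
          have LI4: "levels_stored m le M0 (\<kappa>0 C) L s4 Mf \<kappa> cls"
            by (rule levels_stored_cong[OF LI]) (use frame_reg[OF f4] frame_arr[OF f4] in auto)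
          have "wp EVAL (\<lambda>t s'. t \<le> 120 + eval_time Z \<phi> \<and>
            fst s' 0 = of_bool (sat {0<..<m - 1} {(x, y). le x y} col (snd s4 aEV) \<phi>)) s4"
            by (rule wp_EVAL'[OF LI4 i4]) (use 4 in auto)
          then show ?case
          proof (rule wp_mono, goal_cases step)
            case (step t5 s5)
            note 5 = step(1)
            have "t1 + t2 + t3 + t4 + t5 \<le> 2000 * ?T + (120 + eval_time Z \<phi>)"
              using conjunct1[OF 1] conjunct1[OF 2] conjunct1[OF 3] conjunct1[OF 4] conjunct1[OF 5] bounds by linarith
            then show ?case using 5 by blast
          qed
        qed
      qed
    qed
  qed
  then show ?thesis unfolding CHECK_def wp_Seq by (simp add: add.assoc)
qed

end

section \<open>The computable bound\<close>

primrec tower :: "nat \<Rightarrow> nat \<Rightarrow> nat" where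
  "tower a 0 = a"
| "tower a (Suc h) = 2 ^ tower a h"

declare tower.simps(2) [simp del]

context
  fixes a :: nat assumes a: "10 \<le> a"
begin

lemma tower_Suc_ge: "tower a h \<le> tower a (Suc h)"
  by (simp add: tower.simps(2) less_exp less_imp_le)

lemma tower_mono: "h \<le> k \<Longrightarrow> tower a h \<le> tower a k"
  by (induction k rule: dec_induct) (use tower_Suc_ge in \<open>auto intro: le_trans\<close>)

lemma tower_le: "x \<le> tower a h \<Longrightarrow> h \<le> k \<Longrightarrow> x \<le> tower a k"
  using tower_mono le_trans by blast

lemma tower_ge: "10 \<le> tower a h"
  using tower_mono[of 0 h] a by simp

text \<open>The inequality behind all estimates with towers: sums and products raise the height by
  one and powers by two, so that bounding the running time becomes counting heights.\<close>

lemma square_le_exp: "4 \<le> t \<Longrightarrow> t * t \<le> 2 ^ (t::nat)"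
proof (induction t rule: nat_induct_at_least)
  case (Suc t)
  have "4 * t \<le> t * t" using Suc.hyps by (rule mult_le_mono1)
  moreover have "Suc t * Suc t = t * t + 2 * t + 1" by simp
  ultimately have "Suc t * Suc t \<le> 2 * (t * t)" using Suc.hyps by linarith
  then show ?case using Suc.IH by simp
qed simp

lemma tower_add: "x \<le> tower a h \<Longrightarrow> y \<le> tower a h \<Longrightarrow> x + y \<le> tower a (Suc h)"
proof -
  assume "x \<le> tower a h" "y \<le> tower a h"
  then have "x + y \<le> 2 * tower a h" by simp
  also have "\<dots> \<le> tower a h * tower a h" using tower_ge[of h] by (intro mult_le_mono1) simp
  also have "\<dots> \<le> tower a (Suc h)" using square_le_exp[of "tower a h"] tower_ge[of h] by (simp add: tower.simps(2))
  finally show ?thesis .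
qed

lemma tower_mult: "x \<le> tower a h \<Longrightarrow> y \<le> tower a h \<Longrightarrow> x * y \<le> tower a (Suc h)"
  using mult_le_mono[of x "tower a h" y "tower a h"] square_le_exp[of "tower a h"] tower_ge[of h]
  by (simp add: tower.simps(2))

lemma tower_exp: "x \<le> tower a h \<Longrightarrow> 2 ^ x \<le> tower a (Suc h)"
  by (simp add: tower.simps(2))

lemma tower_power: "x \<le> tower a h \<Longrightarrow> y \<le> tower a h \<Longrightarrow> x ^ y \<le> tower a (Suc (Suc h))"
proof -
  assume *: "x \<le> tower a h" "y \<le> tower a h"
  have "x \<le> 2 ^ tower a h" using *(1) less_exp[of "tower a h"] by linarith
  then have "x ^ y \<le> (2 ^ tower a h) ^ y" by (intro power_mono) auto
  also have "\<dots> = 2 ^ (tower a h * y)" by (rule power_mult[symmetric])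
  also have "\<dots> \<le> tower a (Suc (Suc h))" by (rule tower_exp[OF tower_mult]) (use * in auto)
  finally show ?thesis .
qed

lemma tower_one: "1 \<le> tower a h" "4 \<le> tower a h"
  using tower_ge[of h] by auto

lemma depth_tower: "depth k \<le> tower a k"
proof (induction k)
  case (Suc k)
  have "2 * depth k + 1 \<le> 4 * tower a k" using Suc tower_one(1)[of k] by simp
  also have "\<dots> \<le> tower a k * tower a k" using tower_one(2) by (intro mult_le_mono1)
  also have "\<dots> \<le> tower a (Suc k)" using square_le_exp[OF tower_one(2)] by (simp add: tower.simps(2))
  finally show ?case by simp
qed simp

lemma term_bound_tower:
  assumes "M \<le> tower a h" "d \<le> tower a h"
  shows "term_bound M d \<le> tower a (h + 4)"
proof -
  have "4 * M \<le> tower a (Suc h)" using tower_one(2) assms(1) by (rule tower_mult)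
  then have "1 + 4 * M \<le> tower a (Suc (Suc h))" using tower_one(1) by (intro tower_add)
  then have "(1 + 4 * M) ^ d \<le> tower a (Suc (Suc (Suc (Suc h))))"
    using tower_le[OF assms(2), of "Suc (Suc h)"] by (intro tower_power) auto
  then show ?thesis by (simp add: term_bound_def numeral_eq_Suc)
qed

text \<open>A level costs height 8: four for the number of terms, two for the power, one for the
  product and one for the sum.\<close>

lemma class_bound_tower:
  assumes "M \<le> tower a 2"
  shows "class_bound M k \<le> tower a (8 * k + 2)"
proof (induction k)
  case 0 then show ?case using assms by (simp add: numeral_2_eq_2)
next
  case (Suc k)
  let ?h = "8 * k + 2" and ?M = "class_bound M k" and ?s = "term_bound (class_bound M k) (depth k)"
  have s: "?s \<le> tower a (?h + 4)"
    by (rule term_bound_tower[OF Suc]) (rule tower_le[OF depth_tower], simp)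
  have "?M ^ ?s \<le> tower a (Suc (Suc (?h + 4)))"
    using tower_le[OF Suc, of "?h + 4"] s by (intro tower_power) auto
  moreover have "2 ^ (?s * ?s) \<le> tower a (Suc (Suc (?h + 4)))"
    by (intro tower_exp tower_mult s)
  ultimately have "?M ^ ?s * 2 ^ (?s * ?s) \<le> tower a (Suc (Suc (Suc (?h + 4))))" by (rule tower_mult)
  then have "?M + ?M ^ ?s * 2 ^ (?s * ?s) \<le> tower a (Suc (Suc (Suc (Suc (?h + 4)))))"
    using tower_le[OF Suc, of "Suc (Suc (Suc (?h + 4)))"] by (intro tower_add) auto
  then show ?case by (simp add: numeral_eq_Suc)
qed

end

text \<open>Height \<open>8 * L + 2\<close> covers the number of classes. Eight more give
  \<open>Z\<close>: four for the terms, two for the power \<open>L\<close>, one each for the factor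
  2 and the summand 1. The last five cover the fifth power of \<open>Z\<close> (three), the constant
  32000 (one) and the sum with the evaluation time (one).\<close>

definition bound :: "nat \<Rightarrow> nat fm \<Rightarrow> nat" where
  "bound w \<phi> = tower (w + length (encode_fm \<phi>) + 10) (8 * length (encode_fm \<phi>) + 15)"

lemma bounds:
  fixes w :: nat and \<phi> :: "nat fm"
  defines "L \<equiv> length (encode_fm \<phi>)"
  defines "Z \<equiv> tower (w + L + 10) (8 * L + 10)"
  shows "term_bound (class_bound (w * w * (L + 3)) L) (depth L) + 1 \<le> Z" "class_bound (w * w * (L + 3)) L + 1 \<le> Z" "depth L + 1 \<le> Z"
    "2 * term_bound (class_bound (w * w * (L + 3)) L) (depth L) ^ L + 1 \<le> Z" "w * w + 2 \<le> Z" "L + 3 \<le> Z"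
    "32000 * (Z * Z * (Z * Z) * Z) + (120 + eval_time Z \<phi>) \<le> bound w \<phi>"
proof -
  let ?a = "w + L + 10" and ?h = "8 * L + 2"
  have a: "10 \<le> ?a" by simp
  note add = tower_add[OF a] and mult = tower_mult[OF a] and pow = tower_power[OF a] and le = tower_le[OF a] and one = tower_one[OF a]
  have w0: "w \<le> tower ?a 0" "L + 3 \<le> tower ?a 0" by simp_all
  have ww: "w * w \<le> tower ?a 1" using mult[OF w0(1,1)] by simp
  have "w * w * (L + 3) \<le> tower ?a 2" using mult[OF ww le[OF w0(2), of 1]] by (simp add: numeral_2_eq_2)
  then have M: "class_bound (w * w * (L + 3)) L \<le> tower ?a ?h" by (rule class_bound_tower[OF a])
  have d: "depth L \<le> tower ?a ?h" by (rule le[OF depth_tower[OF a]]) simp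
  have s: "term_bound (class_bound (w * w * (L + 3)) L) (depth L) \<le> tower ?a (?h + 4)" using term_bound_tower[OF a M d] .
  have Suc_le: "x + 1 \<le> Z" if "x \<le> tower ?a (?h + 7)" for x
    using add[OF that one(1)] by (simp add: Z_def numeral_eq_Suc)
  show "term_bound (class_bound (w * w * (L + 3)) L) (depth L) + 1 \<le> Z" by (intro Suc_le le[OF s]) simp
  show "class_bound (w * w * (L + 3)) L + 1 \<le> Z" by (intro Suc_le le[OF M]) simp
  show "depth L + 1 \<le> Z" by (intro Suc_le le[OF d]) simp
  have "L \<le> tower ?a (?h + 4)" using le[OF w0(2), of "?h + 4"] by simp
  with s have "term_bound (class_bound (w * w * (L + 3)) L) (depth L) ^ L \<le> tower ?a (Suc (Suc (?h + 4)))" by (rule pow)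
  then have "2 * term_bound (class_bound (w * w * (L + 3)) L) (depth L) ^ L \<le> tower ?a (Suc (Suc (Suc (?h + 4))))"
    using one(2)[of "Suc (Suc (?h + 4))"] by (intro mult) auto
  then show "2 * term_bound (class_bound (w * w * (L + 3)) L) (depth L) ^ L + 1 \<le> Z" by (intro Suc_le) (simp add: numeral_eq_Suc)
  have "w * w + 1 \<le> tower ?a 2" using add[OF ww one(1)] by (simp add: numeral_2_eq_2)
  then show "w * w + 2 \<le> Z" using Suc_le[OF le[of "w * w + 1" 2]] by simp
  show "L + 3 \<le> Z" unfolding Z_def by (rule le[OF w0(2)]) simp
  let ?H = "8 * L + 10"
  have z: "Z \<le> tower ?a ?H" by (simp add: Z_def)
  have zz: "Z * Z \<le> tower ?a (Suc ?H)" using mult[OF z z] .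
  have "Z * Z * (Z * Z) \<le> tower ?a (Suc (Suc ?H))" using mult[OF zz zz] .
  then have z5: "Z * Z * (Z * Z) * Z \<le> tower ?a (Suc (Suc (Suc ?H)))"
    by (rule mult) (rule le[OF z], simp)
  \<comment> \<open>The summand 10 in the base of the tower puts the constants 600 and 120 below
    height 1 and, by one more exponential, 32000 below height 2.\<close>
  have c1: "1000 \<le> tower ?a 1"
  proof -
    have "(1000::nat) \<le> 2 ^ 10" by simp
    also have "\<dots> \<le> 2 ^ ?a" by (rule power_increasing) auto
    finally show ?thesis by (simp add: tower.simps(2))
  qed
  have c2: "32000 \<le> tower ?a 2"
  proof -
    have "(32000::nat) \<le> 2 ^ 15" by simp
    also have "\<dots> \<le> 2 ^ tower ?a 1" using c1 by (intro power_increasing) auto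
    finally show ?thesis by (simp add: tower.simps(2) numeral_2_eq_2)
  qed
  have t1: "32000 * (Z * Z * (Z * Z) * Z) \<le> tower ?a (Suc (Suc (Suc (Suc ?H))))"
    by (rule mult[OF _ z5]) (rule le[OF c2], simp)
  have "600 \<le> tower ?a ?H" using le[OF c1, of ?H] by simp
  then have "600 * Z \<le> tower ?a (Suc ?H)" using z by (rule mult)
  moreover have "L \<le> tower ?a (Suc ?H)" using le[OF w0(2), of "Suc ?H"] by simp
  ultimately have "(600 * Z) ^ L \<le> tower ?a (Suc (Suc (Suc ?H)))" by (rule pow)
  moreover have "eval_time Z \<phi> \<le> (600 * Z) ^ L"
    unfolding L_def by (rule eval_time_le) (use \<open>L + 3 \<le> Z\<close> in simp)
  ultimately have e: "eval_time Z \<phi> \<le> tower ?a (Suc (Suc (Suc ?H)))" by simp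
  have "120 \<le> tower ?a (Suc (Suc (Suc ?H)))" using le[OF c1, of "Suc (Suc (Suc ?H))"] by simp
  then have "120 + eval_time Z \<phi> \<le> tower ?a (Suc (Suc (Suc (Suc ?H))))" using e by (rule add)
  with t1 have "32000 * (Z * Z * (Z * Z) * Z) + (120 + eval_time Z \<phi>) \<le> tower ?a (Suc (Suc (Suc (Suc (Suc ?H)))))" by (rule add)
  then show "32000 * (Z * Z * (Z * Z) * Z) + (120 + eval_time Z \<phi>) \<le> bound w \<phi>"
    by (simp only: bound_def L_def[symmetric] numeral_eq_Suc pred_numeral_simps) (simp add: add.commute)
qed

definition POWER :: com where
  "POWER = Assign 13 (N 1) ;; For 14 (V 10) (Assign 13 (Plus (V 13) (V 13))) ;; Assign 10 (V 13)"

text \<open>Register 0 initially holds \<open>Suc L\<close>, as the input word consists of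
  \<open>w\<close> and the code. So 9 and 7 yield the base \<open>w + L + 10\<close> and the height
  \<open>8 * L + 15\<close>; the eightfold value is a sum of eight copies.\<close>

definition TOWER :: com where
  "TOWER = Assign 10 (Plus (Rd 0 (N 0)) (Plus (V 0) (N 9))) ;;
     Assign 11 (Plus (Plus (Plus (V 0) (V 0)) (Plus (V 0) (V 0))) (Plus (Plus (Plus (V 0) (V 0)) (Plus (V 0) (V 0))) (N 7))) ;;
     For 12 (V 11) POWER ;; Assign 0 (V 10)"

lemma wp_POWER: "wp POWER (\<lambda>t s'. t \<le> 20 * fst s 10 + 20 \<and> fst s' 10 = 2 ^ fst s 10) s"
proof -
  let ?c = "Assign 13 (Plus (V 13) (V 13))"
  let ?s1 = "((fst s)(13 := 1), snd s)"
  have "wp (For 14 (V 10) ?c) (\<lambda>t s'. t + 4 \<le> 20 * fst s 10 + 20 \<and> fst s' 13 = 2 ^ fst s 10) ?s1"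
  proof (rule wp_For[where k = "fst s 10" and T = 4 and Inv = "\<lambda>j s'. fst s' 13 = 2 ^ j"], goal_cases fresh bound init body post)
    case (bound s')
    show ?case using frame_reg[OF bound, of 10] by simp
  qed (auto simp: wp_simps)
  then show ?thesis unfolding POWER_def wp_Seq wp_Assign by simp
qed

text \<open>The cost of \<open>POWER\<close> grows with its argument, whereas \<open>wp_For\<close>
  wants one bound for all rounds. As computability asks for no time bound, the loop is treated by a
  direct induction that leaves the time open.\<close>

lemma wp_TOWER:
  assumes "fst s 0 = Suc L" "snd s 0 0 = w"
  shows "wp TOWER (\<lambda>t s'. fst s' 0 = tower (w + L + 10) (8 * L + 15)) s"
proof -
  let ?h = "8 * L + 15"
  let ?s1 = "((fst s)(10 := w + L + 10, 11 := ?h), snd s)"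
  have loop: "\<exists>t s'. exec (While (Minus (V 11) (V 12)) (Seq POWER (Assign 12 (Plus (V 12) (N 1))))) s1 t s' \<and>
      fst s' 10 = tower (w + L + 10) ?h"
    if "j \<le> ?h" "fst s1 11 = ?h" "fst s1 12 = j" "fst s1 10 = tower (w + L + 10) j" for j s1
    using that
  proof (induction "?h - j" arbitrary: j s1)
    case 0
    then have "aval (Minus (V 11) (V 12)) s1 = 0" "j = ?h" by auto
    then show ?case using exec.WhileFalse 0 by blast
  next
    case (Suc r)
    from wp_POWER[of s1] obtain t s2 where 2: "exec POWER s1 t s2" "fst s2 10 = 2 ^ fst s1 10" by (auto elim: wpE)
    have f: "fst s2 11 = ?h" "fst s2 12 = j"
      using exec_frame[OF 2(1)] Suc.prems by (auto simp: frame_def POWER_def)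
    let ?s3 = "((fst s2)(12 := Suc j), snd s2)"
    have "exec (Assign 12 (Plus (V 12) (N 1))) s2 (1 + acost (Plus (V 12) (N 1))) ?s3"
      using exec.Assign[of 12 "Plus (V 12) (N 1)" s2] f by simp
    note body = exec.Seq[OF 2(1) this]
    have "r = ?h - Suc j" "Suc j \<le> ?h" using Suc.hyps(2) by auto
    from Suc.hyps(1)[OF this, of ?s3] f 2(2) Suc.prems(4) obtain u s' where
      4: "exec (While (Minus (V 11) (V 12)) (Seq POWER (Assign 12 (Plus (V 12) (N 1))))) ?s3 u s'" "fst s' 10 = tower (w + L + 10) ?h"
      by (auto simp: tower.simps(2))
    have "aval (Minus (V 11) (V 12)) s1 \<noteq> 0" using Suc by auto
    from exec.WhileTrue[OF this body 4(1)] 4(2) show ?case by blast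
  qed
  obtain t s' where "exec (While (Minus (V 11) (V 12)) (Seq POWER (Assign 12 (Plus (V 12) (N 1))))) ((fst ?s1)(12 := 0), snd ?s1) t s'"
    "fst s' 10 = tower (w + L + 10) ?h"
    using loop[of 0 "((fst ?s1)(12 := 0), snd ?s1)"] by auto
  then have "wp (While (Minus (V 11) (V 12)) (Seq POWER (Assign 12 (Plus (V 12) (N 1)))))
      (\<lambda>t s'. fst s' 10 = tower (w + L + 10) ?h) ((fst ?s1)(12 := 0), snd ?s1)" by (rule wpI)
  then show ?thesis unfolding TOWER_def For_def
    using assms by (simp add: wp_simps(2,4) ac_simps)
qed

lemma computable_bound: "computable bound"
  unfolding computable_def
proof (rule exI, intro allI)
  fix w and \<phi> :: "nat fm"
  have "wp TOWER (\<lambda>t s'. fst s' 0 = bound w \<phi>) (init (w # encode_fm \<phi>))"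
    unfolding bound_def by (rule wp_TOWER) (simp_all add: init_def)
  then obtain t s where "exec TOWER (init (w # encode_fm \<phi>)) t s" "fst s 0 = bound w \<phi>" by (rule wpE)
  then show "\<exists>t. outputs_in TOWER (w # encode_fm \<phi>) t (bound w \<phi>)"
    unfolding outputs_in_def by blast
qed

lemma sat_cong: "(\<And>v. v \<in> free_vars \<phi> \<Longrightarrow> e v = e' v) \<Longrightarrow> sat P r col e \<phi> \<longleftrightarrow> sat P r col e' \<phi>"
proof (induction \<phi> arbitrary: e e')
  case (Ex x \<phi>)
  have "sat P r col (e(x := a)) \<phi> \<longleftrightarrow> sat P r col (e'(x := a)) \<phi>" for a
    by (rule Ex.IH) (use Ex.prems in auto)
  then show ?case by simp
next
  case (All x \<phi>)
  have "sat P r col (e(x := a)) \<phi> \<longleftrightarrow> sat P r col (e'(x := a)) \<phi>" for a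
    by (rule All.IH) (use All.prems in auto)
  then show ?case by simp
next
  case (And \<phi> \<psi>)
  have "sat P r col e \<phi> \<longleftrightarrow> sat P r col e' \<phi>" by (rule And.IH(1)) (use And.prems in auto)
  moreover have "sat P r col e \<psi> \<longleftrightarrow> sat P r col e' \<psi>" by (rule And.IH(2)) (use And.prems in auto)
  ultimately show ?case by simp
next
  case (Or \<phi> \<psi>)
  have "sat P r col e \<phi> \<longleftrightarrow> sat P r col e' \<phi>" by (rule Or.IH(1)) (use Or.prems in auto)
  moreover have "sat P r col e \<psi> \<longleftrightarrow> sat P r col e' \<psi>" by (rule Or.IH(2)) (use Or.prems in auto)
  ultimately show ?case by simp
next
  case (Neg \<phi>)
  have "sat P r col e \<phi> \<longleftrightarrow> sat P r col e' \<phi>" by (rule Neg.IH) (use Neg.prems in auto)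
  then show ?case by simp
qed auto

lemma sat_bij_betw:
  assumes h: "bij_betw h A P" and r: "\<And>x y. x \<in> A \<Longrightarrow> y \<in> A \<Longrightarrow> (x, y) \<in> q \<longleftrightarrow> (h x, h y) \<in> r"
    and c: "\<And>x. x \<in> A \<Longrightarrow> c x = col (h x)"
  shows "(\<And>v. v \<in> free_vars \<phi> \<Longrightarrow> e v \<in> A) \<Longrightarrow> sat A q c e \<phi> \<longleftrightarrow> sat P r col (h \<circ> e) \<phi>"
proof (induction \<phi> arbitrary: e)
  case (Eq x y)
  then show ?case using h by (auto simp: bij_betw_def inj_on_eq_iff)
next
  case (Leq x y)
  then show ?case using r by simp
next
  case (Color k x)
  then show ?case using c by simp
next
  case (Ex x \<phi>)
  have "sat A q c (e(x := a)) \<phi> \<longleftrightarrow> sat P r col ((h \<circ> e)(x := h a)) \<phi>" if "a \<in> A" for a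
    unfolding fun_upd_comp[symmetric] by (rule Ex.IH) (use Ex.prems that in auto)
  then show ?case unfolding sat.simps using bij_betw_imp_surj_on[OF h] by blast
next
  case (All x \<phi>)
  have "sat A q c (e(x := a)) \<phi> \<longleftrightarrow> sat P r col ((h \<circ> e)(x := h a)) \<phi>" if "a \<in> A" for a
    unfolding fun_upd_comp[symmetric] by (rule All.IH) (use All.prems that in auto)
  then show ?case unfolding sat.simps using bij_betw_imp_surj_on[OF h] by blast
qed auto

lemma nth_concat_map:
  "i < length xs \<Longrightarrow> j < length ys \<Longrightarrow> concat (map (\<lambda>x. map (g x) ys) xs) ! (i * length ys + j) = g (xs ! i) (ys ! j)"
proof (induction xs arbitrary: i)
  case (Cons x xs)
  then show ?case by (cases i) (simp_all add: nth_append)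
qed simp

lemma length_concat_map: "length (concat (map (\<lambda>x. map (g x) ys) xs)) = length xs * length ys"
  by (induction xs) auto

lemma antichain_card_le_width:
  assumes "finite P" "antichain P r A"
  shows "card A \<le> width P r"
proof -
  have "{A. antichain P r A} \<subseteq> Pow P" by (auto simp: antichain_def)
  then have "finite (card ` {A. antichain P r A})" using assms(1) by (intro finite_imageI) (rule finite_subset, auto)
  then show ?thesis unfolding width_def using assms(2) by (intro Max_ge) auto
qed

lemma CHECK_correct:
  fixes P :: "'a set" and \<phi> :: "nat fm"
  assumes P: "finite P" "P \<noteq> {}" "partial_order_on P r" "set xs = P" "distinct xs" and \<phi>: "sentence \<phi>"
  shows "\<exists>t. outputs_in CHECK (encode_poset xs r col @ encode_fm \<phi>) t (if models P r col \<phi> then 1 else 0) \<and>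
    t \<le> bound (width P r) \<phi> * (card P)\<^sup>2"
proof -
  define n where "n = length xs"
  define w where "w = width P r"
  define L where "L = length (encode_fm \<phi>)"
  define Z where "Z = tower (w + L + 10) (8 * L + 10)"
  define rel where "rel i j \<longleftrightarrow> (xs ! i, xs ! j) \<in> r" for i j
  define color where "color i = col (xs ! i)" for i
  let ?ws = "encode_poset xs r col @ encode_fm \<phi>"
  let ?s0 = "init ?ws"
  have card: "card P = n" unfolding n_def using distinct_card[OF P(5)] P(4) by simp
  have n1: "1 \<le> n" using P(1,2) card by (metis One_nat_def Suc_leI card_gt_0_iff)
  have nth: "xs ! i \<in> P" if "i < n" for i using that P(4) nth_mem n_def by blast
  have inj: "xs ! i = xs ! j \<longleftrightarrow> i = j" if "i < n" "j < n" for i j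
    using nth_eq_iff_index_eq[OF P(5)] that n_def by simp
  from P(3) have po: "refl_on P r" "trans r" "antisym r" by (auto simp: partial_order_on_def preorder_on_def)
  have w_le: "card A \<le> w" if "antichain P r A" for A
    unfolding w_def using antichain_card_le_width[OF P(1) that] .
  have "antichain P r {xs ! 0}" using nth[of 0] n1 by (simp add: antichain_def)
  from w_le[OF this] have w1: "1 \<le> w" by simp
  have wA: "card A \<le> w" if A: "A \<subseteq> {..<n}" "\<forall>i\<in>A. \<forall>j\<in>A. i \<noteq> j \<longrightarrow> \<not> rel i j" for A
  proof -
    have "inj_on ((!) xs) A" using A(1) inj by (auto simp: inj_on_def subset_iff)
    then have "card ((!) xs ` A) = card A" by (rule card_image)
    moreover have "antichain P r ((!) xs ` A)"
      using A nth unfolding antichain_def rel_def by (auto simp: subset_iff)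
    ultimately show ?thesis using w_le by metis
  qed
  let ?rows = "concat (map (\<lambda>x. map (\<lambda>y. if (x, y) \<in> r then 1 else 0) xs) xs) :: nat list"
  have ws: "?ws = n # ?rows @ map col xs @ encode_fm \<phi>"
    by (simp add: encode_poset_def n_def)
  have rows: "length ?rows = n * n" "\<And>i j. i < n \<Longrightarrow> j < n \<Longrightarrow> ?rows ! (i * n + j) = of_bool (rel i j)"
    unfolding n_def length_concat_map by (simp_all add: nth_concat_map rel_def)
  have len: "length ?ws = 1 + n * n + n + L" unfolding ws by (simp add: rows(1) n_def[symmetric] L_def)
  have inp: "snd ?s0 0 i = ?ws ! i" if "i < 1 + n * n + n + L" for i
    using that len by (simp add: init_def)
  note bnds = bounds[where w = w and \<phi> = \<phi>, folded L_def, folded Z_def]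
  interpret instance_data n w L Z rel color \<phi> ?s0
  proof
    show "1 \<le> n" "1 \<le> w" by fact+
    show "rel i i" if "i < n" for i using po(1) nth[OF that] by (simp add: rel_def refl_on_def)
    show "rel i k" if "i < n" "j < n" "k < n" "rel i j" "rel j k" for i j k
      using that(4,5) po(2) unfolding rel_def trans_def by blast
    show "i = j" if "i < n" "j < n" "rel i j" "rel j i" for i j
      using that po(3) inj unfolding rel_def antisym_def by blast
    show "card A \<le> w" if "A \<subseteq> {..<n}" "\<forall>i\<in>A. \<forall>j\<in>A. i \<noteq> j \<longrightarrow> \<not> rel i j" for A
      using wA[OF that] .
    show "free_vars \<phi> = {}" using \<phi> by (simp add: sentence_def)
    show "fst ?s0 0 = 1 + n * n + n + L" using len by (simp add: init_def)
    show "snd ?s0 0 0 = n" using inp[of 0] ws by simp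
    show "snd ?s0 0 (1 + i * n + j) = of_bool (rel i j)" if "i < n" "j < n" for i j
    proof -
      have "i * n + j < n * n" using row_less[OF that] by simp
      then show ?thesis using inp[of "1 + i * n + j"] rows(2)[OF that] rows(1) unfolding ws by (simp add: nth_append)
    qed
    show "snd ?s0 0 (1 + n * n + i) = color i" if "i < n" for i
      using inp[of "1 + n * n + i"] that rows(1) unfolding ws by (simp add: nth_append n_def[symmetric] color_def)
    show "snd ?s0 0 (1 + n * n + n + i) = encode_fm \<phi> ! i" if "i < L" for i
      using inp[of "1 + n * n + n + i"] that rows(1) unfolding ws by (simp add: nth_append n_def[symmetric])
    show "snd ?s0 10 c = 0" for c by (simp add: init_def)
  qed (use bnds in \<open>auto simp: L_def\<close>)
  from wp_CHECK obtain t s e where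
    1: "exec CHECK ?s0 t s" "t \<le> 2000 * (Z * ((m + 1) * (Z * B))) + (120 + eval_time Z \<phi>)"
      "fst s 0 = of_bool (sat {0<..<m - 1} {(x, y). le x y} local.col e \<phi>)"
    by (auto elim: wpE)
  \<comment> \<open>Inner element \<open>x\<close> stands for list position \<open>x - 1\<close>. A
    sentence has no free variables, so the assignment left over in the machine may be any.\<close>
  have "sat {0<..<m - 1} {(x, y). le x y} local.col e \<phi> \<longleftrightarrow> sat P r col ((\<lambda>x. xs ! (x - 1)) \<circ> e) \<phi>"
  proof (rule sat_bij_betw)
    show "bij_betw (\<lambda>x. xs ! (x - 1)) {0<..<m - 1} P"
    proof (rule bij_betw_imageI)
      show "inj_on (\<lambda>x. xs ! (x - 1)) {0<..<m - 1}"
      proof (rule inj_onI)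
        fix x y assume *: "x \<in> {0<..<m - 1}" "y \<in> {0<..<m - 1}" "xs ! (x - 1) = xs ! (y - 1)"
        then have "x - 1 = y - 1" using inj[of "x - 1" "y - 1"] by auto
        then show "x = y" using * by (cases x; cases y) auto
      qed
      show "(\<lambda>x. xs ! (x - 1)) ` {0<..<m - 1} = P"
      proof
        show "(\<lambda>x. xs ! (x - 1)) ` {0<..<m - 1} \<subseteq> P" using nth by auto
        show "P \<subseteq> (\<lambda>x. xs ! (x - 1)) ` {0<..<m - 1}"
        proof
          fix p assume "p \<in> P"
          then obtain i where "i < n" "xs ! i = p" using P(4) n_def by (metis in_set_conv_nth)
          then show "p \<in> (\<lambda>x. xs ! (x - 1)) ` {0<..<m - 1}" by (intro image_eqI[of _ _ "Suc i"]) auto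
        qed
      qed
    qed
    show "((x, y) \<in> {(x, y). le x y}) = ((xs ! (x - 1), xs ! (y - 1)) \<in> r)"
      if "x \<in> {0<..<m - 1}" "y \<in> {0<..<m - 1}" for x y
      using that by (auto simp: ext_le_def rel_def)
    show "local.col x = col (xs ! (x - 1))" for x by (simp add: col_def color_def)
    show "e v \<in> {0<..<m - 1}" if "v \<in> free_vars \<phi>" for v using that \<phi> by (simp add: sentence_def)
  qed
  also have "\<dots> \<longleftrightarrow> models P r col \<phi>"
    unfolding models_def by (rule sat_cong) (use \<phi> in \<open>simp add: sentence_def\<close>)
  finally have out: "fst s 0 = (if models P r col \<phi> then 1 else 0)" using 1(3) by (simp split: split_of_bool)
  \<comment> \<open>Here \<open>m + 1\<close> is \<open>n + 3\<close>, and the poset is nonempty.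
    The factor 16 arising from the square turns 2000 into the 32000 of the bound; the five factors
    \<open>Z\<close> come from levels, representatives and the three in \<open>B\<close>.\<close>
  have "m + 1 \<le> 4 * n" using n1 by simp
  then have "(m + 1) * (m + 1) \<le> (4 * n) * (4 * n)" by (intro mult_le_mono)
  then have "Z * Z * (Z * Z) * Z * ((m + 1) * (m + 1)) \<le> Z * Z * (Z * Z) * Z * (16 * n\<^sup>2)"
    by (intro mult_le_mono2) (simp add: power2_eq_square)
  moreover have "Z * ((m + 1) * (Z * B)) = Z * Z * (Z * Z) * Z * ((m + 1) * (m + 1))"
    unfolding B_def by (simp only: ac_simps)
  ultimately have "2000 * (Z * ((m + 1) * (Z * B))) \<le> 32000 * (Z * Z * (Z * Z) * Z) * n\<^sup>2" by simp
  moreover have "120 + eval_time Z \<phi> \<le> (120 + eval_time Z \<phi>) * n\<^sup>2" using n1 by simp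
  ultimately have "t \<le> (32000 * (Z * Z * (Z * Z) * Z) + (120 + eval_time Z \<phi>)) * n\<^sup>2"
    using 1(2) unfolding add_mult_distrib by linarith
  also have "\<dots> \<le> bound w \<phi> * n\<^sup>2" using bnds(7) by (rule mult_le_mono1)
  finally show ?thesis using 1(1) out card unfolding outputs_in_def w_def by blast
qed

theorem theorem4p6:
  shows "\<exists>(p :: com) (f :: nat \<Rightarrow> nat fm \<Rightarrow> nat).
    computable f \<and>
    (\<forall>(P :: nat set) (r :: nat rel) (\<Lambda> :: nat set) (col :: nat \<Rightarrow> nat) (xs :: nat list) (\<phi> :: nat fm).
       finite P \<and> P \<noteq> {} \<and> partial_order_on P r \<and>
       finite \<Lambda> \<and> col ` P \<subseteq> \<Lambda> \<and>
       set xs = P \<and> distinct xs \<and>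
       sentence \<phi> \<and> nnf \<phi> \<and> set_fm \<phi> \<subseteq> \<Lambda> \<longrightarrow>
       (\<exists>t. outputs_in p (encode_poset xs r col @ encode_fm \<phi>) t
               (if models P r col \<phi> then 1 else 0) \<and>
            t \<le> f (width P r) \<phi> * (card P)\<^sup>2))"
proof (rule exI[of _ CHECK], rule exI[of _ bound], intro conjI allI impI)
  show "computable bound" by (rule computable_bound)
qed (elim conjE, rule CHECK_correct)

end
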